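(* Let $n\ge 3$, let $P$ be any ideal hyperbolic $n$-gon and let $P_{\mathrm{reg}}$ denote the regular ideal $n$-gon. Then: (1) There is a boundary-tight map $P\to P_{\mathrm{reg}}$ if and only if $P$ has an embedded horogon. (2) There is a boundary-tight map $P_{\mathrm{reg}}\to P$ if and only if $P$ has an immersed horogon.
   Context: The regular ideal $n$-gon is the one whose isometry group contains the full dihedral group of order $2n$. Ideal $n$-gons are considered with cyclically labeled sides, and maps between them respect the labeling of the sides. A map $f:Y\to Y'$ between hyperbolic surfaces with geodesic (possibly ideal-cornered) boundary is boundary-tight if, for some $L$, it is $L$-Lipschitz, takes $\partial Y$ onto $\partial Y'$, and is affine with stretch factor $L$ (with respect to arc length) on each geodesic of $\partial Y$; the constant $L$ is the same in all these conditions. An (immersed) horogon of an ideal polygon $P\subset\mathbb H^2$ is a choice of $n$ horocycles, one based at each ideal vertex of $P$, such that for each geodesic side of $P$ the two horocycles based at its endpoints are tangent (the horocycles are not required to be otherwise disjoint or to stay inside $P$). A horogon is embedded if its horocycles are pairwise disjoint except for these required points of consecutive tangency. *)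

theory Defs
  imports "HOL-Analysis.Analysis"
begin

text \<open>
  The hyperbolic plane is the Beltrami--Klein model: its points are the points of the open unit
  disc, its ideal points are those of the unit circle, and its geodesics are the open chords.
  Hyperbolic convexity is therefore Euclidean convexity.
\<close>

definition hyp_plane :: "complex set" where
  "hyp_plane = ball 0 1"

definition hdist :: "complex \<Rightarrow> complex \<Rightarrow> real" where
  "hdist x y = arcosh ((1 - x \<bullet> y) / sqrt ((1 - (norm x)\<^sup>2) * (1 - (norm y)\<^sup>2)))"

text \<open>
  A labelled ideal \<open>n\<close>-gon is given by its ideal vertices \<open>v 0, \<dots>, v (n - 1)\<close>, listed in cyclic
  order around the circle; \<open>s\<close> is the direction (counterclockwise or clockwise).
\<close>

definition ideal_polygon :: "nat \<Rightarrow> (nat \<Rightarrow> complex) \<Rightarrow> bool" where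
  "ideal_polygon n v \<longleftrightarrow>
    (\<exists>\<theta> :: nat \<Rightarrow> real. \<exists>s \<in> {1, -1 :: real}.
      (\<forall>i j. i < j \<and> j < n \<longrightarrow> \<theta> i < \<theta> j \<and> \<theta> j < \<theta> i + 2 * pi) \<and>
      (\<forall>i<n. v i = cis (s * \<theta> i)))"

definition region :: "nat \<Rightarrow> (nat \<Rightarrow> complex) \<Rightarrow> complex set" where
  "region n v = convex hull (v ` {..<n}) \<inter> hyp_plane"

definition side :: "nat \<Rightarrow> (nat \<Rightarrow> complex) \<Rightarrow> nat \<Rightarrow> complex set" where
  "side n v i = open_segment (v i) (v (Suc i mod n))"

definition polygon_boundary :: "nat \<Rightarrow> (nat \<Rightarrow> complex) \<Rightarrow> complex set" where
  "polygon_boundary n v = (\<Union>i<n. side n v i)"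

definition isometry_of :: "complex set \<Rightarrow> (complex \<Rightarrow> complex) \<Rightarrow> bool" where
  "isometry_of S g \<longleftrightarrow> bij_betw g S S \<and> (\<forall>x\<in>S. \<forall>y\<in>S. hdist (g x) (g y) = hdist x y)"

text \<open>
  The dihedral group of order \<open>2 * n\<close> (for \<open>n \<ge> 3\<close>), as the group of symmetries of the cyclically
  ordered labels \<open>0, \<dots>, n - 1\<close>; only the values on these labels matter.
\<close>

definition dihedral :: "nat \<Rightarrow> (nat \<Rightarrow> nat) set" where
  "dihedral n = (\<Union>k<n. {(\<lambda>i. (i + k) mod n), (\<lambda>i. (k + (n - i)) mod n)})"

definition regular_ideal_polygon :: "nat \<Rightarrow> (nat \<Rightarrow> complex) \<Rightarrow> bool" where
  "regular_ideal_polygon n v \<longleftrightarrow> ideal_polygon n v \<and>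
    (\<forall>\<sigma>\<in>dihedral n. \<exists>g. isometry_of (region n v) g \<and>
      (\<forall>i<n. g ` side n v i = side n v (\<sigma> i)))"

definition arclength_param :: "(real \<Rightarrow> complex) \<Rightarrow> complex set \<Rightarrow> bool" where
  "arclength_param \<gamma> S \<longleftrightarrow> range \<gamma> = S \<and> (\<forall>s t. hdist (\<gamma> s) (\<gamma> t) = \<bar>s - t\<bar>)"

text \<open>
  Since \<open>\<gamma>'\<close> below may be any arc length parametrization of the target side, the condition
  \<open>f (\<gamma> t) = \<gamma>' (L * t)\<close> allows an arbitrary translation, and either direction, along that side.
\<close>

definition boundary_tight ::
    "nat \<Rightarrow> (nat \<Rightarrow> complex) \<Rightarrow> (nat \<Rightarrow> complex) \<Rightarrow> (complex \<Rightarrow> complex) \<Rightarrow> bool" where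
  "boundary_tight n v w f \<longleftrightarrow>
    f ` region n v \<subseteq> region n w \<and>
    (\<forall>i<n. f ` side n v i \<subseteq> side n w i) \<and>
    (\<exists>L. (\<forall>x\<in>region n v. \<forall>y\<in>region n v. hdist (f x) (f y) \<le> L * hdist x y) \<and>
         f ` polygon_boundary n v = polygon_boundary n w \<and>
         (\<forall>i<n. \<forall>\<gamma>. arclength_param \<gamma> (side n v i) \<longrightarrow>
            (\<exists>\<gamma>'. arclength_param \<gamma>' (side n w i) \<and> (\<forall>t. f (\<gamma> t) = \<gamma>' (L * t)))))"

text \<open>
  The horocycles based at the ideal point \<open>p\<close> are the level sets of its Busemann function;
  \<open>\<lambda>t. tanh t *\<^sub>R p\<close> is the unit speed ray from the origin to \<open>p\<close>.
\<close>

definition horocycle :: "complex \<Rightarrow> real \<Rightarrow> complex set" where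
  "horocycle p c =
    {x \<in> hyp_plane. ((\<lambda>t. hdist x (tanh t *\<^sub>R p) - t) \<longlongrightarrow> c) at_top}"

text \<open>
  Two horocycles with different base points meet in zero, one or two points, and meet in
  one point precisely when they touch.
\<close>

definition tangent :: "complex set \<Rightarrow> complex set \<Rightarrow> bool" where
  "tangent H H' \<longleftrightarrow> (\<exists>x. H \<inter> H' = {x})"

definition immersed_horogon :: "nat \<Rightarrow> (nat \<Rightarrow> complex) \<Rightarrow> (nat \<Rightarrow> complex set) \<Rightarrow> bool" where
  "immersed_horogon n v H \<longleftrightarrow>
    (\<forall>i<n. \<exists>c. H i = horocycle (v i) c) \<and>
    (\<forall>i<n. tangent (H i) (H (Suc i mod n)))"

definition embedded_horogon :: "nat \<Rightarrow> (nat \<Rightarrow> complex) \<Rightarrow> (nat \<Rightarrow> complex set) \<Rightarrow> bool" where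
  "embedded_horogon n v H \<longleftrightarrow> immersed_horogon n v H \<and>
    (\<forall>i<n. \<forall>j<n. j \<noteq> i \<and> j \<noteq> Suc i mod n \<and> i \<noteq> Suc j mod n \<longrightarrow> H i \<inter> H j = {})"

lemma isometry_of_linear:
  assumes "linear g" "\<And>x. norm (g x) = norm x" "bij g" "g ` (v ` {..<n}) = v ` {..<n}"
  shows "isometry_of (region n v) g"
proof -
  have inner: "g x \<bullet> g y = x \<bullet> y" for x y
    using assms(1,2) by (simp add: dot_norm linear_add [symmetric])
  have "g ` hyp_plane = hyp_plane"
  proof -
    have "x \<in> g ` ball 0 1" if "norm x < 1" for x
      using that assms(2,3) by (metis bij_pointE dist_0_norm image_eqI mem_ball)
    then show ?thesis using assms(2) by (auto simp: hyp_plane_def)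
  qed
  then have "g ` region n v = region n v"
    unfolding region_def using assms
    by (simp add: image_Int bij_is_inj convex_hull_linear_image)
  then show ?thesis
    unfolding isometry_of_def hdist_def using assms(2,3) inner
    by (simp add: bij_betw_def bij_is_inj inj_on_def)
qed

lemma side_linear:
  assumes "linear g" "bij g"
  shows "g ` side n v i = open_segment (g (v i)) (g (v (Suc i mod n)))"
  using assms by (simp add: side_def open_segment_linear_image bij_is_inj)

lemma regular_ideal_polygon_exists:
  assumes "n \<ge> 3"
  shows "regular_ideal_polygon n (\<lambda>i. cis (2 * pi * real i / real n))"
proof -
  define v where "v = (\<lambda>i. cis (2 * pi * real i / real n))"
  have n: "n > 0" "real n > 0" using assms by auto
  have cis_int: "cis (2 * pi * of_int m) = 1" for m
    by (metis cis_multiple_2pi Ints_of_int)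
  have v_mod: "v (i mod n) = v i" for i
  proof -
    have "real i = real (i mod n) + real n * real (i div n)"
      by (metis add.commute mult_div_mod_eq of_nat_add of_nat_mult)
    then have "2 * pi * real i / real n = 2 * pi * real (i mod n) / real n + 2 * pi * of_int (int (i div n))"
      using n by (simp add: field_simps)
    then show ?thesis
      unfolding v_def using cis_int by (simp add: cis_mult [symmetric] del: of_int_of_nat_eq)
  qed
  have v_add: "v (i + j) = v i * v j" for i j
    unfolding v_def by (simp add: cis_mult add_divide_distrib distrib_left)
  have v_cnj: "v j * cnj (v i) = v (j - i)" if "i \<le> j" for i j
    using v_add [of "j - i" i] that by (simp add: v_def cis_cnj cis_mult)
  have v_n: "v n = 1" using n by (simp add: v_def)
  have norm_v: "norm (v i) = 1" for i by (simp add: v_def)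
  have bij_mult: "bij ((*) (v k))" for k
    by (rule o_bij [where g = "(*) (inverse (v k))"]) 
       (auto simp: v_def fun_eq_iff cis_mult mult.assoc [symmetric])
  have bij_cnj: "bij (\<lambda>z. v k * cnj z)" for k
  proof -
    have "bij cnj" by (rule o_bij [where g = cnj]) auto
    then have "bij ((*) (v k) \<circ> cnj)" using bij_mult by (intro bij_comp)
    then show ?thesis by (simp add: o_def)
  qed
  have im: "g ` (v ` {..<n}) = v ` {..<n}" 
    if bij: "bij g" and ex: "\<And>i. i < n \<Longrightarrow> \<exists>j. g (v i) = v j" for g
  proof (rule card_subset_eq)
    show "g ` v ` {..<n} \<subseteq> v ` {..<n}"
    proof clarify
      fix i assume "i < n"
      then obtain j where "g (v i) = v (j mod n)" using ex v_mod by metis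
      then show "g (v i) \<in> v ` {..<n}" using n by auto
    qed
    show "card (g ` v ` {..<n}) = card (v ` {..<n})"
      using bij by (meson bij_is_inj card_image inj_on_subset subset_UNIV)
  qed simp
  have "2 * pi * real j / real n < 2 * pi * real i / real n + 2 * pi" if "j < n" for i j
  proof -
    have "real j / real n < real i / real n + 1" using that n by (simp add: field_simps)
    then have "2 * pi * (real j / real n) < 2 * pi * (real i / real n + 1)"
      by (intro mult_strict_left_mono) auto
    then show ?thesis by (simp add: distrib_left)
  qed
  then have "ideal_polygon n v"
    unfolding ideal_polygon_def v_def using n
    by (intro exI [of _ "\<lambda>i. 2 * pi * real i / real n"] bexI [of _ 1])
       (auto simp: divide_strict_right_mono)
  moreover have "\<exists>g. isometry_of (region n v) g \<and> (\<forall>i<n. g ` side n v i = side n v (\<sigma> i))"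
    if \<sigma>: "\<sigma> \<in> dihedral n" for \<sigma>
  proof -
    obtain k where k: "k < n" and "\<sigma> = (\<lambda>i. (i + k) mod n) \<or> \<sigma> = (\<lambda>i. (k + (n - i)) mod n)"
      using \<sigma> unfolding dihedral_def by blast
    then consider "\<sigma> = (\<lambda>i. (i + k) mod n)" | "\<sigma> = (\<lambda>i. (k + (n - i)) mod n)" by blast
    then show ?thesis
    proof cases
      case 1
      let ?g = "(*) (v k)"
      have lin: "linear ?g" by (simp add: linear_times)
      have gv: "?g (v i) = v (i + k)" for i by (simp add: v_add)
      have "isometry_of (region n v) ?g"
      proof (rule isometry_of_linear [OF lin _ bij_mult im [OF bij_mult]])
        show "\<exists>j. v k * v i = v j" for i using gv by blast
      qed (simp add: norm_mult norm_v)
      moreover have "?g ` side n v i = side n v (\<sigma> i)" if "i < n" for i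
        unfolding side_linear [OF lin bij_mult]
        by (simp add: side_def 1 gv v_mod mod_Suc_eq)
      ultimately show ?thesis by blast
    next
      case 2
      let ?g = "\<lambda>z. v (Suc k) * cnj z"
      have lin: "linear ?g"
        by (intro linearI) (auto simp: algebra_simps)
      have gv: "?g (v i) = v (Suc k + (n - i))" if "i \<le> n" for i
      proof -
        have "Suc k + (n - i) = (Suc k + n) - i" using that by simp
        moreover have "v (Suc k + n) = v (Suc k)" using v_add [of "Suc k" n] v_n by simp
        ultimately show ?thesis using v_cnj [of i "Suc k + n"] that by simp
      qed
      have "isometry_of (region n v) ?g"
      proof (rule isometry_of_linear [OF lin _ bij_cnj im [OF bij_cnj]])
        show "\<exists>j. ?g (v i) = v j" if "i < n" for i using gv that less_imp_le by blast
      qed (simp add: norm_mult norm_v)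
      moreover have "?g ` side n v i = side n v (\<sigma> i)" if "i < n" for i
      proof -
        have 3: "Suc k + (n - Suc i) = k + (n - i)" using that by simp
        show ?thesis
          unfolding side_linear [OF lin bij_cnj]
          using gv [of i] gv [of "Suc i"] that 3
          by (simp add: side_def 2 v_mod mod_Suc_eq open_segment_commute)
      qed
      ultimately show ?thesis by blast
    qed
  qed
  ultimately show ?thesis
    unfolding regular_ideal_polygon_def v_def by blast
qed

end

theory Submission
  imports Defs
begin

text \<open>
  Boundary-tight maps transport horogons. Consecutive sides are asymptotic, so a Lipschitz map that is
  affine with factor \<open>L\<close> on them respects the horocycles through corresponding points; comparing
  distances far out in the cusps at two non-adjacent vertices, an embedded horogon of the target pulls
  back to an embedded one.

  Conversely, take an embedded horogon of the source and an immersed one of the target, and map each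
  side to the corresponding side by stretching it by \<open>L\<close> away from the tangency points. Since horocycles
  at non-adjacent vertices of the source are a positive distance apart, this boundary map is
  \<open>L\<close>-Lipschitz for large \<open>L\<close>. It extends to the polygon by the Kirszbraun--Valentine theorem, which holds
  for \<open>L \<ge> 1\<close>: if the best one-point extension had a constant \<open>l > L\<close>, its value would be a convex
  combination of the images of the extremal points, and comparing Gram matrices of tangent
  vectors gives a contradiction, because scaling a hyperbolic hinge by \<open>l \<ge> 1\<close> scales the third side
  by at least \<open>l\<close>.

  The regular polygon has an embedded horogon: a shift of the labels is realised by an isometry, hence
  there is a shift-invariant horogon, and Ptolemy's theorem bounds its other lambda lengths from below.
\<close>

section \<open>The hyperbolic distance in the Klein model\<close>

text \<open>A horocycle at an ideal point \<open>p\<close> is encoded by a weight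
  \<open>a > 0\<close>, standing for the lightlike vector \<open>a * (1, p)\<close> of Minkowski
  space. Tangency and disjointness become conditions on
  \<open>a * b * (1 - p \<bullet> q) / 2\<close>, the exponential of the signed distance between two
  horocycles, and \<open>cosh\<close> of the distance between points on two parametrised sides
  becomes a sum of four such values times exponentials. The obstacle is that compactness yields no
  Lipschitz constant for the boundary map: sides are infinite, and consecutive ones come arbitrarily
  close in the cusps. Hence the estimate is made exact. The stretch factor is an integer
  \<open>N\<close>, so that \<open>cosh (N * D)\<close> is a polynomial in \<open>cosh D\<close>
  whose superadditivity gives the bound. Values between adjacent vertices are 1 and stay 1 under
  N-th powers; those between non-adjacent vertices have to grow, which is what embeddedness
  provides. Both equivalences rest on the same construction and the same transport of weights,
  because the regular polygon itself carries an embedded horogon.\<close>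

lemma mem_hyp_plane: "x \<in> hyp_plane \<longleftrightarrow> norm x < 1"
  by (simp add: hyp_plane_def)

lemma one_minus_norm_sq_pos: "x \<in> hyp_plane \<Longrightarrow> 0 < 1 - (norm x)\<^sup>2"
  by (simp add: mem_hyp_plane abs_square_less_1)

definition hcosh :: "complex \<Rightarrow> complex \<Rightarrow> real" where
  "hcosh x y = (1 - x \<bullet> y) / sqrt ((1 - (norm x)\<^sup>2) * (1 - (norm y)\<^sup>2))"

lemma hdist_eq_arcosh: "hdist x y = arcosh (hcosh x y)"
  by (simp add: hdist_def hcosh_def)

lemma hcosh_commute: "hcosh x y = hcosh y x"
  by (simp add: hcosh_def inner_commute mult.commute)

text \<open>Reversed Cauchy-Schwarz for the Minkowski vectors \<open>(a, z)\<close> and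
  \<open>(1, p)\<close>: the left side is the negative of their Gram determinant, and the right side
  is visibly nonnegative when \<open>p\<close> lies in the disc.\<close>

lemma lorentz_gram_identity:
  fixes p z :: complex
  shows "(a - z \<bullet> p)\<^sup>2 + (1 - (norm p)\<^sup>2) * ((norm z)\<^sup>2 - a\<^sup>2)
    = (1 - (norm p)\<^sup>2) * (norm (z - a *\<^sub>R p))\<^sup>2 + (p \<bullet> (z - a *\<^sub>R p))\<^sup>2"
  unfolding power2_norm_eq_inner
  by (simp add: inner_diff_left inner_diff_right inner_commute power2_eq_square algebra_simps)

lemma inner_less_one:
  assumes "x \<in> hyp_plane" "norm y \<le> 1"
  shows "x \<bullet> y < 1"
proof -
  have "x \<bullet> y \<le> norm x * norm y" by (rule norm_cauchy_schwarz)
  also have "\<dots> \<le> norm x" using assms by (simp add: mult_left_le)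
  finally show ?thesis using assms by (simp add: mem_hyp_plane)
qed

lemma hcosh_sq_identity:
  assumes "x \<in> hyp_plane" "y \<in> hyp_plane"
  shows "(1 - x \<bullet> y)\<^sup>2 - (1 - (norm x)\<^sup>2) * (1 - (norm y)\<^sup>2)
    = (1 - (norm x)\<^sup>2) * (norm (y - x))\<^sup>2 + (x \<bullet> (y - x))\<^sup>2"
  using lorentz_gram_identity[of 1 y x] by (simp add: inner_commute algebra_simps)

lemma hcosh_ge_1:
  assumes "x \<in> hyp_plane" "y \<in> hyp_plane"
  shows "hcosh x y \<ge> 1"
proof -
  have "(1 - (norm x)\<^sup>2) * (1 - (norm y)\<^sup>2) \<le> (1 - x \<bullet> y)\<^sup>2"
    using hcosh_sq_identity[OF assms] one_minus_norm_sq_pos[OF assms(1)]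
    by (smt (verit) mult_nonneg_nonneg zero_le_power2)
  then have "sqrt ((1 - (norm x)\<^sup>2) * (1 - (norm y)\<^sup>2)) \<le> 1 - x \<bullet> y"
    using inner_less_one[OF assms(1), of y] assms(2) by (intro real_le_lsqrt) (auto simp: mem_hyp_plane)
  moreover have "0 < sqrt ((1 - (norm x)\<^sup>2) * (1 - (norm y)\<^sup>2))"
    using mult_pos_pos[OF assms[THEN one_minus_norm_sq_pos]] by simp
  ultimately show ?thesis unfolding hcosh_def by simp
qed

lemma hcosh_eq_1_imp_eq:
  assumes "x \<in> hyp_plane" "y \<in> hyp_plane" "hcosh x y = 1"
  shows "x = y"
proof -
  have p: "0 < (1 - (norm x)\<^sup>2) * (1 - (norm y)\<^sup>2)"
    using assms one_minus_norm_sq_pos by (intro mult_pos_pos) auto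
  have "1 - x \<bullet> y = sqrt ((1 - (norm x)\<^sup>2) * (1 - (norm y)\<^sup>2))"
    using assms(3) p unfolding hcosh_def by (simp add: divide_eq_1_iff)
  then have "(1 - x \<bullet> y)\<^sup>2 = (1 - (norm x)\<^sup>2) * (1 - (norm y)\<^sup>2)"
    using p by simp
  then have "(1 - (norm x)\<^sup>2) * (norm (y - x))\<^sup>2 + (x \<bullet> (y - x))\<^sup>2 = 0"
    using hcosh_sq_identity[OF assms(1,2)] by simp
  then have "(1 - (norm x)\<^sup>2) * (norm (y - x))\<^sup>2 = 0"
    using one_minus_norm_sq_pos[OF assms(1)]
    by (smt (verit) mult_nonneg_nonneg zero_le_power2)
  then show ?thesis using one_minus_norm_sq_pos[OF assms(1)] by simp
qed

lemma cosh_hdist: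
  assumes "x \<in> hyp_plane" "y \<in> hyp_plane"
  shows "cosh (hdist x y) = hcosh x y"
  using hcosh_ge_1[OF assms] by (simp add: hdist_eq_arcosh)

lemma hdist_nonneg:
  assumes "x \<in> hyp_plane" "y \<in> hyp_plane"
  shows "hdist x y \<ge> 0"
  using hcosh_ge_1[OF assms] by (simp add: hdist_eq_arcosh)

lemma hdist_commute: "hdist x y = hdist y x"
  by (simp add: hdist_eq_arcosh hcosh_commute)

lemma hcosh_self: "x \<in> hyp_plane \<Longrightarrow> hcosh x x = 1"
  using one_minus_norm_sq_pos[of x] by (simp add: hcosh_def power2_norm_eq_inner)

lemma hdist_self: "x \<in> hyp_plane \<Longrightarrow> hdist x x = 0"
  by (simp add: hdist_eq_arcosh hcosh_self)

lemma hdist_le_0_imp_eq: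
  assumes "x \<in> hyp_plane" "y \<in> hyp_plane" "hdist x y \<le> 0"
  shows "x = y"
proof -
  have "hdist x y = 0" using assms hdist_nonneg[OF assms(1,2)] by simp
  then show ?thesis using cosh_hdist[OF assms(1,2)] hcosh_eq_1_imp_eq[OF assms(1,2)] by simp
qed

lemma hdist_pos:
  assumes "x \<in> hyp_plane" "y \<in> hyp_plane" "x \<noteq> y"
  shows "0 < hdist x y"
  using hdist_le_0_imp_eq[OF assms(1,2)] assms(3) by force

lemma hdist_le_iff:
  assumes "x \<in> hyp_plane" "y \<in> hyp_plane" "0 \<le> r"
  shows "hdist x y \<le> r \<longleftrightarrow> hcosh x y \<le> cosh r"
  using cosh_real_nonneg_le_iff[OF hdist_nonneg[OF assms(1,2)] assms(3)]
  by (simp add: cosh_hdist assms)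

text \<open>\<open>(t, z) / sqrt (t\<^sup>2 - \<bar>z\<bar>\<^sup>2)\<close> is the hyperboloid lift of the Klein point \<open>z / t\<close>.\<close>

lemma hyperboloid_point:
  fixes z :: complex
  assumes "0 < t" "t\<^sup>2 - (norm z)\<^sup>2 = 1"
  shows "z /\<^sub>R t \<in> hyp_plane" "1 - (norm (z /\<^sub>R t))\<^sup>2 = 1 / t\<^sup>2"
proof -
  have "(norm (z /\<^sub>R t))\<^sup>2 = (norm z)\<^sup>2 / t\<^sup>2"
    using assms(1) by (simp add: power_mult_distrib power_inverse divide_inverse mult.commute)
  moreover have "t\<^sup>2 / t\<^sup>2 = 1" using assms(1) by simp
  ultimately show *: "1 - (norm (z /\<^sub>R t))\<^sup>2 = 1 / t\<^sup>2"
    using assms(2) by (metis diff_divide_distrib)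
  have "0 < 1 / t\<^sup>2" using assms by simp
  with * have "(norm (z /\<^sub>R t))\<^sup>2 < 1\<^sup>2" by (simp only: power_one)
  then show "z /\<^sub>R t \<in> hyp_plane" unfolding mem_hyp_plane
    by (meson power2_less_imp_less zero_le_one)
qed

lemma hcosh_hyperboloid:
  fixes z w :: complex
  assumes "0 < t" "t\<^sup>2 - (norm z)\<^sup>2 = 1" "0 < u" "u\<^sup>2 - (norm w)\<^sup>2 = 1"
  shows "hcosh (z /\<^sub>R t) (w /\<^sub>R u) = t * u - z \<bullet> w"
proof -
  have "sqrt ((1 - (norm (z /\<^sub>R t))\<^sup>2) * (1 - (norm (w /\<^sub>R u))\<^sup>2)) = 1 / (t * u)"
    unfolding hyperboloid_point(2)[OF assms(1,2)] hyperboloid_point(2)[OF assms(3,4)]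
    using assms by (simp add: real_sqrt_divide real_sqrt_mult)
  then have "hcosh (z /\<^sub>R t) (w /\<^sub>R u) = (1 - (z \<bullet> w) / (t * u)) * (t * u)"
    by (simp add: hcosh_def divide_inverse mult.commute)
  then show ?thesis
    using assms(1,3) by (simp add: left_diff_distrib)
qed

text \<open>The bracket is an inner product of tangent vectors at \<open>p\<close>: the hyperboloid
  lift of \<open>x i\<close> minus \<open>hcosh p (x i)\<close> times the lift of \<open>p\<close>
  is orthogonal to the latter. The Minkowski form is definite on that plane, so the matrix is a Gram
  matrix.\<close>

lemma hcosh_gram_nonneg:
  assumes "finite S" "p \<in> hyp_plane" "\<And>i. i \<in> S \<Longrightarrow> x i \<in> hyp_plane"
  shows "0 \<le> (\<Sum>i\<in>S. \<Sum>j\<in>S. t i * t j * (hcosh p (x i) * hcosh p (x j) - hcosh (x i) (x j)))"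
proof -
  \<comment> \<open>\<open>h y\<close> is the time coordinate of the lift
    \<open>h y * (1, y)\<close>, and \<open>(a, z)\<close> is the combination of the lifts with
    coefficients \<open>t\<close>.\<close>
  define h where "h = (\<lambda>y::complex. 1 / sqrt (1 - (norm y)\<^sup>2))"
  define a where "a = (\<Sum>i\<in>S. t i * h (x i))"
  define z where "z = (\<Sum>i\<in>S. (t i * h (x i)) *\<^sub>R x i)"
  have hc: "hcosh y w = (1 - y \<bullet> w) * h y * h w" for y w
    by (simp add: hcosh_def h_def real_sqrt_mult)
  have hp: "(h p)\<^sup>2 * (1 - (norm p)\<^sup>2) = 1"
    using one_minus_norm_sq_pos[OF assms(2)] by (simp add: h_def power_divide)
  have z1: "a - z \<bullet> p = (\<Sum>i\<in>S. t i * h (x i) * (1 - p \<bullet> x i))"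
    by (simp add: a_def z_def inner_sum_right inner_commute[of _ p] algebra_simps sum_subtractf)
  have 1: "(\<Sum>i\<in>S. t i * hcosh p (x i)) = h p * (a - z \<bullet> p)"
    by (simp add: z1 hc sum_distrib_left algebra_simps)
  have 2: "(\<Sum>i\<in>S. \<Sum>j\<in>S. t i * t j * hcosh (x i) (x j)) = a\<^sup>2 - (norm z)\<^sup>2"
    unfolding power2_norm_eq_inner unfolding power2_eq_square a_def z_def sum_product inner_sum_left
    unfolding inner_sum_right sum_subtractf[symmetric]
    by (intro sum.cong refl) (simp only: hc inner_scaleR_left inner_scaleR_right, algebra)
  have "(\<Sum>i\<in>S. \<Sum>j\<in>S. t i * t j * (hcosh p (x i) * hcosh p (x j) - hcosh (x i) (x j)))
      = (\<Sum>i\<in>S. t i * hcosh p (x i))\<^sup>2 - (\<Sum>i\<in>S. \<Sum>j\<in>S. t i * t j * hcosh (x i) (x j))"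
    unfolding power2_eq_square sum_product
    by (simp add: sum_subtractf[symmetric] algebra_simps)
  also have "\<dots> = (h p)\<^sup>2 * ((a - z \<bullet> p)\<^sup>2 + (1 - (norm p)\<^sup>2) * ((norm z)\<^sup>2 - a\<^sup>2))"
    unfolding 1 2 distrib_left mult.assoc[symmetric] hp by (simp add: power_mult_distrib)
  also have "\<dots> \<ge> 0"
    unfolding lorentz_gram_identity using one_minus_norm_sq_pos[OF assms(2)] by simp
  finally show ?thesis .
qed

section \<open>Hyperbolic functions under scaling of the argument\<close>

lemma sinh_power_le:
  assumes "0 \<le> (x::real)"
  shows "2 ^ n * sinh x ^ Suc n \<le> sinh (real (Suc n) * x)"
proof (induction n)
  case (Suc n)
  define y where "y = real (Suc n) * x"
  have y: "0 \<le> y" "2 ^ n * sinh x ^ Suc n \<le> sinh y" using Suc assms by (simp_all add: y_def)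
  have c: "sinh x \<le> cosh x" "sinh y \<le> cosh y" by (simp_all add: sinh_le_cosh_real)
  have "2 ^ Suc n * sinh x ^ Suc (Suc n) = 2 * sinh x * (2 ^ n * sinh x ^ Suc n)" by simp
  also have "\<dots> \<le> 2 * sinh x * sinh y"
    using y(2) assms by (intro mult_left_mono) auto
  \<comment> \<open>Replacing one \<open>sinh\<close> by \<open>cosh\<close> in each of two copies
    of the product gives the two terms of the addition formula.\<close>
  also have "\<dots> \<le> sinh y * cosh x + cosh y * sinh x"
    using mult_left_mono[OF c(1), of "sinh y"] mult_right_mono[OF c(2), of "sinh x"] assms y(1)
    by (simp add: algebra_simps)
  also have "\<dots> = sinh (y + x)" by (simp add: sinh_add)
  also have "\<dots> = sinh (real (Suc (Suc n)) * x)"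
    by (simp add: y_def distrib_right)
  finally show ?case .
qed simp

lemma cosh_diff_eq: "cosh a - cosh (b::real) = 2 * (sinh ((a + b) / 2) * sinh ((a - b) / 2))"
proof -
  have "cosh ((a+b)/2 + (a-b)/2) - cosh ((a+b)/2 - (a-b)/2) = 2 * (sinh ((a + b) / 2) * sinh ((a - b) / 2))"
    by (simp only: cosh_add cosh_diff)
  then show ?thesis by (simp add: field_simps)
qed

text \<open>A superadditivity of the Chebyshev polynomials \<open>cosh D \<mapsto> cosh (N D)\<close> on \<open>[1, \<infinity>)\<close>.\<close>

lemma cosh_mult_superadditive:
  fixes D r B :: real
  assumes "0 \<le> D" "0 \<le> B" "cosh D = cosh r + B" "1 \<le> N"
  shows "cosh (real N * r) + (2 * B) ^ N / 2 \<le> cosh (real N * D)"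
proof -
  obtain n where N: "N = Suc n" using assms(4) by (cases N) auto
  have "\<bar>r\<bar> \<le> D"
    using assms cosh_real_nonneg_le_iff[of "\<bar>r\<bar>" D] by simp
  then have nn: "0 \<le> (D + r) / 2" "0 \<le> (D - r) / 2" by auto
  let ?p = "sinh ((D + r) / 2)" and ?q = "sinh ((D - r) / 2)"
  have B: "B = 2 * (?p * ?q)" using assms cosh_diff_eq[of D r] by simp
  \<comment> \<open>\<open>(2 * B) ^ N / 2\<close> is the leading term of the N-th Chebyshev
    polynomial at \<open>B\<close>. Factoring both differences of \<open>cosh\<close> into products
    of \<open>sinh\<close> reduces the claim to the power bound for each factor.\<close>
  have "(2 * B) ^ N / 2 = 2 * ((2 ^ n * ?p ^ Suc n) * (2 ^ n * ?q ^ Suc n))"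
    by (simp add: B N power_mult_distrib power_mult[symmetric]) (simp flip: power_mult_distrib)
  also have "\<dots> \<le> 2 * (sinh (real N * ((D + r) / 2)) * sinh (real N * ((D - r) / 2)))"
    unfolding N by (intro mult_left_mono mult_mono sinh_power_le) (use nn in auto)
  also have "\<dots> = cosh (real N * D) - cosh (real N * r)"
    unfolding cosh_diff_eq[of "real N * D"] by (simp add: algebra_simps)
  finally show ?thesis by simp
qed

text \<open>\<open>?k\<close> is the numerator of the derivative of
  \<open>sinh (l * x) / sinh x\<close>. It vanishes at 0, and its own derivative
  \<open>(l\<^sup>2 - 1) * sinh (l * x) * sinh x\<close> is nonnegative because
  \<open>l >= 1\<close>.\<close>

lemma sinh_ratio_mono:
  fixes l c d :: real
  assumes "1 \<le> l" "0 < c" "c \<le> d"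
  shows "sinh (l * c) * sinh d \<le> sinh (l * d) * sinh c"
proof -
  let ?k = "\<lambda>x. l * cosh (l * x) * sinh x - sinh (l * x) * cosh x"
  have k0: "0 \<le> ?k x" if "0 \<le> x" for x
  proof -
    have "?k 0 \<le> ?k x"
    proof (rule DERIV_nonneg_imp_nondecreasing[OF that])
      fix y :: real assume y: "0 \<le> y" "y \<le> x"
      have "(?k has_real_derivative (l\<^sup>2 - 1) * sinh (l * y) * sinh y) (at y)"
        by (auto intro!: derivative_eq_intros simp: power2_eq_square algebra_simps)
      moreover have "0 \<le> (l\<^sup>2 - 1) * sinh (l * y) * sinh y"
        using y assms(1) by (intro mult_nonneg_nonneg) auto
      ultimately show "\<exists>z. (?k has_real_derivative z) (at y) \<and> 0 \<le> z" by blast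
    qed
    then show ?thesis by simp
  qed
  let ?g = "\<lambda>x. sinh (l * x) / sinh x"
  have "?g c \<le> ?g d"
  proof (rule DERIV_nonneg_imp_nondecreasing[OF assms(3)])
    fix y assume y: "c \<le> y" "y \<le> d"
    have "(?g has_real_derivative ?k y / (sinh y)\<^sup>2) (at y)"
      using y assms by (auto intro!: derivative_eq_intros simp: power2_eq_square algebra_simps)
    then show "\<exists>z. (?g has_real_derivative z) (at y) \<and> 0 \<le> z"
      using k0[of y] y assms by (intro exI[of _ "?k y / (sinh y)\<^sup>2"] conjI) auto
  qed
  then show ?thesis using assms by (simp add: field_simps)
qed

text \<open>For \<open>l >= 1\<close>, \<open>cosh (l * d)\<close> is a convex function of the
  variable \<open>cosh d\<close>; \<open>m\<close> is the slope of a supporting line at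
  \<open>cosh c\<close>, for positive \<open>c\<close> the derivative
  \<open>l * sinh (l * c) / sinh c\<close>.\<close>

lemma cosh_mult_tangent:
  fixes l c :: real
  assumes "1 \<le> l" "0 \<le> c"
  obtains m where "\<And>d. 0 \<le> d \<Longrightarrow> cosh (l * c) + m * (cosh d - cosh c) \<le> cosh (l * d)"
proof (cases "c = 0")
  case True
  \<comment> \<open>At \<open>c = 0\<close> the quotient for the slope degenerates; slope 0 supports
    the graph since \<open>cosh\<close> is at least 1.\<close>
  show ?thesis by (rule that[of 0]) (simp add: True cosh_real_ge_1)
next
  case False
  then have c: "0 < c" using assms by simp
  define m where "m = l * sinh (l * c) / sinh c"
  let ?f = "\<lambda>x. cosh (l * x) - m * cosh x"
  have der: "(?f has_real_derivative l / sinh c * (sinh (l * x) * sinh c - sinh (l * c) * sinh x)) (at x)" for x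
    using c by (auto intro!: derivative_eq_intros simp: m_def field_simps)
  have lp: "0 < l / sinh c" using c assms by simp
  have "?f c \<le> ?f d" if d: "0 \<le> d" for d
  proof (cases "c \<le> d")
    case True
    show ?thesis
    proof (rule DERIV_nonneg_imp_nondecreasing[OF True])
      fix y assume y: "c \<le> y" "y \<le> d"
      have "0 \<le> l / sinh c * (sinh (l * y) * sinh c - sinh (l * c) * sinh y)"
        using sinh_ratio_mono[OF assms(1) c y(1)] lp by (intro mult_nonneg_nonneg) auto
      then show "\<exists>z. (?f has_real_derivative z) (at y) \<and> 0 \<le> z" using der by blast
    qed
  next
    case False
    then have "d \<le> c" by simp
    show ?thesis
    proof (rule DERIV_nonpos_imp_nonincreasing[OF \<open>d \<le> c\<close>])
      fix y assume y: "d \<le> y" "y \<le> c"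
      have "sinh (l * y) * sinh c - sinh (l * c) * sinh y \<le> 0"
      proof (cases "y = 0")
        case False
        then have "0 < y" using y d by simp
        then show ?thesis using sinh_ratio_mono[OF assms(1) _ y(2)] by simp
      qed simp
      then have "l / sinh c * (sinh (l * y) * sinh c - sinh (l * c) * sinh y) \<le> 0"
        using lp by (intro mult_nonneg_nonpos) auto
      then show "\<exists>z. (?f has_real_derivative z) (at y) \<and> z \<le> 0" using der by blast
    qed
  qed
  then show ?thesis by (intro that[of m]) (simp add: algebra_simps)
qed

lemma cosh_mult_convex:
  fixes l a b c u :: real
  assumes "1 \<le> l" "0 \<le> u" "u \<le> 1" "cosh c = u * cosh a + (1 - u) * cosh b"
  shows "cosh (l * c) \<le> u * cosh (l * a) + (1 - u) * cosh (l * b)"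
proof -
  obtain m where m: "\<And>d. 0 \<le> d \<Longrightarrow> cosh (l * \<bar>c\<bar>) + m * (cosh d - cosh \<bar>c\<bar>) \<le> cosh (l * d)"
    using cosh_mult_tangent[OF assms(1), of "\<bar>c\<bar>"] by auto
  have abs: "cosh (l * \<bar>x\<bar>) = cosh (l * x)" for x
    using assms(1) by (metis abs_mult abs_of_nonneg cosh_real_abs order_trans zero_le_one)
  have t: "cosh (l * c) + m * (cosh d - cosh c) \<le> cosh (l * d)" for d
    using m[of "\<bar>d\<bar>"] by (simp add: abs)
  have "cosh (l * c) = u * (cosh (l * c) + m * (cosh a - cosh c)) + (1 - u) * (cosh (l * c) + m * (cosh b - cosh c))"
    unfolding assms(4) by algebra
  also have "\<dots> \<le> u * cosh (l * a) + (1 - u) * cosh (l * b)"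
    using assms t by (intro add_mono mult_left_mono) auto
  finally show ?thesis .
qed

text \<open>The inequality says that scaling a hinge by \<open>l \<ge> 1\<close> scales the opposite side by at least \<open>l\<close>.\<close>

lemma hinge_scaling:
  fixes l r r' c :: real
  assumes "1 \<le> l" "0 < r" "0 < r'" "\<bar>cosh r * cosh r' - cosh c\<bar> \<le> sinh r * sinh r'"
  shows "(cosh r * cosh r' - cosh c) / (sinh r * sinh r') * (sinh (l * r) * sinh (l * r'))
    \<le> cosh (l * r) * cosh (l * r') - cosh (l * c)"
proof -
  \<comment> \<open>\<open>k\<close> is the cosine of the hinge angle. By the law of cosines
    \<open>cosh c\<close> is the average of \<open>cosh (r - r')\<close> and
    \<open>cosh (r + r')\<close>, the two flat hinges, with weights \<open>(1 + k) / 2\<close> and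
    \<open>(1 - k) / 2\<close>, so convexity applies.\<close>
  define k where "k = (cosh r * cosh r' - cosh c) / (sinh r * sinh r')"
  have s: "0 < sinh r * sinh r'" using assms by simp
  have k: "\<bar>k\<bar> \<le> 1" unfolding k_def abs_divide using assms(4) s by (simp only: divide_le_eq_1 abs_of_pos simp_thms)
  have ks: "cosh c = cosh r * cosh r' - k * (sinh r * sinh r')" unfolding k_def using s by (subst times_divide_eq_left, subst nonzero_mult_div_cancel_right) auto
  have "cosh (l * c) \<le> (1 + k) / 2 * cosh (l * (r - r')) + (1 - (1 + k) / 2) * cosh (l * (r + r'))"
    by (rule cosh_mult_convex) (use k assms in \<open>auto simp: ks cosh_add cosh_diff field_simps\<close>)
  then show ?thesis
    by (fold k_def) (simp add: right_diff_distrib distrib_left cosh_add cosh_diff field_simps)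
qed

section \<open>Compact hyperbolic balls and weighted centres\<close>

lemma continuous_on_hcosh: "continuous_on hyp_plane (\<lambda>q. hcosh q y)" if "y \<in> hyp_plane"
  unfolding hcosh_def
  by (intro continuous_intros) (use that one_minus_norm_sq_pos in force)

lemma continuous_on_hdist: "continuous_on hyp_plane (\<lambda>q. hdist q y)" if "y \<in> hyp_plane"
  unfolding hdist_eq_arcosh
  by (rule continuous_on_compose2[OF continuous_on_arcosh[OF order_refl] continuous_on_hcosh[OF that]])
    (use that hcosh_ge_1 in auto)

lemma compact_hyperbolic_ball:
  assumes y: "y \<in> hyp_plane"
  shows "compact {q \<in> hyp_plane. hdist q y \<le> r}"
proof -
  define C where "C = cosh r"
  define k where "k = 1 - (norm y)\<^sup>2"
  \<comment> \<open>Solving \<open>1 - norm y <= C * sqrt ((1 - (norm q)\<^sup>2) * k)\<close> for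
    \<open>1 - (norm q)\<^sup>2\<close> gives the lower bound \<open>d\<close>: the ball lies in a
    smaller closed disc, on which the distance is continuous.\<close>
  define d where "d = ((1 - norm y) / C)\<^sup>2 / k"
  have C: "0 < C" and k: "0 < k" and d: "0 < d"
    using y one_minus_norm_sq_pos[OF y] by (auto simp: C_def d_def k_def mem_hyp_plane)
  have bound: "(norm q)\<^sup>2 \<le> 1 - d" if q: "q \<in> hyp_plane" "hdist q y \<le> r" for q
  proof -
    have "0 \<le> r" using hdist_nonneg[OF q(1) y] q by simp
    then have "hcosh q y \<le> C" using hdist_le_iff[OF q(1) y] q by (simp add: C_def)
    moreover have s: "0 < sqrt ((1 - (norm q)\<^sup>2) * k)"
      using one_minus_norm_sq_pos[OF q(1)] k by simp
    ultimately have "1 - q \<bullet> y \<le> C * sqrt ((1 - (norm q)\<^sup>2) * k)"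
      by (simp add: hcosh_def k_def divide_le_eq)
    moreover have "q \<bullet> y \<le> norm y"
    proof -
      have "q \<bullet> y \<le> norm q * norm y" by (rule norm_cauchy_schwarz)
      also have "\<dots> \<le> 1 * norm y" using q by (intro mult_right_mono) (auto simp: mem_hyp_plane)
      finally show ?thesis by simp
    qed
    ultimately have "(1 - norm y) / C \<le> sqrt ((1 - (norm q)\<^sup>2) * k)"
      using C by (simp add: divide_le_eq mult.commute)
    then have "((1 - norm y) / C)\<^sup>2 \<le> (sqrt ((1 - (norm q)\<^sup>2) * k))\<^sup>2"
      using y C by (intro power_mono) (auto simp: mem_hyp_plane)
    also have "\<dots> = (1 - (norm q)\<^sup>2) * k"
      using s by simp
    finally have "d \<le> 1 - (norm q)\<^sup>2"
      using k by (simp add: d_def divide_le_eq)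
    then show ?thesis by simp
  qed
  have sub: "{q. (norm q)\<^sup>2 \<le> 1 - d} \<subseteq> hyp_plane"
  proof
    fix q assume "q \<in> {q::complex. (norm q)\<^sup>2 \<le> 1 - d}"
    then have "(norm q)\<^sup>2 < 1\<^sup>2" using d by simp
    then show "q \<in> hyp_plane" unfolding mem_hyp_plane by (rule power2_less_imp_less) simp
  qed
  have cl: "closed {q::complex. (norm q)\<^sup>2 \<le> 1 - d}"
    by (intro closed_Collect_le continuous_intros)
  have "{q. (norm q)\<^sup>2 \<le> 1 - d} \<subseteq> ball (0::complex) 1"
    using sub by (simp add: hyp_plane_def)
  then have "bounded {q::complex. (norm q)\<^sup>2 \<le> 1 - d}"
    using bounded_ball bounded_subset by blast
  moreover have "closed ({q. (norm q)\<^sup>2 \<le> 1 - d} \<inter> (\<lambda>q. hdist q y) -` {..r})"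
    by (rule continuous_closed_preimage[OF continuous_on_subset[OF continuous_on_hdist[OF y] sub] cl]) simp
  ultimately have "compact ({q. (norm q)\<^sup>2 \<le> 1 - d} \<inter> (\<lambda>q. hdist q y) -` {..r})"
    by (simp add: compact_eq_bounded_closed bounded_Int)
  moreover have "{q. (norm q)\<^sup>2 \<le> 1 - d} \<inter> (\<lambda>q. hdist q y) -` {..r} = {q \<in> hyp_plane. hdist q y \<le> r}"
    using bound sub by auto
  ultimately show ?thesis by simp
qed

lemma hdist_less_iff:
  assumes "x \<in> hyp_plane" "y \<in> hyp_plane" "x' \<in> hyp_plane" "y' \<in> hyp_plane"
  shows "hdist x y < hdist x' y' \<longleftrightarrow> hcosh x y < hcosh x' y'"
  unfolding hdist_eq_arcosh using hcosh_ge_1 assms by simp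

lemma hcosh_sq:
  assumes "x \<in> hyp_plane" "y \<in> hyp_plane"
  shows "(hcosh x y)\<^sup>2 = (1 - x \<bullet> y)\<^sup>2 / (1 - (norm x)\<^sup>2) / (1 - (norm y)\<^sup>2)"
  using assms[THEN one_minus_norm_sq_pos] by (simp add: hcosh_def power_divide)

text \<open>\<open>n - (q \<bullet> n) *\<^sub>R q\<close> is the hyperbolic gradient at \<open>q\<close> of a function with Euclidean gradient \<open>n\<close>, up to scale.\<close>

lemma hdist_decreases:
  assumes q: "q \<in> hyp_plane" and y: "y \<in> hyp_plane" and n: "0 < n \<bullet> (y - q)"
  shows "\<forall>\<^sub>F e in at_right 0. hdist (q + e *\<^sub>R (n - (q \<bullet> n) *\<^sub>R q)) y < hdist q y"
proof -
  define w where "w = n - (q \<bullet> n) *\<^sub>R q"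
  define N where "N = (\<lambda>e. (1 - q \<bullet> y) - e * (w \<bullet> y))"
  define D where "D = (\<lambda>e. 1 - q \<bullet> q - 2 * e * (q \<bullet> w) - e\<^sup>2 * (w \<bullet> w))"
  have ND: "N e = 1 - (q + e *\<^sub>R w) \<bullet> y" "D e = 1 - (norm (q + e *\<^sub>R w))\<^sup>2" for e
    unfolding power2_norm_eq_inner
    by (auto simp: N_def D_def inner_add_left inner_add_right inner_commute
        power2_eq_square algebra_simps)
  have D0: "0 < D 0" "D 0 = 1 - q \<bullet> q" using ND(2)[of 0] one_minus_norm_sq_pos[OF q] by (auto simp: D_def)
  have N0: "0 < N 0" using inner_less_one[OF q, of y] y by (simp add: N_def mem_hyp_plane)
  \<comment> \<open>The squared \<open>hcosh\<close> from the moved point to \<open>y\<close>, up to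
    the constant factor \<open>1 - (norm y)\<^sup>2\<close>; this avoids the square root and
    \<open>arcosh\<close>.\<close>
  define g where "g = (\<lambda>e. (N e)\<^sup>2 / D e)"
  have der: "(g has_real_derivative (2 * N 0 * (- (w \<bullet> y)) * D 0 - (N 0)\<^sup>2 * (- 2 * (q \<bullet> w))) / (D 0)\<^sup>2) (at 0)"
    unfolding g_def N_def D_def using D0
    by (auto intro!: derivative_eq_intros simp: power2_eq_square)
  have "2 * N 0 * (- (w \<bullet> y)) * D 0 - (N 0)\<^sup>2 * (- 2 * (q \<bullet> w)) = 2 * N 0 * (N 0 * (q \<bullet> w) - (w \<bullet> y) * D 0)"
    by (simp add: power2_eq_square algebra_simps)
  \<comment> \<open>The multiple of \<open>q\<close> subtracted from \<open>n\<close> is what turns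
    this into a negative multiple of \<open>n \<bullet> (y - q)\<close>.\<close>
  also have "N 0 * (q \<bullet> w) - (w \<bullet> y) * D 0 = - (D 0 * (n \<bullet> (y - q)))"
    by (simp add: w_def N_def D_def inner_diff_left inner_diff_right inner_commute power2_eq_square algebra_simps)
  finally have "(2 * N 0 * (- (w \<bullet> y)) * D 0 - (N 0)\<^sup>2 * (- 2 * (q \<bullet> w))) / (D 0)\<^sup>2 < 0"
    using D0 N0 n by (simp add: divide_neg_pos mult_pos_pos)
  from DERIV_neg_dec_right[OF der this] obtain d
    where d: "0 < d" "\<And>h. 0 < h \<Longrightarrow> h < d \<Longrightarrow> g h < g 0" by auto
  have ev: "\<forall>\<^sub>F e in at_right 0. 0 < D e \<and> 0 < N e"
  proof -
    have "(D \<longlongrightarrow> D 0) (at_right 0)" "(N \<longlongrightarrow> N 0) (at_right 0)"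
      unfolding D_def N_def by (intro tendsto_eq_intros | simp)+
    then show ?thesis
      using D0(1) N0 by (auto dest: order_tendstoD(1) intro: eventually_conj)
  qed
  have ev2: "\<forall>\<^sub>F e in at_right 0. 0 < e \<and> e < d"
    using d(1) by (auto simp: eventually_at_right_field)
  show ?thesis
    using eventually_conj[OF ev ev2]
  proof (rule eventually_mono, fold w_def)
    fix e assume e: "(0 < D e \<and> 0 < N e) \<and> 0 < e \<and> e < d"
    have qe: "q + e *\<^sub>R w \<in> hyp_plane"
      using e unfolding ND mem_hyp_plane
      by (metis diff_gt_0_iff_gt one_power2 power2_less_imp_less zero_le_one)
    have "(hcosh (q + e *\<^sub>R w) y)\<^sup>2 < (hcosh q y)\<^sup>2"
      using d(2)[of e] e ND[of e] ND[of 0] one_minus_norm_sq_pos[OF y]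
      unfolding hcosh_sq[OF qe y] hcosh_sq[OF q y]
      by (intro divide_strict_right_mono) (auto simp: g_def)
    then have "hcosh (q + e *\<^sub>R w) y < hcosh q y"
      using hcosh_ge_1[OF q y] by (meson order_trans power2_less_imp_less zero_le_one)
    then show "hdist (q + e *\<^sub>R w) y < hdist q y"
      using hdist_less_iff qe q y by simp
  qed
qed

lemma continuous_on_Max:
  fixes f :: "'i \<Rightarrow> 'a::topological_space \<Rightarrow> real"
  assumes "finite I" "I \<noteq> {}" "\<And>i. i \<in> I \<Longrightarrow> continuous_on A (f i)"
  shows "continuous_on A (\<lambda>x. Max ((\<lambda>i. f i x) ` I))"
  using assms
proof (induction I rule: finite_ne_induct)
  case (insert i I)
  have "(\<lambda>x. Max ((\<lambda>i. f i x) ` insert i I)) = (\<lambda>x. max (f i x) (Max ((\<lambda>i. f i x) ` I)))"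
    using insert by (simp add: fun_eq_iff)
  then show ?case using insert by (simp add: continuous_on_max)
qed simp

text \<open>\<open>q\<close> minimises the largest ratio \<open>hdist q y / r\<close>. If it were
  outside the hull of the points attaining the maximum, a separating line would give a direction
  lowering all tight distances at once. The Klein model allows the Euclidean hull here.\<close>

lemma weighted_center_exists:
  assumes "finite F" "F \<noteq> {}" and F: "\<And>y r. (y, r) \<in> F \<Longrightarrow> y \<in> hyp_plane \<and> 0 < r"
  obtains q l where "q \<in> hyp_plane" "\<And>y r. (y, r) \<in> F \<Longrightarrow> hdist q y \<le> l * r"
    "q \<in> convex hull {y. \<exists>r. (y, r) \<in> F \<and> hdist q y = l * r}"
proof -
  define G where "G = (\<lambda>q. Max ((\<lambda>(y, r). hdist q y / r) ` F))"
  have G_le: "G q \<le> m \<longleftrightarrow> (\<forall>(y, r) \<in> F. hdist q y \<le> m * r)" for q m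
  proof -
    have "G q \<le> m \<longleftrightarrow> (\<forall>(y, r) \<in> F. hdist q y / r \<le> m)"
      unfolding G_def using assms(1,2) by (subst Max_le_iff) auto
    also have "\<dots> \<longleftrightarrow> (\<forall>(y, r) \<in> F. hdist q y \<le> m * r)"
      using F by (intro ball_cong refl) (auto simp: divide_le_eq dest: F split: prod.splits)
    finally show ?thesis .
  qed
  have G_less: "G q < m \<longleftrightarrow> (\<forall>(y, r) \<in> F. hdist q y < m * r)" for q m
  proof -
    have "G q < m \<longleftrightarrow> (\<forall>(y, r) \<in> F. hdist q y / r < m)"
      unfolding G_def using assms(1,2) by (subst Max_less_iff) auto
    also have "\<dots> \<longleftrightarrow> (\<forall>(y, r) \<in> F. hdist q y < m * r)"
      using F by (intro ball_cong refl) (auto simp: divide_less_eq dest: F split: prod.splits)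
    finally show ?thesis .
  qed
  have contG: "continuous_on hyp_plane G"
    unfolding G_def
  proof (rule continuous_on_Max[OF assms(1,2)])
    fix i assume "i \<in> F"
    then show "continuous_on hyp_plane (\<lambda>x. case i of (y, r) \<Rightarrow> hdist x y / r)"
      using F by (cases i) (force intro!: continuous_intros continuous_on_hdist)
  qed
  have 0: "(0::complex) \<in> hyp_plane" by (simp add: mem_hyp_plane)
  \<comment> \<open>The disc is not compact, so the minimum is sought on a sublevel set, which lies
    in a single hyperbolic ball.\<close>
  define S where "S = {q \<in> hyp_plane. G q \<le> G 0}"
  have "compact S"
  proof -
    obtain y r where yr: "(y, r) \<in> F" using assms(2) by auto
    let ?B = "{q \<in> hyp_plane. hdist q y \<le> G 0 * r}"
    have sub: "?B \<subseteq> hyp_plane" by auto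
    have "S \<subseteq> ?B" using yr by (auto simp: S_def G_le)
    then have S: "S = ?B \<inter> G -` {..G 0}" using sub by (auto simp: S_def)
    have cB: "compact ?B" using compact_hyperbolic_ball F[OF yr] by blast
    moreover have "closed S" unfolding S
      by (rule continuous_closed_preimage[OF continuous_on_subset[OF contG sub] compact_imp_closed[OF cB]]) simp
    ultimately show ?thesis unfolding S by (metis Int_absorb1 Int_lower1 compact_Int_closed inf.absorb_iff2)
  qed
  moreover have "S \<noteq> {}" using 0 by (auto simp: S_def)
  moreover have "continuous_on S G" by (rule continuous_on_subset[OF contG]) (auto simp: S_def)
  ultimately obtain q where q: "q \<in> S" "\<And>q'. q' \<in> S \<Longrightarrow> G q \<le> G q'"
    using continuous_attains_inf by metis
  have qh: "q \<in> hyp_plane" using q by (simp add: S_def)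
  have min: "G q \<le> G q'" if "q' \<in> hyp_plane" for q'
    using q(2)[of q'] q(1) that by (cases "G q' \<le> G 0") (auto simp: S_def)
  define l where "l = G q"
  have le: "hdist q y \<le> l * r" if "(y, r) \<in> F" for y r
    using G_le[of q l] that by (auto simp: l_def)
  let ?Y = "{y. \<exists>r. (y, r) \<in> F \<and> hdist q y = l * r}"
  have finY: "finite ?Y" by (rule finite_subset[of _ "fst ` F"]) (use assms(1) in force)+
  have "q \<in> convex hull ?Y"
  proof (rule ccontr)
    assume "q \<notin> convex hull ?Y"
    then obtain n b where nb: "n \<bullet> q < b" "\<forall>x\<in>convex hull ?Y. b < n \<bullet> x"
      using separating_hyperplane_closed_point[of "convex hull ?Y" q] finY
      by (meson compact_imp_closed convex_convex_hull finite_imp_compact_convex_hull)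
    define w where "w = n - (q \<bullet> n) *\<^sub>R q"
    have lim: "((\<lambda>e. q + e *\<^sub>R w) \<longlongrightarrow> q) (at_right 0)"
      by (intro tendsto_eq_intros | simp)+
    have evh: "\<forall>\<^sub>F e in at_right 0. q + e *\<^sub>R w \<in> hyp_plane"
      using topological_tendstoD[OF lim, of hyp_plane] qh by (simp add: hyp_plane_def)
    \<comment> \<open>Tight constraints improve along \<open>w\<close>, slack ones survive a small
      step by continuity, and finiteness of \<open>F\<close> gives a common step.\<close>
    have "\<forall>\<^sub>F e in at_right 0. \<forall>(y, r) \<in> F. hdist (q + e *\<^sub>R w) y < l * r"
    proof (rule eventually_ball_finite[OF assms(1)], clarify)
      fix y r assume yr: "(y, r) \<in> F"
      have y: "y \<in> hyp_plane" using F[OF yr] by simp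
      show "\<forall>\<^sub>F e in at_right 0. hdist (q + e *\<^sub>R w) y < l * r"
      proof (cases "hdist q y = l * r")
        case True
        then have "y \<in> convex hull ?Y" using yr by (intro hull_inc) auto
        then have "0 < n \<bullet> (y - q)" using nb by (force simp: inner_diff_right)
        from hdist_decreases[OF qh y this] show ?thesis using True by (simp add: w_def)
      next
        case False
        then have *: "hdist q y < l * r" using le[OF yr] by simp
        have "isCont (\<lambda>q. hdist q y) q"
          using continuous_on_hdist[OF y] qh by (simp add: hyp_plane_def continuous_on_eq_continuous_at)
        then have "((\<lambda>e. hdist (q + e *\<^sub>R w) y) \<longlongrightarrow> hdist q y) (at_right 0)"
          using lim by (rule isCont_tendsto_compose)
        then show ?thesis using * by (rule order_tendstoD(2))
      qed
    qed
    then have "\<forall>\<^sub>F e in at_right 0. q + e *\<^sub>R w \<in> hyp_plane \<and> G (q + e *\<^sub>R w) < l"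
      using evh by eventually_elim (simp add: G_less)
    then obtain e where "q + e *\<^sub>R w \<in> hyp_plane" "G (q + e *\<^sub>R w) < l"
      using eventually_happens'[OF trivial_limit_at_right_real] by blast
    then show False using min[of "q + e *\<^sub>R w"] by (simp add: l_def)
  qed
  then show ?thesis using that[of q l] qh le by blast
qed

text \<open>Cauchy-Schwarz for the two tangent vectors at \<open>p\<close>, whose lengths are the
  two \<open>sinh\<close> values: the cosine of a hinge angle lies in
  \<open>[-1, 1]\<close>.\<close>

lemma hinge_bound:
  assumes "p \<in> hyp_plane" "x \<in> hyp_plane" "y \<in> hyp_plane"
  shows "\<bar>cosh (hdist p x) * cosh (hdist p y) - cosh (hdist x y)\<bar> \<le> sinh (hdist p x) * sinh (hdist p y)"
proof (cases "x = y")
  case True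
  then show ?thesis
    using assms cosh_square_eq[of "hdist p y"] by (simp add: hdist_self power2_eq_square[symmetric])
next
  case False
  define A where "A = (sinh (hdist p x))\<^sup>2"
  define C where "C = (sinh (hdist p y))\<^sup>2"
  define B where "B = cosh (hdist p x) * cosh (hdist p y) - cosh (hdist x y)"
  have q: "0 \<le> s * s * A + 2 * s * t * B + t * t * C" for s t
  proof -
    have "0 \<le> (\<Sum>i\<in>{x,y}. \<Sum>j\<in>{x,y}. (if i = x then s else t) * (if j = x then s else t) *
        (hcosh p i * hcosh p j - hcosh i j))"
      by (rule hcosh_gram_nonneg[where x = "\<lambda>i. i"]) (use assms in auto)
    also have "\<dots> = s * s * A + 2 * s * t * B + t * t * C"
      using False assms hcosh_commute[of y x] unfolding A_def B_def C_def sinh_square_eq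
      by (simp add: cosh_hdist hcosh_self power2_eq_square algebra_simps)
    finally show ?thesis .
  qed
  have nn: "0 \<le> sinh (hdist p x)" "0 \<le> sinh (hdist p y)" using hdist_nonneg assms by auto
  have "B\<^sup>2 \<le> A * C"
  proof (cases "C = 0")
    case True
    \<comment> \<open>With \<open>C = 0\<close> the form is affine in \<open>t\<close>; at
      \<open>s = B\<close>, \<open>t = - (A + 1)\<close> it equals
      \<open>- (B\<^sup>2 * (A + 2))\<close>, so \<open>B\<close> vanishes.\<close>
    have "0 \<le> B * B * A + 2 * B * (- (A + 1) ) * B" using q[of B "- (A + 1)"] True by simp
    also have "\<dots> = - (B\<^sup>2 * (A + 2))" by (simp add: power2_eq_square algebra_simps)
    finally have "B\<^sup>2 * (A + 2) \<le> 0" by simp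
    moreover have "0 < A + 2" by (simp add: A_def add_nonneg_pos)
    ultimately have "B\<^sup>2 \<le> 0" by (simp add: mult_le_0_iff)
    then show ?thesis using True by simp
  next
    case False
    then have C: "0 < C" by (simp add: C_def)
    have "0 \<le> C * (A * C - B\<^sup>2)" using q[of C "- B"] by (simp add: power2_eq_square algebra_simps)
    then show ?thesis using C by (simp add: zero_le_mult_iff)
  qed
  also have "\<dots> = (sinh (hdist p x) * sinh (hdist p y))\<^sup>2" by (simp add: A_def C_def power_mult_distrib)
  finally show ?thesis
    unfolding B_def[symmetric] using nn by (simp add: abs_le_square_iff[symmetric])
qed

section \<open>Kirszbraun's theorem for the hyperbolic plane\<close>

text \<open>The candidate is the weighted centre of the points \<open>y\<close> with radii
  \<open>hdist p x\<close>. Membership in the hull comes with it, so only \<open>l <= L\<close>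
  remains.\<close>

lemma kirszbraun_finite:
  fixes L :: real
  assumes F: "finite F" "F \<noteq> {}" "F \<subseteq> hyp_plane \<times> hyp_plane"
    and L: "1 \<le> L"
    and lip: "\<And>x y x' y'. (x, y) \<in> F \<Longrightarrow> (x', y') \<in> F \<Longrightarrow> hdist y y' \<le> L * hdist x x'"
    and p: "p \<in> hyp_plane"
  obtains q where "q \<in> convex hull (snd ` F)" "q \<in> hyp_plane"
    "\<And>x y. (x, y) \<in> F \<Longrightarrow> hdist q y \<le> L * hdist p x"
proof (cases "p \<in> fst ` F")
  \<comment> \<open>If \<open>p\<close> already has a partner, that partner works; excluding this
    case makes all radii positive.\<close>
  case True
  then obtain q where pq: "(p, q) \<in> F" by auto
  show ?thesis
  proof (rule that)
    show "q \<in> convex hull (snd ` F)" using pq by (force intro: hull_inc)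
    show "q \<in> hyp_plane" using pq F by auto
  qed (use lip pq in auto)
next
  case False
  have hyp: "x \<in> hyp_plane" "y \<in> hyp_plane" if "(x, y) \<in> F" for x y using F that by auto
  define F' where "F' = (\<lambda>(x, y). (y, hdist p x)) ` F"
  have F': "finite F'" "F' \<noteq> {}" "\<And>y r. (y, r) \<in> F' \<Longrightarrow> y \<in> hyp_plane \<and> 0 < r"
  proof -
    show "finite F'" "F' \<noteq> {}" using F by (simp_all add: F'_def)
    fix y r assume "(y, r) \<in> F'"
    then obtain x where x: "(x, y) \<in> F" "r = hdist p x" by (auto simp: F'_def)
    then have "p \<noteq> x" using False by force
    then show "y \<in> hyp_plane \<and> 0 < r" using hdist_pos[OF p] hyp x by auto
  qed
  obtain q l where q: "q \<in> hyp_plane"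
    and le: "\<And>y r. (y, r) \<in> F' \<Longrightarrow> hdist q y \<le> l * r"
    and hull: "q \<in> convex hull {y. \<exists>r. (y, r) \<in> F' \<and> hdist q y = l * r}"
    by - (rule weighted_center_exists[OF F'], assumption, rule that)
  define Y where "Y = {y. \<exists>r. (y, r) \<in> F' \<and> hdist q y = l * r}"
  have Ysub: "Y \<subseteq> snd ` F" by (force simp: Y_def F'_def)
  have finY: "finite Y" using Ysub F(1) finite_subset by blast
  have le': "hdist q y \<le> l * hdist p x" if "(x, y) \<in> F" for x y
    using le[of y "hdist p x"] that by (force simp: F'_def)
  have "l \<le> L"
  proof (rule ccontr)
    assume "\<not> l \<le> L"
    then have l: "L < l" "1 \<le> l" "0 < l" using L by auto
    obtain u where u: "\<And>y. y \<in> Y \<Longrightarrow> 0 \<le> u y" "sum u Y = 1" "(\<Sum>y\<in>Y. u y *\<^sub>R y) = q"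
      using hull unfolding Y_def[symmetric] convex_hull_finite[OF finY] by auto
    have "\<forall>y\<in>Y. \<exists>x. (x, y) \<in> F \<and> hdist q y = l * hdist p x"
      by (auto simp: Y_def F'_def)
    then obtain \<xi> where \<xi>: "\<And>y. y \<in> Y \<Longrightarrow> (\<xi> y, y) \<in> F" "\<And>y. y \<in> Y \<Longrightarrow> hdist q y = l * hdist p (\<xi> y)"
      by metis
    have h: "y \<in> hyp_plane" "\<xi> y \<in> hyp_plane" if "y \<in> Y" for y
      using hyp \<xi>(1) that by blast+
    have \<rho>: "0 < hdist p (\<xi> y)" if "y \<in> Y" for y
      using hdist_pos[OF p h(2)[OF that]] False \<xi>(1)[OF that] by force
    \<comment> \<open>The Klein weights \<open>u\<close> rescaled for the hyperboloid: a lift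
      carries the factor \<open>1 / sqrt (1 - (norm y)\<^sup>2)\<close>, so the lifts weighted by
      \<open>t\<close> add up to \<open>s\<close> times the lift of \<open>q\<close>.\<close>
    define t where "t = (\<lambda>y::complex. u y * sqrt (1 - (norm y)\<^sup>2))"
    define s where "s = sqrt (1 - (norm q)\<^sup>2)"
    have t0: "0 \<le> t y" if "y \<in> Y" for y
      using u(1)[OF that] one_minus_norm_sq_pos[OF h(1)[OF that]] by (simp add: t_def)
    have center: "(\<Sum>y\<in>Y. t y * hcosh y z) = s * hcosh q z" for z
    proof -
      have "(\<Sum>y\<in>Y. t y * hcosh y z) = (\<Sum>y\<in>Y. (u y - (u y *\<^sub>R y) \<bullet> z) / sqrt (1 - (norm z)\<^sup>2))"
      proof (rule sum.cong)
        fix y assume "y \<in> Y"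
        then have "sqrt (1 - (norm y)\<^sup>2) \<noteq> 0" using one_minus_norm_sq_pos[OF h(1)] by force
        moreover have "c * a * (X / (a * b)) = c * X / b" if "a \<noteq> 0" for a b c X :: real
          using that by simp
        ultimately have "t y * hcosh y z = u y * (1 - y \<bullet> z) / sqrt (1 - (norm z)\<^sup>2)"
          by (simp only: t_def hcosh_def real_sqrt_mult)
        then show "t y * hcosh y z = (u y - (u y *\<^sub>R y) \<bullet> z) / sqrt (1 - (norm z)\<^sup>2)"
          by (simp only: inner_scaleR_left right_diff_distrib mult_1_right)
      qed simp
      also have "\<dots> = (1 - q \<bullet> z) / sqrt (1 - (norm z)\<^sup>2)"
        unfolding sum_divide_distrib[symmetric] sum_subtractf u(2) inner_sum_left[symmetric] u(3) ..
      also have "\<dots> = s * hcosh q z"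
        using one_minus_norm_sq_pos[OF q] by (simp add: s_def hcosh_def real_sqrt_mult)
      finally show ?thesis .
    qed
    \<comment> \<open>Weighted Gram entries of the tangent vectors at \<open>q\<close> towards the
      points \<open>y\<close>. Their total is 0, because the weighted lifts add up to a multiple of
      the lift of \<open>q\<close>, which has no tangential part.\<close>
    define E where "E = (\<lambda>(y, z). t y * t z * (hcosh q y * hcosh q z - hcosh y z))"
    \<comment> \<open>The tangent vector at \<open>p\<close> towards \<open>\<xi> y\<close> has
      length \<open>sinh\<close> of the radius, the one at \<open>q\<close> towards \<open>y\<close>
      has length \<open>sinh\<close> of \<open>l\<close> times the radius; the quotient in
      \<open>\<tau>\<close> makes the lengths of the two families agree.\<close>
    define \<tau> where "\<tau> = (\<lambda>y. t y * (sinh (l * hdist p (\<xi> y)) / sinh (hdist p (\<xi> y))))"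
    define E' where "E' = (\<lambda>(y, z). \<tau> y * \<tau> z * (hcosh p (\<xi> y) * hcosh p (\<xi> z) - hcosh (\<xi> y) (\<xi> z)))"
    have "(\<Sum>yz\<in>Y \<times> Y. E yz) = (\<Sum>y\<in>Y. \<Sum>z\<in>Y. t y * hcosh q y * (t z * hcosh q z) - t z * (t y * hcosh y z))"
      unfolding sum.cartesian_product' E_def prod.case by (intro sum.cong refl) algebra
    also have "\<dots> = (\<Sum>y\<in>Y. t y * hcosh q y) * (\<Sum>z\<in>Y. t z * hcosh q z)
        - (\<Sum>y\<in>Y. \<Sum>z\<in>Y. t z * (t y * hcosh y z))"
      unfolding sum_subtractf sum_product ..
    also have "(\<Sum>y\<in>Y. \<Sum>z\<in>Y. t z * (t y * hcosh y z)) = (\<Sum>z\<in>Y. t z * (\<Sum>y\<in>Y. t y * hcosh y z))"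
      by (subst sum.swap) (simp add: sum_distrib_left)
    also have "(\<Sum>y\<in>Y. t y * hcosh q y) * (\<Sum>z\<in>Y. t z * hcosh q z)
        - (\<Sum>z\<in>Y. t z * (\<Sum>y\<in>Y. t y * hcosh y z)) = 0"
    proof -
      have "(\<Sum>y\<in>Y. t y * hcosh q y) = s"
        using center[of q] unfolding hcosh_self[OF q] by (subst hcosh_commute) simp
      moreover have "(\<Sum>z\<in>Y. t z * (s * hcosh q z)) = s * (\<Sum>z\<in>Y. t z * hcosh q z)"
        by (simp add: sum_distrib_left algebra_simps)
      ultimately show ?thesis by (simp add: center)
    qed
    finally have sumE: "sum E (Y \<times> Y) = 0" .
    have sumE': "0 \<le> sum E' (Y \<times> Y)"
      unfolding E'_def sum.cartesian_product'[symmetric] prod.case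
      using hcosh_gram_nonneg[OF finY p, of \<xi> \<tau>] h by (simp add: sum.cartesian_product)
    have hinge: "\<tau> y * \<tau> z * (hcosh p (\<xi> y) * hcosh p (\<xi> z) - hcosh (\<xi> y) (\<xi> z))
        \<le> t y * t z * (hcosh q y * hcosh q z - cosh (l * hdist (\<xi> y) (\<xi> z)))" if "y \<in> Y" "z \<in> Y" for y z
    proof -
      let ?r = "hdist p (\<xi> y)" and ?r' = "hdist p (\<xi> z)" and ?c = "hdist (\<xi> y) (\<xi> z)"
      have "(cosh ?r * cosh ?r' - cosh ?c) / (sinh ?r * sinh ?r') * (sinh (l * ?r) * sinh (l * ?r'))
          \<le> cosh (l * ?r) * cosh (l * ?r') - cosh (l * ?c)"
        by (rule hinge_scaling) (use l \<rho> that hinge_bound p h in auto)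
      also have "cosh (l * ?r) * cosh (l * ?r') = hcosh q y * hcosh q z"
        using that q h by (simp add: \<xi>(2)[symmetric] cosh_hdist)
      finally have "t y * t z * ((cosh ?r * cosh ?r' - cosh ?c) / (sinh ?r * sinh ?r') * (sinh (l * ?r) * sinh (l * ?r')))
        \<le> t y * t z * (hcosh q y * hcosh q z - cosh (l * ?c))"
        using t0 that by (intro mult_left_mono mult_nonneg_nonneg)
      then show ?thesis
        using that p h by (simp add: \<tau>_def cosh_hdist mult_ac)
    qed
    have EE': "E' yz \<le> E yz" if asm: "yz \<in> Y \<times> Y" for yz
    proof -
      obtain y z where yz: "yz = (y, z)" "y \<in> Y" "z \<in> Y" using asm by auto
      have "hdist y z \<le> l * hdist (\<xi> y) (\<xi> z)"
        using lip[OF \<xi>(1) \<xi>(1), OF yz(2,3)] l hdist_nonneg[OF h(2) h(2), OF yz(2,3)]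
        by (meson less_imp_le mult_right_mono order_trans)
      then have "hcosh y z \<le> cosh (l * hdist (\<xi> y) (\<xi> z))"
        using hdist_le_iff[OF h(1) h(1)] yz l hdist_nonneg[OF h(2) h(2), OF yz(2,3)] by simp
      then have "t y * t z * (hcosh q y * hcosh q z - cosh (l * hdist (\<xi> y) (\<xi> z))) \<le> E yz"
        using t0 yz unfolding E_def by (simp add: mult_left_mono)
      then show ?thesis using hinge[OF yz(2,3)] by (simp add: E'_def yz(1))
    qed
    \<comment> \<open>Two distinct points of positive weight would make one entry strict, since
      \<open>L < l\<close>. Then the sum of \<open>E'\<close>, which is nonnegative, would lie below
      the sum of \<open>E\<close>, which is 0.\<close>
    have single: "y = z" if "y \<in> Y" "z \<in> Y" "0 < t y" "0 < t z" for y z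
    proof (rule ccontr)
      assume "y \<noteq> z"
      have "\<xi> y \<noteq> \<xi> z"
      proof
        assume "\<xi> y = \<xi> z"
        then have "hdist y z \<le> 0" using lip[OF \<xi>(1) \<xi>(1), OF that(1,2)] that h by (simp add: hdist_self)
        then show False using hdist_le_0_imp_eq h that \<open>y \<noteq> z\<close> by blast
      qed
      then have c: "0 < hdist (\<xi> y) (\<xi> z)" using hdist_pos h that by blast
      have "hdist y z < l * hdist (\<xi> y) (\<xi> z)"
        using lip[OF \<xi>(1) \<xi>(1), OF that(1,2)] mult_strict_right_mono[OF l(1) c] by linarith
      then have "hcosh y z < cosh (l * hdist (\<xi> y) (\<xi> z))"
        using cosh_real_nonneg_less_iff[OF hdist_nonneg[OF h(1) h(1)]] c l that h by (simp add: cosh_hdist)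
      then have "t y * t z * (hcosh q y * hcosh q z - cosh (l * hdist (\<xi> y) (\<xi> z))) < E (y, z)"
        using that unfolding E_def by simp
      then have "E' (y, z) < E (y, z)" using hinge[OF that(1,2)] by (simp add: E'_def)
      then have "sum E' (Y \<times> Y) < sum E (Y \<times> Y)"
        using that finY EE' by (intro sum_strict_mono_ex1) auto
      then show False using sumE sumE' by simp
    qed
    have "\<exists>y\<in>Y. u y \<noteq> 0" using u(2) by (metis sum.neutral zero_neq_one)
    then obtain y where y: "y \<in> Y" "0 < u y" using u(1) by (metis order_le_less)
    have tpos: "0 < t z" if "z \<in> Y" "0 < u z" for z
      using one_minus_norm_sq_pos[OF h(1)] that by (simp add: t_def)
    have zero: "u z = 0" if "z \<in> Y - {y}" for z
      using single[of y z] tpos y that u(1)[of z] by fastforce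
    have "(\<Sum>z\<in>Y. u z *\<^sub>R z) = u y *\<^sub>R y" "sum u Y = u y"
      using sum.remove[OF finY y(1), of "\<lambda>z. u z *\<^sub>R z"] sum.remove[OF finY y(1), of u] zero by simp_all
    \<comment> \<open>A single remaining point is at distance 0 from the centre, against its
      positive radius and \<open>l > 0\<close>.\<close>
    then have "q = y" using u by simp
    then show False using \<xi>(2)[OF y(1)] \<rho>[OF y(1)] l q by (simp add: hdist_self)
  qed
  then show ?thesis
  proof (intro that[of q] q)
    show "q \<in> convex hull (snd ` F)"
      using hull hull_mono[OF Ysub] unfolding Y_def by blast
    fix x y assume xy: "(x, y) \<in> F"
    show "hdist q y \<le> L * hdist p x"
      using le'[OF xy] \<open>l \<le> L\<close> hdist_nonneg[OF p hyp(1)[OF xy]] by (meson mult_right_mono order_trans)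
  qed
qed

text \<open>The admissible values form an intersection of compact hyperbolic balls with
  \<open>C\<close>. The finite case supplies the finite intersection property, as the hull of
  finitely many values stays in \<open>C\<close>.\<close>

lemma kirszbraun_one_point:
  fixes L :: real
  assumes G: "G \<noteq> {}" "G \<subseteq> hyp_plane \<times> (C \<inter> hyp_plane)"
    and C: "closed C" "convex C"
    and L: "1 \<le> L"
    and lip: "\<And>x y x' y'. (x, y) \<in> G \<Longrightarrow> (x', y') \<in> G \<Longrightarrow> hdist y y' \<le> L * hdist x x'"
    and p: "p \<in> hyp_plane"
  obtains q where "q \<in> C \<inter> hyp_plane" "\<And>x y. (x, y) \<in> G \<Longrightarrow> hdist q y \<le> L * hdist p x"
proof -
  define B where "B = (\<lambda>(x, y). {q \<in> hyp_plane. hdist q y \<le> L * hdist p x})"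
  obtain g where g: "g \<in> G" using G by auto
  have B: "compact (B h)" if "h \<in> G" for h
    using that G compact_hyperbolic_ball by (auto simp: B_def)
  \<comment> \<open>The ball of the fixed pair \<open>g\<close> makes the ambient set compact, so
    \<open>g\<close> is added to each finite subfamily.\<close>
  have "(C \<inter> B g) \<inter> (\<Inter>h\<in>G. B h) \<noteq> {}"
  proof (rule compact_imp_fip_image)
    show "compact (C \<inter> B g)" using C(1) B[OF g] by (rule closed_Int_compact)
    show "closed (B h)" if "h \<in> G" for h using B[OF that] by (rule compact_imp_closed)
    fix I assume I: "finite I" "I \<subseteq> G"
    obtain q where q: "q \<in> convex hull (snd ` insert g I)" "q \<in> hyp_plane"
      "\<And>x y. (x, y) \<in> insert g I \<Longrightarrow> hdist q y \<le> L * hdist p x"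
    proof (rule kirszbraun_finite[OF _ _ _ L _ p, of "insert g I"])
      show "insert g I \<subseteq> hyp_plane \<times> hyp_plane" using G g I by blast
      show "hdist y y' \<le> L * hdist x x'" if "(x, y) \<in> insert g I" "(x', y') \<in> insert g I" for x y x' y'
        by (rule lip) (use that I g in blast)+
    qed (simp_all add: I)
    have "snd ` insert g I \<subseteq> C" using G g I by force
    then have "q \<in> C" using q(1) C(2) by (meson hull_minimal subsetD)
    then have "q \<in> (C \<inter> B g) \<inter> (\<Inter>h\<in>I. B h)"
      using q by (auto simp: B_def)
    then show "(C \<inter> B g) \<inter> (\<Inter>h\<in>I. B h) \<noteq> {}" by blast
  qed
  then obtain q where q: "q \<in> C" "\<And>h. h \<in> G \<Longrightarrow> q \<in> B h" by blast
  show ?thesis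
  proof (rule that)
    show "q \<in> C \<inter> hyp_plane" using q(1) q(2)[OF g] by (cases g) (simp add: B_def)
    show "hdist q y \<le> L * hdist p x" if "(x, y) \<in> G" for x y
      using q(2)[OF that] by (simp add: B_def)
  qed
qed

text \<open>Zorn's lemma on Lipschitz relations, kept as sets of pairs rather than partial
  functions: unions of chains are then immediate, and single-valuedness follows from the Lipschitz
  bound at distance 0.\<close>

lemma kirszbraun:
  fixes L :: real
  assumes G: "G \<noteq> {}" "G \<subseteq> hyp_plane \<times> (C \<inter> hyp_plane)"
    and C: "closed C" "convex C"
    and L: "1 \<le> L"
    and lip: "\<And>x y x' y'. (x, y) \<in> G \<Longrightarrow> (x', y') \<in> G \<Longrightarrow> hdist y y' \<le> L * hdist x x'"
  obtains f where "f ` hyp_plane \<subseteq> C \<inter> hyp_plane"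
    "\<And>x y. x \<in> hyp_plane \<Longrightarrow> y \<in> hyp_plane \<Longrightarrow> hdist (f x) (f y) \<le> L * hdist x y"
    "\<And>x y. (x, y) \<in> G \<Longrightarrow> f x = y"
proof -
  define \<A> where "\<A> = {M. G \<subseteq> M \<and> M \<subseteq> hyp_plane \<times> (C \<inter> hyp_plane) \<and>
    (\<forall>(x, y)\<in>M. \<forall>(x', y')\<in>M. hdist y y' \<le> L * hdist x x')}"
  have "\<exists>M\<in>\<A>. \<forall>X\<in>\<A>. M \<subseteq> X \<longrightarrow> X = M"
  proof (rule subset_Zorn_nonempty)
    have "G \<in> \<A>" unfolding \<A>_def using G(2) by (auto intro: lip)
    then show "\<A> \<noteq> {}" by blast
    fix \<C> assume c: "\<C> \<noteq> {}" "subset.chain \<A> \<C>"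
    have A: "G \<subseteq> M" "M \<subseteq> hyp_plane \<times> (C \<inter> hyp_plane)"
      "\<And>x y x' y'. (x, y) \<in> M \<Longrightarrow> (x', y') \<in> M \<Longrightarrow> hdist y y' \<le> L * hdist x x'" if "M \<in> \<C>" for M
    proof -
      have "M \<in> \<A>" using c(2) that unfolding subset_chain_def by blast
      then show "G \<subseteq> M" "M \<subseteq> hyp_plane \<times> (C \<inter> hyp_plane)"
        "\<And>x y x' y'. (x, y) \<in> M \<Longrightarrow> (x', y') \<in> M \<Longrightarrow> hdist y y' \<le> L * hdist x x'"
        unfolding \<A>_def by auto
    qed
    have "hdist y y' \<le> L * hdist x x'" if xy: "(x, y) \<in> \<Union>\<C>" "(x', y') \<in> \<Union>\<C>" for x y x' y'
    proof -
      obtain M M' where M: "M \<in> \<C>" "(x, y) \<in> M" "M' \<in> \<C>" "(x', y') \<in> M'" using xy by blast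
      then have "M \<subseteq> M' \<or> M' \<subseteq> M" using c(2) unfolding subset_chain_def by blast
      then show ?thesis using A(3)[OF M(1)] A(3)[OF M(3)] M by blast
    qed
    moreover have "G \<subseteq> \<Union>\<C>" using c(1) A(1) by blast
    moreover have "\<Union>\<C> \<subseteq> hyp_plane \<times> (C \<inter> hyp_plane)" using A(2) by blast
    ultimately show "\<Union>\<C> \<in> \<A>" unfolding \<A>_def by (simp del: Union_iff) blast
  qed
  then obtain M where M: "M \<in> \<A>" and max: "\<And>X. X \<in> \<A> \<Longrightarrow> M \<subseteq> X \<Longrightarrow> X = M" by blast
  have GM: "G \<subseteq> M" and Msub: "M \<subseteq> hyp_plane \<times> (C \<inter> hyp_plane)"
    and Mlip: "\<And>x y x' y'. (x, y) \<in> M \<Longrightarrow> (x', y') \<in> M \<Longrightarrow> hdist y y' \<le> L * hdist x x'"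
    using M unfolding \<A>_def by auto
  have total: "\<exists>q. (p, q) \<in> M" if p: "p \<in> hyp_plane" for p
  proof -
    have "M \<noteq> {}" using GM G by auto
    then obtain q where q: "q \<in> C \<inter> hyp_plane" "\<And>x y. (x, y) \<in> M \<Longrightarrow> hdist q y \<le> L * hdist p x"
      by - (rule kirszbraun_one_point[OF _ Msub C L Mlip p], assumption+, rule that)
    have "insert (p, q) M \<in> \<A>"
    proof -
      have "hdist y q \<le> L * hdist x p" if "(x, y) \<in> M" for x y
        using q(2)[OF that] by (simp only: hdist_commute)
      moreover have "hdist q q \<le> L * hdist p p" using q p by (simp add: hdist_self)
      ultimately show ?thesis unfolding \<A>_def using GM Msub Mlip q p by auto
    qed
    then have "insert (p, q) M = M" using max by blast
    then show ?thesis by blast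
  qed
  have unique: "y = y'" if "(x, y) \<in> M" "(x, y') \<in> M" for x y y'
  proof -
    have "x \<in> hyp_plane" "y \<in> hyp_plane" "y' \<in> hyp_plane" using Msub that by auto
    then show ?thesis using Mlip[OF that] hdist_le_0_imp_eq by (simp add: hdist_self)
  qed
  define f where "f = (\<lambda>x. SOME y. (x, y) \<in> M)"
  have f: "(x, f x) \<in> M" if "x \<in> hyp_plane" for x
    unfolding f_def using total[OF that] by (rule someI_ex)
  show ?thesis
  proof (rule that)
    show "f ` hyp_plane \<subseteq> C \<inter> hyp_plane" using f Msub by auto
    show "hdist (f x) (f y) \<le> L * hdist x y" if "x \<in> hyp_plane" "y \<in> hyp_plane" for x y
      using Mlip f that by blast
    show "f x = y" if "(x, y) \<in> G" for x y
      using unique[of x "f x" y] f GM G that by blast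
  qed
qed

section \<open>Horocycles and horogons\<close>

text \<open>The points whose hyperboloid lifts have Minkowski product 1 with the lightlike vector
  \<open>a * (1, p)\<close>. A larger weight \<open>a\<close> means a smaller horocycle.\<close>

definition horo :: "complex \<Rightarrow> real \<Rightarrow> complex set" where
  "horo p a = {x \<in> hyp_plane. a * (1 - x \<bullet> p) = sqrt (1 - (norm x)\<^sup>2)}"

text \<open>Along the ray, \<open>hcosh\<close> is
  \<open>\<alpha> * exp t + \<beta> * exp (- t)\<close>, so \<open>hdist - t\<close> tends to
  \<open>ln (2 * \<alpha>)\<close>; equating this with \<open>c\<close> is the equation of
  \<open>horo\<close>.\<close>

lemma horocycle_eq_horo:
  assumes p: "norm p = 1"
  shows "horocycle p c = horo p (exp (- c))"
proof -
  have "((\<lambda>t. hdist x (tanh t *\<^sub>R p) - t) \<longlongrightarrow> c) at_top \<longleftrightarrow> exp (- c) * (1 - x \<bullet> p) = sqrt (1 - (norm x)\<^sup>2)"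
    if x: "x \<in> hyp_plane" for x
  proof -
    define S where "S = sqrt (1 - (norm x)\<^sup>2)"
    define k where "k = x \<bullet> p"
    have S: "0 < S" using one_minus_norm_sq_pos[OF x] by (simp add: S_def)
    have k: "k < 1" using inner_less_one[OF x, of p] p by (simp add: k_def)
    define \<alpha> where "\<alpha> = (1 - k) / (2 * S)"
    define \<beta> where "\<beta> = (1 + k) / (2 * S)"
    have \<alpha>: "0 < \<alpha>" using S k by (simp add: \<alpha>_def)
    define g where "g = (\<lambda>t. \<alpha> + \<beta> * exp (- 2 * t))"
    \<comment> \<open>\<open>arcosh (exp t * g t)\<close> with the factor \<open>exp t\<close>
      pulled out of the logarithm, so that the divergent \<open>t\<close> cancels before the limit
      is taken.\<close>
    define G where "G = (\<lambda>t. ln (g t + sqrt ((g t)\<^sup>2 - exp (- 2 * t))))"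
    have eq: "hdist x (tanh t *\<^sub>R p) - t = G t" for t
    proof -
      have tp: "tanh t *\<^sub>R p \<in> hyp_plane"
        using p tanh_real_bounds[of t] by (simp add: mem_hyp_plane abs_less_iff)
      have c: "1 - (tanh t)\<^sup>2 = (1 / cosh t)\<^sup>2"
      proof -
        have "1 - (tanh t)\<^sup>2 = (cosh t)\<^sup>2 / (cosh t)\<^sup>2 - (sinh t)\<^sup>2 / (cosh t)\<^sup>2"
          by (simp add: tanh_def power_divide)
        also have "\<dots> = (1 / cosh t)\<^sup>2"
          unfolding diff_divide_distrib[symmetric] cosh_square_eq by (simp add: power_divide cosh_square_eq)
        finally show ?thesis .
      qed
      have "hcosh x (tanh t *\<^sub>R p) = (1 - tanh t * k) / (S * (1 / cosh t))"
        using p by (simp add: hcosh_def real_sqrt_mult c S_def k_def real_sqrt_divide)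
      also have "1 - tanh t * k = (cosh t - sinh t * k) / cosh t"
        by (simp add: tanh_def diff_divide_distrib)
      also have "\<dots> / (S * (1 / cosh t)) = (cosh t - sinh t * k) / S"
        by simp
      also have "\<dots> = \<alpha> * exp t + \<beta> * exp (- t)"
        using S by (simp add: \<alpha>_def \<beta>_def cosh_def sinh_def field_simps)
      also have "exp (- t) = exp t * exp (- 2 * t)"
        by (simp add: mult_exp_exp)
      also have "\<alpha> * exp t + \<beta> * (exp t * exp (- 2 * t)) = exp t * g t"
        by (simp add: g_def algebra_simps)
      finally have hc: "hcosh x (tanh t *\<^sub>R p) = exp t * g t" .
      have ge: "1 \<le> exp t * g t" using hcosh_ge_1[OF x tp] hc by simp
      have "(exp t * g t)\<^sup>2 - 1 = (exp t)\<^sup>2 * ((g t)\<^sup>2 - exp (- 2 * t))"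
        by (simp add: right_diff_distrib power_mult_distrib power2_eq_square mult_exp_exp)
      then have "exp t * g t + sqrt ((exp t * g t)\<^sup>2 - 1) = exp t * (g t + sqrt ((g t)\<^sup>2 - exp (- 2 * t)))"
        by (simp add: real_sqrt_mult distrib_left)
      moreover have "0 < exp t * g t + sqrt ((exp t * g t)\<^sup>2 - 1)"
        using ge by (intro add_pos_nonneg) auto
      ultimately have "ln (exp t * g t + sqrt ((exp t * g t)\<^sup>2 - 1)) = t + G t"
        by (simp add: G_def ln_mult zero_less_mult_iff)
      then show ?thesis
        by (simp add: hdist_eq_arcosh hc arcosh_real_def[OF ge])
    qed
    have e: "((\<lambda>t::real. exp (- 2 * t)) \<longlongrightarrow> 0) at_top"
      by (intro filterlim_compose[OF exp_at_bot]
          filterlim_tendsto_neg_mult_at_bot[OF tendsto_const _ filterlim_ident]) simp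
    have "(g \<longlongrightarrow> \<alpha> + \<beta> * 0) at_top"
      unfolding g_def by (intro tendsto_intros e)
    then have "(G \<longlongrightarrow> ln (\<alpha> + sqrt (\<alpha>\<^sup>2 - 0))) at_top"
      unfolding G_def using \<alpha> by (intro tendsto_intros e) auto
    moreover have "\<alpha> + sqrt (\<alpha>\<^sup>2 - 0) = 2 * \<alpha>" using \<alpha> by simp
    moreover have "2 * \<alpha> = (1 - k) / S" using S by (simp add: \<alpha>_def field_simps)
    ultimately have G: "(G \<longlongrightarrow> ln ((1 - k) / S)) at_top" by simp
    have "((\<lambda>t. hdist x (tanh t *\<^sub>R p) - t) \<longlongrightarrow> c) at_top \<longleftrightarrow> ln ((1 - k) / S) = c"
      unfolding eq using G tendsto_unique[OF trivial_limit_at_top_linorder _ G] by metis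
    also have "\<dots> \<longleftrightarrow> (1 - k) / S = exp c"
      using S k by (metis diff_gt_0_iff_gt divide_pos_pos exp_ln ln_exp)
    also have "\<dots> \<longleftrightarrow> exp (- c) * (1 - k) = S"
      using S by (auto simp: field_simps exp_minus)
    finally show ?thesis by (simp add: k_def S_def)
  qed
  then show ?thesis by (auto simp: horocycle_def horo_def)
qed

lemma one_minus_inner_unit:
  assumes "norm p = 1" "norm q = (1::real)"
  shows "1 - p \<bullet> q = (norm (p - q))\<^sup>2 / 2"
proof -
  have "p \<bullet> p = 1" "q \<bullet> q = 1" using assms by (simp_all add: dot_square_norm)
  then show ?thesis
    by (simp add: power2_norm_eq_inner inner_diff_left inner_diff_right inner_commute)
qed

lemma unit_frame:
  fixes e X Y :: complex
  assumes "norm e = 1"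
  shows "X = (X \<bullet> e) *\<^sub>R e + (X \<bullet> (\<i> * e)) *\<^sub>R (\<i> * e)"
    "X \<bullet> Y = (X \<bullet> e) * (Y \<bullet> e) + (X \<bullet> (\<i> * e)) * (Y \<bullet> (\<i> * e))"
proof -
  have e: "(Re e)\<^sup>2 + (Im e)\<^sup>2 = 1" using assms by (simp add: cmod_def)
  have "Re X * ((Re e)\<^sup>2 + (Im e)\<^sup>2) = Re X" "Im X * ((Re e)\<^sup>2 + (Im e)\<^sup>2) = Im X" by (simp_all add: e)
  then show 1: "X = (X \<bullet> e) *\<^sub>R e + (X \<bullet> (\<i> * e)) *\<^sub>R (\<i> * e)"
    by (simp add: complex_eq_iff inner_complex_def power2_eq_square algebra_simps)
  have "X \<bullet> Y = ((X \<bullet> e) *\<^sub>R e + (X \<bullet> (\<i> * e)) *\<^sub>R (\<i> * e)) \<bullet> Y"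
    by (rule arg_cong[OF 1, of "\<lambda>Z. Z \<bullet> Y"])
  also have "\<dots> = (X \<bullet> e) * (Y \<bullet> e) + (X \<bullet> (\<i> * e)) * (Y \<bullet> (\<i> * e))"
    unfolding inner_add_left inner_scaleR_left inner_commute[of e Y] inner_commute[of "\<i> * e" Y] ..
  finally show "X \<bullet> Y = (X \<bullet> e) * (Y \<bullet> e) + (X \<bullet> (\<i> * e)) * (Y \<bullet> (\<i> * e))" .
qed

text \<open>The hyperboloid points on both horocycles form a line cut by a quadric; \<open>z\<close> parametrises this line.\<close>

lemma horo_Int_horo:
  fixes p q :: complex
  assumes pq: "norm p = 1" "norm q = 1" "p \<noteq> q" and ab: "0 < a" "0 < b"
  obtains \<phi> :: "real \<Rightarrow> complex" and A B :: real
  where "0 < A" "inj_on \<phi> {z. (A * z - B)\<^sup>2 = 1 / (a * b) - (1 - p \<bullet> q) / 2}"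
    "horo p a \<inter> horo q b = \<phi> ` {z. (A * z - B)\<^sup>2 = 1 / (a * b) - (1 - p \<bullet> q) / 2}"
proof -
  \<comment> \<open>Half the chord length. With \<open>e\<close> along the chord and
    \<open>f\<close> perpendicular to it, \<open>p\<close> and \<open>q\<close> have opposite
    \<open>e\<close>-coordinates and the same \<open>f\<close>-coordinate \<open>c\<close>.\<close>
  define h where "h = norm (p - q) / 2"
  have h: "0 < h" using pq by (simp add: h_def)
  have h2: "1 - p \<bullet> q = 2 * h\<^sup>2" using one_minus_inner_unit[OF pq(1,2)] by (simp add: h_def power_divide)
  define e where "e = (p - q) /\<^sub>R (2 * h)"
  define f where "f = \<i> * e"
  have e1: "norm e = 1" using h pq by (simp add: e_def h_def)
  then have f1: "norm f = 1" by (simp add: f_def norm_mult)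
  note frame = unit_frame[OF e1, folded f_def]
  have ef: "e \<bullet> f = 0" "e \<bullet> e = 1" "f \<bullet> f = 1" "f \<bullet> e = 0"
    using e1 f1 by (auto simp: dot_square_norm) (simp_all add: f_def inner_complex_def)
  have pp: "p \<bullet> p = 1" "q \<bullet> q = 1" using pq by (simp_all add: dot_square_norm)
  have pe: "p \<bullet> e = h" "q \<bullet> e = - h"
  proof -
    have "p \<bullet> e = inverse (2 * h) * (1 - p \<bullet> q)" "q \<bullet> e = inverse (2 * h) * - (1 - p \<bullet> q)"
      unfolding e_def inner_scaleR_right inner_diff_right pp inner_commute[of q p] by simp_all
    then show "p \<bullet> e = h" "q \<bullet> e = - h" using h unfolding h2 by (simp_all add: power2_eq_square)
  qed
  define c where "c = p \<bullet> f"
  have "p - q = (2 * h) *\<^sub>R e" using h by (simp add: e_def)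
  then have "(p - q) \<bullet> f = 0" by (simp add: ef)
  then have qf: "q \<bullet> f = c" "p \<bullet> f = c" by (simp_all add: c_def inner_diff_left)
  have ch: "h\<^sup>2 + c\<^sup>2 = 1" using frame(2)[of p p] by (simp add: pe qf pp power2_eq_square)
  \<comment> \<open>For a lift \<open>(T, X)\<close> the horocycle equations read
    \<open>T - X \<bullet> p = 1 / a\<close> and \<open>T - X \<bullet> q = 1 / b\<close>. Their
    difference fixes the coordinate \<open>y\<close> of \<open>X\<close> along \<open>e\<close>, and
    their mean gives \<open>T = c * z + k\<close>.\<close>
  define y where "y = (1 / b - 1 / a) / (2 * h)"
  define k where "k = (1 / a + 1 / b) / 2"
  define T where "T = (\<lambda>z. c * z + k)"
  define X where "X = (\<lambda>z. y *\<^sub>R e + z *\<^sub>R f)"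
  define D where "D = 1 / (a * b) - (1 - p \<bullet> q) / 2"
  have hy: "h * y = (1 / b - 1 / a) / 2" using h by (simp add: y_def)
  have Xp: "X z \<bullet> p = h * y + c * z" "X z \<bullet> q = - (h * y) + c * z" for z
    by (simp_all add: X_def inner_add_left inner_commute[of e] inner_commute[of f] pe qf)
  have X2: "(norm (X z))\<^sup>2 = y\<^sup>2 + z\<^sup>2" for z
    unfolding power2_norm_eq_inner by (simp add: X_def inner_add_left inner_add_right ef power2_eq_square)
  \<comment> \<open>Multiplying the hyperboloid equation by \<open>h\<^sup>2\<close> completes the
    square in \<open>z\<close>, so the number of solutions depends only on the sign of
    \<open>D\<close>.\<close>
  have quad: "(T z)\<^sup>2 - (norm (X z))\<^sup>2 = 1 \<longleftrightarrow> (h\<^sup>2 * z - c * k)\<^sup>2 = D" for z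
  proof -
    have "k\<^sup>2 - (h * y)\<^sup>2 = 1 / (a * b)"
      using ab unfolding hy by (simp add: k_def field_simps power2_eq_square)
    then have D: "D = k\<^sup>2 - h\<^sup>2 * y\<^sup>2 - h\<^sup>2" by (simp add: D_def h2 power_mult_distrib)
    have "h\<^sup>2 * ((T z)\<^sup>2 - (norm (X z))\<^sup>2 - 1) = D - (h\<^sup>2 * z - c * k)\<^sup>2"
      unfolding X2 D T_def using ch by algebra
    then show ?thesis using h by auto
  qed
  \<comment> \<open>Selects the upper sheet: on the lower one \<open>T - X \<bullet> p\<close> would
    be negative, but it equals \<open>1 / a\<close>.\<close>
  have pos: "0 < T z" if "(T z)\<^sup>2 - (norm (X z))\<^sup>2 = 1" for z
  proof (rule ccontr)
    assume "\<not> 0 < T z"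
    have "(norm (X z))\<^sup>2 < \<bar>T z\<bar>\<^sup>2" using that by simp
    then have "norm (X z) < \<bar>T z\<bar>" by (rule power2_less_imp_less) simp
    moreover have "\<bar>X z \<bullet> p\<bar> \<le> norm (X z)" using Cauchy_Schwarz_ineq2[of "X z" p] pq by simp
    moreover have "T z - X z \<bullet> p = 1 / a" by (simp add: T_def Xp hy k_def field_simps)
    moreover have "0 < 1 / a" using ab by simp
    ultimately show False using \<open>\<not> 0 < T z\<close> by linarith
  qed
  define \<phi> where "\<phi> = (\<lambda>z. X z /\<^sub>R T z)"
  have lift: "T z = 1 / sqrt (1 - (norm (\<phi> z))\<^sup>2)" "\<phi> z \<in> hyp_plane" if "(T z)\<^sup>2 - (norm (X z))\<^sup>2 = 1" for z
    using hyperboloid_point[OF pos[OF that] that] pos[OF that] by (simp_all add: \<phi>_def real_sqrt_divide)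
  show ?thesis
  proof (rule that[of "h\<^sup>2" \<phi> "c * k"], fold D_def)
    show "0 < h\<^sup>2" using h by simp
    show "inj_on \<phi> {z. (h\<^sup>2 * z - c * k)\<^sup>2 = D}"
    proof (rule inj_onI, unfold mem_Collect_eq quad[symmetric])
      fix z w assume z: "(T z)\<^sup>2 - (norm (X z))\<^sup>2 = 1" and w: "(T w)\<^sup>2 - (norm (X w))\<^sup>2 = 1" and eq: "\<phi> z = \<phi> w"
      have "T z = T w" using lift(1)[OF z] lift(1)[OF w] eq by simp
      then have "X z = X w" using eq pos[OF z] by (simp add: \<phi>_def)
      then have "X z \<bullet> f = X w \<bullet> f" by simp
      then show "z = w" by (simp add: X_def inner_add_left ef)
    qed
    show "horo p a \<inter> horo q b = \<phi> ` {z. (h\<^sup>2 * z - c * k)\<^sup>2 = D}"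
    proof (intro equalityI subsetI)
      fix x assume x: "x \<in> horo p a \<inter> horo q b"
      define t where "t = 1 / sqrt (1 - (norm x)\<^sup>2)"
      have xh: "x \<in> hyp_plane" using x by (simp add: horo_def)
      have t: "0 < t" using one_minus_norm_sq_pos[OF xh] by (simp add: t_def)
      have xpq: "t * (1 - x \<bullet> p) = 1 / a" "t * (1 - x \<bullet> q) = 1 / b"
      proof -
        have s: "0 < sqrt (1 - (norm x)\<^sup>2)" using one_minus_norm_sq_pos[OF xh] by simp
        have "a * (1 - x \<bullet> p) = sqrt (1 - (norm x)\<^sup>2)" "b * (1 - x \<bullet> q) = sqrt (1 - (norm x)\<^sup>2)"
          using x by (simp_all add: horo_def)
        then show "t * (1 - x \<bullet> p) = 1 / a" "t * (1 - x \<bullet> q) = 1 / b"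
          unfolding t_def using ab s by (simp_all add: field_simps)
      qed
      define z where "z = t * (x \<bullet> f)"
      have ip: "x \<bullet> p = (x \<bullet> e) * h + (x \<bullet> f) * c" "x \<bullet> q = - (x \<bullet> e) * h + (x \<bullet> f) * c"
        using frame(2)[of x p] frame(2)[of x q] by (simp_all add: pe qf)
      have "h * (t * (x \<bullet> e)) = h * y"
        using xpq unfolding hy ip by (simp add: algebra_simps)
      then have y: "t * (x \<bullet> e) = y" using h by simp
      have tx: "t *\<^sub>R x = X z"
        by (subst frame(1)[of x]) (simp add: X_def z_def y[symmetric] scaleR_add_right)
      have T: "T z = t"
      proof -
        have "2 * k = 1 / a + 1 / b" by (simp add: k_def)
        also have "\<dots> = 2 * (t - c * z)"
          unfolding xpq[symmetric] ip z_def by (simp add: algebra_simps)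
        finally have "k = t - c * z" by simp
        then show ?thesis by (simp add: T_def)
      qed
      have xz: "x = \<phi> z" using t by (simp add: \<phi>_def T flip: tx)
      have "(T z)\<^sup>2 - (norm (X z))\<^sup>2 = t\<^sup>2 * (1 - (norm x)\<^sup>2)"
        unfolding T tx[symmetric] using t by (simp add: power_mult_distrib algebra_simps)
      also have "\<dots> = 1" using one_minus_norm_sq_pos[OF xh] by (simp add: t_def power_divide)
      finally show "x \<in> \<phi> ` {z. (h\<^sup>2 * z - c * k)\<^sup>2 = D}" using xz quad by blast
    next
      fix x assume "x \<in> \<phi> ` {z. (h\<^sup>2 * z - c * k)\<^sup>2 = D}"
      then obtain z where xz: "x = \<phi> z" and z: "(T z)\<^sup>2 - (norm (X z))\<^sup>2 = 1" using quad by auto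
      have T: "0 < T z" using pos[OF z] .
      have s: "sqrt (1 - (norm x)\<^sup>2) = 1 / T z" using lift(1)[OF z] T by (simp add: xz)
      have "1 - x \<bullet> p = (T z - X z \<bullet> p) / T z" "1 - x \<bullet> q = (T z - X z \<bullet> q) / T z"
        using T by (simp_all add: xz \<phi>_def field_simps)
      moreover have "T z - X z \<bullet> p = 1 / a" "T z - X z \<bullet> q = 1 / b"
        by (simp_all add: T_def Xp hy k_def field_simps)
      ultimately show "x \<in> horo p a \<inter> horo q b"
        using ab T lift(2)[OF z] by (simp add: horo_def s xz[symmetric])
    qed
  qed
qed

text \<open>The roots of \<open>(A * z - B)\<^sup>2 = D\<close> are symmetric about
  \<open>B / A\<close>, so there is exactly one precisely when \<open>D = 0\<close>.\<close>

lemma tangent_horo_iff: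
  fixes p q :: complex
  assumes pq: "norm p = 1" "norm q = 1" "p \<noteq> q" and ab: "0 < a" "0 < b"
  shows "tangent (horo p a) (horo q b) \<longleftrightarrow> a * b * (1 - p \<bullet> q) = 2"
proof -
  obtain \<phi> A B where A: "0 < A"
    and inj: "inj_on \<phi> {z. (A * z - B)\<^sup>2 = 1 / (a * b) - (1 - p \<bullet> q) / 2}"
    and eq: "horo p a \<inter> horo q b = \<phi> ` {z. (A * z - B)\<^sup>2 = 1 / (a * b) - (1 - p \<bullet> q) / 2}"
    by - (rule horo_Int_horo[OF assms], rule that)
  define D where "D = 1 / (a * b) - (1 - p \<bullet> q) / 2"
  have D0: "D = 0 \<longleftrightarrow> a * b * (1 - p \<bullet> q) = 2" using ab by (auto simp: D_def field_simps)
  have "tangent (horo p a) (horo q b) \<longleftrightarrow> (\<exists>z. {z. (A * z - B)\<^sup>2 = D} = {z})"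
  proof
    assume "tangent (horo p a) (horo q b)"
    then obtain x where x: "\<phi> ` {z. (A * z - B)\<^sup>2 = D} = {x}" using eq by (auto simp: tangent_def D_def)
    then obtain z where z: "(A * z - B)\<^sup>2 = D" by auto
    have "w = z" if w: "(A * w - B)\<^sup>2 = D" for w
    proof (rule inj_onD[OF inj[folded D_def]])
      have "\<phi> w \<in> {x}" "\<phi> z \<in> {x}" unfolding x[symmetric] using z w by simp_all
      then show "\<phi> w = \<phi> z" by simp
    qed (use z w in simp_all)
    then show "\<exists>z. {z. (A * z - B)\<^sup>2 = D} = {z}" using z by blast
  next
    assume "\<exists>z. {z. (A * z - B)\<^sup>2 = D} = {z}"
    then show "tangent (horo p a) (horo q b)" using eq by (auto simp: tangent_def D_def)
  qed
  also have "\<dots> \<longleftrightarrow> D = 0"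
  proof
    assume "\<exists>z. {z. (A * z - B)\<^sup>2 = D} = {z}"
    then obtain z where z: "{z. (A * z - B)\<^sup>2 = D} = {z}" by blast
    then have "(A * z - B)\<^sup>2 = D" by blast
    moreover have "(A * (2 * B / A - z) - B)\<^sup>2 = (A * z - B)\<^sup>2"
      using A by (simp add: field_simps power2_eq_square)
    ultimately have "2 * B / A - z = z" using z by blast
    then have "A * z - B = 0" using A by (simp add: field_simps)
    then show "D = 0" using \<open>(A * z - B)\<^sup>2 = D\<close> by simp
  next
    assume "D = 0"
    then have "{z. (A * z - B)\<^sup>2 = D} = {B / A}" using A by (auto simp: field_simps)
    then show "\<exists>z. {z. (A * z - B)\<^sup>2 = D} = {z}" by blast
  qed
  finally show ?thesis using D0 by simp
qed

lemma disjoint_horo_iff: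
  fixes p q :: complex
  assumes pq: "norm p = 1" "norm q = 1" "p \<noteq> q" and ab: "0 < a" "0 < b"
  shows "horo p a \<inter> horo q b = {} \<longleftrightarrow> 2 < a * b * (1 - p \<bullet> q)"
proof -
  obtain \<phi> A B where A: "0 < A"
    and eq: "horo p a \<inter> horo q b = \<phi> ` {z. (A * z - B)\<^sup>2 = 1 / (a * b) - (1 - p \<bullet> q) / 2}"
    by - (rule horo_Int_horo[OF assms], rule that)
  define D where "D = 1 / (a * b) - (1 - p \<bullet> q) / 2"
  have "horo p a \<inter> horo q b = {} \<longleftrightarrow> (\<forall>z. (A * z - B)\<^sup>2 \<noteq> D)"
    using eq by (simp add: D_def)
  also have "\<dots> \<longleftrightarrow> D < 0"
  proof
    assume *: "\<forall>z. (A * z - B)\<^sup>2 \<noteq> D"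
    show "D < 0"
    proof (rule ccontr)
      assume "\<not> D < 0"
      then have "(A * ((sqrt D + B) / A) - B)\<^sup>2 = D" using A by simp
      then show False using * by blast
    qed
  next
    assume "D < 0" then show "\<forall>z. (A * z - B)\<^sup>2 \<noteq> D" by (metis not_less zero_le_power2)
  qed
  also have "\<dots> \<longleftrightarrow> 2 < a * b * (1 - p \<bullet> q)"
    using ab by (simp add: D_def field_simps)
  finally show ?thesis .
qed

section \<open>Ideal polygons, and horogons as positive vertex weights\<close>

lemma ideal_polygon_vertices:
  assumes "ideal_polygon n v"
  shows "\<And>i. i < n \<Longrightarrow> norm (v i) = 1" "\<And>i j. i < n \<Longrightarrow> j < n \<Longrightarrow> i \<noteq> j \<Longrightarrow> v i \<noteq> v j"
proof -
  obtain \<theta> s where s: "s \<in> {1, -1 :: real}"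
    and \<theta>: "\<And>i j. i < j \<Longrightarrow> j < n \<Longrightarrow> \<theta> i < \<theta> j \<and> \<theta> j < \<theta> i + 2 * pi"
    and v: "\<And>i. i < n \<Longrightarrow> v i = cis (s * \<theta> i)"
    using assms unfolding ideal_polygon_def by blast
  show "norm (v i) = 1" if "i < n" for i using v that by simp
  have lt: "v i \<noteq> v j" if "i < j" "j < n" for i j
  proof
    assume "v i = v j"
    then have "cis (s * (\<theta> j - \<theta> i)) = 1"
      using v that by (simp add: right_diff_distrib cis_divide[symmetric])
    then have "cos (s * (\<theta> j - \<theta> i)) = 1" by (simp add: complex_eq_iff)
    then have "cos (\<theta> j - \<theta> i) = 1" using s cos_minus[of "\<theta> j - \<theta> i"] by auto
    then obtain m :: int where m: "\<theta> j - \<theta> i = 2 * pi * m"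
      by (metis cos_one_2pi_int mult.commute mult.left_commute)
    have "0 < 2 * pi * of_int m" "2 * pi * of_int m < 2 * pi * 1" using \<theta>[OF that] m by linarith+
    then have "0 < m" "m < 1" by (simp_all add: zero_less_mult_iff)
    then show False by simp
  qed
  show "v i \<noteq> v j" if "i < n" "j < n" "i \<noteq> j" for i j
    using lt[of i j] lt[of j i] that by (cases "i < j") auto
qed

definition adjacent :: "nat \<Rightarrow> nat \<Rightarrow> nat \<Rightarrow> bool" where
  "adjacent n i j \<longleftrightarrow> j = Suc i mod n \<or> i = Suc j mod n"

definition horogon_weights :: "nat \<Rightarrow> (nat \<Rightarrow> complex) \<Rightarrow> (nat \<Rightarrow> real) \<Rightarrow> bool" where
  "horogon_weights n v a \<longleftrightarrow> (\<forall>i<n. 0 < a i) \<and>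
    (\<forall>i<n. a i * a (Suc i mod n) * (1 - v i \<bullet> v (Suc i mod n)) = 2)"

definition embedded_weights :: "nat \<Rightarrow> (nat \<Rightarrow> complex) \<Rightarrow> (nat \<Rightarrow> real) \<Rightarrow> bool" where
  "embedded_weights n v a \<longleftrightarrow> horogon_weights n v a \<and>
    (\<forall>i<n. \<forall>j<n. i \<noteq> j \<longrightarrow> \<not> adjacent n i j \<longrightarrow> 2 < a i * a j * (1 - v i \<bullet> v j))"

lemma Suc_mod_neq:
  assumes "2 \<le> n" "i < n"
  shows "Suc i mod n < n" "Suc i mod n \<noteq> i"
  using assms by (auto simp: mod_Suc)

lemma horogon_iff:
  assumes n: "3 \<le> n" and v: "ideal_polygon n v"
  shows "(\<exists>H. immersed_horogon n v H) \<longleftrightarrow> (\<exists>a. horogon_weights n v a)"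
    and "(\<exists>H. embedded_horogon n v H) \<longleftrightarrow> (\<exists>a. embedded_weights n v a)"
proof -
  note v1 = ideal_polygon_vertices[OF v]
  have suc: "Suc i mod n < n" "i \<noteq> Suc i mod n" if "i < n" for i
    using Suc_mod_neq[of n i] n that by auto
  have H_iff: "(\<exists>c. X = horocycle (v i) c) \<longleftrightarrow> (\<exists>a>0. X = horo (v i) a)" if "i < n" for X i
  proof
    show "\<exists>c. X = horocycle (v i) c \<Longrightarrow> \<exists>a>0. X = horo (v i) a"
      using horocycle_eq_horo[OF v1(1)[OF that]] by (metis exp_gt_zero)
    assume "\<exists>a>0. X = horo (v i) a"
    then obtain a where "0 < a" "X = horo (v i) a" by blast
    then show "\<exists>c. X = horocycle (v i) c"
      using horocycle_eq_horo[OF v1(1)[OF that], of "- ln a"] by auto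
  qed
  have tang: "tangent (horo (v i) (a i)) (horo (v (Suc i mod n)) (a (Suc i mod n))) \<longleftrightarrow>
      a i * a (Suc i mod n) * (1 - v i \<bullet> v (Suc i mod n)) = 2" if "i < n" "\<forall>i<n. 0 < a i" for i a
    using tangent_horo_iff[OF v1(1) v1(1) v1(2)] suc[OF that(1)] that by simp
  have disj: "horo (v i) (a i) \<inter> horo (v j) (a j) = {} \<longleftrightarrow> 2 < a i * a j * (1 - v i \<bullet> v j)"
    if "i < n" "j < n" "i \<noteq> j" "\<forall>i<n. 0 < a i" for i j a
    using disjoint_horo_iff[OF v1(1) v1(1) v1(2)] that by simp
  have weights: "\<exists>a. (\<forall>i<n. 0 < a i) \<and> (\<forall>i<n. H i = horo (v i) (a i))"
    if "immersed_horogon n v H" for H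
  proof -
    have "\<exists>a>0. H i = horo (v i) a" if "i < n" for i
      using H_iff[OF that, of "H i"] \<open>immersed_horogon n v H\<close> that by (simp add: immersed_horogon_def)
    then have "\<forall>i. \<exists>a. i < n \<longrightarrow> 0 < a \<and> H i = horo (v i) a" by blast
    from choice[OF this] show ?thesis by blast
  qed
  have imm: "immersed_horogon n v H \<longleftrightarrow> horogon_weights n v a"
    if a: "\<forall>i<n. 0 < a i" "\<forall>i<n. H i = horo (v i) (a i)" for H a
  proof -
    have "\<exists>c. H i = horocycle (v i) c" if "i < n" for i
      using H_iff[OF that, of "H i"] a that by auto
    moreover have "tangent (H i) (H (Suc i mod n)) \<longleftrightarrow>
      a i * a (Suc i mod n) * (1 - v i \<bullet> v (Suc i mod n)) = 2" if "i < n" for i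
      using tang[OF that a(1)] a(2) that suc[OF that] by simp
    ultimately show ?thesis using a(1) by (simp add: immersed_horogon_def horogon_weights_def)
  qed
  have emb: "embedded_horogon n v H \<longleftrightarrow> embedded_weights n v a"
    if a: "\<forall>i<n. 0 < a i" "\<forall>i<n. H i = horo (v i) (a i)" for H a
  proof -
    have "(j \<noteq> i \<and> j \<noteq> Suc i mod n \<and> i \<noteq> Suc j mod n \<longrightarrow> H i \<inter> H j = {}) \<longleftrightarrow>
      (i \<noteq> j \<longrightarrow> \<not> adjacent n i j \<longrightarrow> 2 < a i * a j * (1 - v i \<bullet> v j))" if "i < n" "j < n" for i j
      using that a(2) disj[OF that _ a(1)] unfolding adjacent_def by auto
    then show ?thesis unfolding embedded_horogon_def embedded_weights_def imm[OF a] by blast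
  qed
  show "(\<exists>H. immersed_horogon n v H) \<longleftrightarrow> (\<exists>a. horogon_weights n v a)"
  proof
    show "\<exists>H. immersed_horogon n v H \<Longrightarrow> \<exists>a. horogon_weights n v a" using weights imm by blast
    assume "\<exists>a. horogon_weights n v a"
    then obtain a where a: "horogon_weights n v a" by blast
    then show "\<exists>H. immersed_horogon n v H"
      using imm[of a "\<lambda>i. horo (v i) (a i)"] horogon_weights_def by blast
  qed
  show "(\<exists>H. embedded_horogon n v H) \<longleftrightarrow> (\<exists>a. embedded_weights n v a)"
  proof
    show "\<exists>H. embedded_horogon n v H \<Longrightarrow> \<exists>a. embedded_weights n v a"
      using weights emb by (metis embedded_horogon_def)
    assume "\<exists>a. embedded_weights n v a"
    then obtain a where a: "embedded_weights n v a" by blast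
    then show "\<exists>H. embedded_horogon n v H"
      using emb[of a "\<lambda>i. horo (v i) (a i)"] embedded_weights_def horogon_weights_def by blast
  qed
qed

section \<open>Boundary-tight maps from horogons\<close>

text \<open>For \<open>A * B * (1 - p \<bullet> q) = 2\<close> this is the geodesic from \<open>p\<close> to \<open>q\<close>, parametrised by arc length
  so that it meets the horocycles of weights \<open>A\<close> at \<open>p\<close> and \<open>B\<close> at \<open>q\<close> at time \<open>0\<close>.\<close>

definition geo :: "real \<Rightarrow> complex \<Rightarrow> real \<Rightarrow> complex \<Rightarrow> real \<Rightarrow> complex" where
  "geo A p B q s = ((exp (- s) * A) *\<^sub>R p + (exp s * B) *\<^sub>R q) /\<^sub>R (exp (- s) * A + exp s * B)"

locale geodesic =
  fixes A B :: real and p q :: complex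
  assumes unit: "norm p = 1" "norm q = 1" and pos: "0 < A" "0 < B"
    and normalized: "A * B * (1 - p \<bullet> q) = 2"
begin

text \<open>\<open>(T s, Z s)\<close> is the hyperboloid lift of \<open>geo A p B q s\<close>: half
  the sum of the lightlike vectors \<open>exp (- s) * A * (1, p)\<close> and
  \<open>exp s * B * (1, q)\<close>.\<close>

definition T where "T s = (exp (- s) * A + exp s * B) / 2"
definition Z where "Z s = ((exp (- s) * A / 2) *\<^sub>R p + (exp s * B / 2) *\<^sub>R q)"

lemma geo_eq: "geo A p B q s = Z s /\<^sub>R T s"
proof -
  have "(exp (- s) * A) *\<^sub>R p + (exp s * B) *\<^sub>R q = 2 *\<^sub>R Z s" "exp (- s) * A + exp s * B = 2 * T s"
    by (simp_all add: Z_def T_def scaleR_add_right)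
  then have "geo A p B q s = (2 *\<^sub>R Z s) /\<^sub>R (2 * T s)" by (simp only: geo_def)
  then show ?thesis by simp
qed

lemma T_pos: "0 < T s"
  using pos by (simp add: T_def add_pos_pos)

lemma hyperboloid: "(T s)\<^sup>2 - (norm (Z s))\<^sup>2 = 1"
proof -
  have u: "p \<bullet> p = 1" "q \<bullet> q = 1" using unit by (simp_all add: dot_square_norm)
  have "(T s)\<^sup>2 - (norm (Z s))\<^sup>2 = (exp (- s) * exp s) * (A * B * (1 - p \<bullet> q)) / 2"
    unfolding power2_norm_eq_inner Z_def T_def inner_add_left inner_add_right inner_scaleR_left
      inner_scaleR_right u inner_commute[of q p]
    by (simp add: power2_eq_square field_simps)
  then show ?thesis using normalized by (simp add: mult_exp_exp)
qed

lemma geo_in_hyp_plane: "geo A p B q s \<in> hyp_plane"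
  unfolding geo_eq using hyperboloid_point(1)[OF T_pos hyperboloid] .

end

text \<open>The Minkowski product of two lifts, each half a sum of two lightlike vectors, expands
  bilinearly into four terms; the factor 4 clears the halves.\<close>

lemma hcosh_geo:
  assumes "geodesic A B p q" "geodesic A' B' p' q'"
  shows "4 * hcosh (geo A p B q s) (geo A' p' B' q' t) =
    A * A' * (1 - p \<bullet> p') * exp (- (s + t)) + B * B' * (1 - q \<bullet> q') * exp (s + t) +
    B * A' * (1 - q \<bullet> p') * exp (s - t) + A * B' * (1 - p \<bullet> q') * exp (- (s - t))"
proof -
  interpret a: geodesic A B p q by fact
  interpret b: geodesic A' B' p' q' by fact
  have "exp (- (s + t)) = exp (- s) * exp (- t)" "exp (s + t) = exp s * exp t"
    "exp (s - t) = exp s * exp (- t)" "exp (- (s - t)) = exp (- s) * exp t"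
    by (simp_all add: mult_exp_exp)
  then show ?thesis
    unfolding a.geo_eq b.geo_eq hcosh_hyperboloid[OF a.T_pos a.hyperboloid b.T_pos b.hyperboloid]
    unfolding a.T_def b.T_def a.Z_def b.Z_def inner_add_left inner_add_right inner_scaleR_left inner_scaleR_right
    by (simp add: field_simps)
qed

context geodesic
begin

lemma hcosh_geo_self: "hcosh (geo A p B q s) (geo A p B q t) = cosh (s - t)"
proof -
  have u: "p \<bullet> p = 1" "q \<bullet> q = 1" using unit by (simp_all add: dot_square_norm)
  have "4 * hcosh (geo A p B q s) (geo A p B q t) = (A * B * (1 - p \<bullet> q)) * (exp (s - t) + exp (- (s - t)))"
    unfolding hcosh_geo[OF geodesic_axioms geodesic_axioms] u inner_commute[of q p] by (simp add: algebra_simps)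
  then show ?thesis unfolding normalized by (simp add: cosh_def)
qed

lemma hdist_geo_self: "hdist (geo A p B q s) (geo A p B q t) = \<bar>s - t\<bar>"
proof -
  have "cosh (hdist (geo A p B q s) (geo A p B q t)) = cosh \<bar>s - t\<bar>"
    by (simp add: cosh_hdist geo_in_hyp_plane hcosh_geo_self)
  then show ?thesis
    using hdist_nonneg[OF geo_in_hyp_plane geo_in_hyp_plane] unfolding cosh_real_eq_iff
    by (metis abs_ge_zero abs_of_nonneg)
qed

lemma range_geo: "range (geo A p B q) = open_segment p q"
proof -
  have pq: "p \<noteq> q" using normalized unit by (auto simp: dot_square_norm)
  have conv: "geo A p B q s = (1 - u) *\<^sub>R p + u *\<^sub>R q"
    if "u * (exp (- s) * A) = (1 - u) * (exp s * B)" for u s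
  proof -
    define D where "D = exp (- s) * A + exp s * B"
    have D: "0 < D" using pos by (simp add: D_def add_pos_pos)
    have "(1 - u) * D = exp (- s) * A" "u * D = exp s * B"
      using that by (simp_all add: D_def algebra_simps)
    then have "geo A p B q s = (((1 - u) * D) *\<^sub>R p + (u * D) *\<^sub>R q) /\<^sub>R D" by (simp only: geo_def D_def)
    also have "\<dots> = (inverse D * ((1 - u) * D)) *\<^sub>R p + (inverse D * (u * D)) *\<^sub>R q"
      by (simp only: scaleR_add_right scaleR_scaleR)
    also have "\<dots> = (1 - u) *\<^sub>R p + u *\<^sub>R q"
    proof -
      have "inverse D * (y * D) = y" for y using D by simp
      then show ?thesis by (simp only:)
    qed
    finally show ?thesis .
  qed
  show ?thesis
  proof (intro equalityI subsetI)
    fix x assume "x \<in> range (geo A p B q)"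
    then obtain s where x: "x = geo A p B q s" by blast
    define u where "u = exp s * B / (exp (- s) * A + exp s * B)"
    have D: "0 < exp (- s) * A" "0 < exp s * B" using pos by simp_all
    then have u: "0 < u" "u < 1" by (simp_all add: u_def add_pos_pos)
    have "u * (exp (- s) * A) = (1 - u) * (exp s * B)"
      using D by (simp add: u_def field_simps)
    from conv[OF this] show "x \<in> open_segment p q" using x pq u by (auto simp: in_segment)
  next
    fix x assume "x \<in> open_segment p q"
    then obtain u where u: "0 < u" "u < 1" "x = (1 - u) *\<^sub>R p + u *\<^sub>R q" by (auto simp: in_segment)
    define s where "s = ln (u * A / ((1 - u) * B)) / 2"
    have "exp s * exp s = u * A / ((1 - u) * B)" using u pos by (simp add: s_def mult_exp_exp)
    then have "exp s * exp s * ((1 - u) * B) = u * A" using u pos by simp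
    then have "exp (- s) * (exp s * exp s * ((1 - u) * B)) = exp (- s) * (u * A)" by simp
    moreover have "exp (- s) * (exp s * exp s * ((1 - u) * B)) = (1 - u) * (exp s * B)"
      by (simp add: exp_minus)
    ultimately have "u * (exp (- s) * A) = (1 - u) * (exp s * B)" by simp
    from conv[OF this] have "x = geo A p B q s" using u by simp
    then show "x \<in> range (geo A p B q)" by blast
  qed
qed

lemma arclength_geo: "arclength_param (geo A p B q) (open_segment p q)"
  by (simp add: arclength_param_def range_geo hdist_geo_self)

end

section \<open>Distances between the sides of a polygon under stretching\<close>

lemma cosh_mult_ge_adjacent:
  fixes D r y m m' :: real
  assumes "0 \<le> D" "0 \<le> m" "2 * cosh D = 2 * cosh r + m * exp y" "1 \<le> N" "m' \<le> m ^ N"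
  shows "2 * cosh (real N * r) + m' * exp (real N * y) \<le> 2 * cosh (real N * D)"
proof -
  have e: "(2 * (m * exp y / 2)) ^ N = m ^ N * exp (real N * y)"
    by (simp add: power_mult_distrib exp_of_nat_mult)
  \<comment> \<open>Two sides with a common ideal vertex follow this pattern; superadditivity
    applies with the increment \<open>m * exp y / 2\<close>.\<close>
  have "cosh (real N * r) + (2 * (m * exp y / 2)) ^ N / 2 \<le> cosh (real N * D)"
    by (rule cosh_mult_superadditive) (use assms in auto)
  note this[unfolded e]
  moreover have "m' * exp (real N * y) \<le> m ^ N * exp (real N * y)"
    using assms by (intro mult_right_mono) auto
  ultimately show ?thesis by linarith
qed

lemma power_add_le:
  fixes x y :: real
  assumes "0 \<le> x" "0 \<le> y" "1 \<le> N"
  shows "x ^ N + y ^ N \<le> (x + y) ^ N"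
  using assms(3)
proof (induction N rule: dec_induct)
  case (step N)
  have "x ^ Suc N + y ^ Suc N \<le> (x + y) * (x ^ N + y ^ N)"
    using assms by (simp add: algebra_simps)
  also have "\<dots> \<le> (x + y) * (x + y) ^ N"
    using step assms by (intro mult_left_mono) auto
  finally show ?case by simp
qed simp

text \<open>The pattern of two sides without common endpoint. The term \<open>c3 * exp z\<close>
  becomes \<open>exp r\<close>, and everything else goes into the increment \<open>B\<close>. The
  target term with \<open>d4\<close> is not compared with its own source term: as
  \<open>z >= 0\<close>, it is at most \<open>d4 * (exp (- (N * x)) + exp (N * x))\<close> and is
  charged to the first two terms, hence the sums \<open>d1 + d4\<close> and
  \<open>d2 + d4\<close>.\<close>

lemma cosh_mult_ge_nonadjacent_aux:
  fixes D x z :: real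
  assumes D: "0 \<le> D" "2 * cosh D = c1 * exp (- x) + c2 * exp x + c3 * exp z + c4 * exp (- z)"
    and z: "0 \<le> z" and N: "1 \<le> N"
    and c: "0 \<le> c1" "0 \<le> c2" "1 \<le> c3" "1 \<le> c4" "0 \<le> d4"
    and d: "d1 + d4 \<le> c1 ^ N" "d2 + d4 \<le> c2 ^ N" "d3 \<le> c3 ^ N"
  shows "d1 * exp (- (real N * x)) + d2 * exp (real N * x) + d3 * exp (real N * z) + d4 * exp (- (real N * z))
    \<le> 2 * cosh (real N * D)"
proof -
  define r where "r = z + ln c3"
  have er: "exp r = c3 * exp z" using c by (simp add: r_def exp_add)
  have "exp (- r) = exp (- z) / c3" using c by (simp add: r_def exp_diff)
  also have "\<dots> \<le> 1 * exp (- z)" using c by (simp add: divide_le_eq)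
  also have "\<dots> \<le> c4 * exp (- z)" using c by (intro mult_right_mono) auto
  finally have er': "exp (- r) \<le> c4 * exp (- z)" .
  \<comment> \<open>What remains of \<open>cosh D\<close> after removing \<open>cosh r\<close>; it
    is nonnegative because \<open>c3\<close> and \<open>c4\<close> are at least 1.\<close>
  define B where "B = (c1 * exp (- x) + c2 * exp x + (c4 * exp (- z) - exp (- r))) / 2"
  have B: "c1 * exp (- x) + c2 * exp x \<le> 2 * B" using er' by (simp add: B_def)
  have c12: "0 \<le> c1 * exp (- x)" "0 \<le> c2 * exp x" using c by simp_all
  have "cosh (real N * r) + (2 * B) ^ N / 2 \<le> cosh (real N * D)"
  proof (rule cosh_mult_superadditive[OF D(1) _ _ N])
    show "0 \<le> B" using B c12 by linarith
    show "cosh D = cosh r + B"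
    proof -
      have "2 * cosh r = exp r + exp (- r)" by (simp add: cosh_def)
      moreover have "2 * B = c1 * exp (- x) + c2 * exp x + (c4 * exp (- z) - exp (- r))" by (simp add: B_def)
      ultimately show ?thesis using D(2) er by linarith
    qed
  qed
  moreover have "c1 ^ N * exp (- (real N * x)) + c2 ^ N * exp (real N * x) \<le> (2 * B) ^ N"
  proof -
    have "c1 ^ N * exp (- (real N * x)) + c2 ^ N * exp (real N * x) = (c1 * exp (- x)) ^ N + (c2 * exp x) ^ N"
      by (simp add: power_mult_distrib exp_of_nat_mult[symmetric])
    also have "\<dots> \<le> (c1 * exp (- x) + c2 * exp x) ^ N" by (rule power_add_le[OF c12 N])
    also have "\<dots> \<le> (2 * B) ^ N" using B c12 by (intro power_mono) auto
    finally show ?thesis .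
  qed
  moreover have "c3 ^ N * exp (real N * z) \<le> 2 * cosh (real N * r)"
  proof -
    have "c3 ^ N * exp (real N * z) = (c3 * exp z) ^ N"
      by (simp add: power_mult_distrib exp_of_nat_mult[symmetric])
    also have "\<dots> = exp (real N * r)" by (simp add: er[symmetric] exp_of_nat_mult)
    also have "\<dots> \<le> 2 * cosh (real N * r)" by (simp add: cosh_def)
    finally show ?thesis .
  qed
  moreover have "(d1 + d4) * exp (- (real N * x)) \<le> c1 ^ N * exp (- (real N * x))"
    "(d2 + d4) * exp (real N * x) \<le> c2 ^ N * exp (real N * x)"
    "d3 * exp (real N * z) \<le> c3 ^ N * exp (real N * z)"
    using d by (simp_all add: mult_right_mono)
  moreover have "d4 * exp (- (real N * z)) \<le> d4 * exp (- (real N * x)) + d4 * exp (real N * x)"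
  proof -
    have "exp (- (real N * z)) \<le> 1" using z by simp
    also have "1 \<le> cosh (real N * x)" by (rule cosh_real_ge_1)
    also have "\<dots> \<le> exp (- (real N * x)) + exp (real N * x)" by (simp add: cosh_def)
    finally show ?thesis using c(5) by (metis distrib_left mult_left_mono)
  qed
  ultimately show ?thesis unfolding distrib_right by linarith
qed

text \<open>Replacing \<open>z\<close> by \<open>- z\<close> exchanges the third and fourth terms,
  which is why the conditions on \<open>d3\<close> and \<open>d4\<close> are symmetric.\<close>

lemma cosh_mult_ge_nonadjacent:
  fixes D x z :: real
  assumes D: "0 \<le> D" "2 * cosh D = c1 * exp (- x) + c2 * exp x + c3 * exp z + c4 * exp (- z)"
    and N: "1 \<le> N"
    and c: "0 \<le> c1" "0 \<le> c2" "1 \<le> c3" "1 \<le> c4" "0 \<le> d3" "0 \<le> d4"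
    and d: "d1 + d4 \<le> c1 ^ N" "d2 + d4 \<le> c2 ^ N" "d1 + d3 \<le> c1 ^ N" "d2 + d3 \<le> c2 ^ N"
      "d3 \<le> c3 ^ N" "d4 \<le> c4 ^ N"
  shows "d1 * exp (- (real N * x)) + d2 * exp (real N * x) + d3 * exp (real N * z) + d4 * exp (- (real N * z))
    \<le> 2 * cosh (real N * D)"
proof (cases "0 \<le> z")
  case True
  show ?thesis by (rule cosh_mult_ge_nonadjacent_aux[OF D True N]) (use c d in auto)
next
  case False
  have "d1 * exp (- (real N * x)) + d2 * exp (real N * x) + d4 * exp (real N * (- z)) + d3 * exp (- (real N * (- z)))
    \<le> 2 * cosh (real N * D)"
    by (rule cosh_mult_ge_nonadjacent_aux[where ?c1.0 = c1 and ?c2.0 = c2 and ?c3.0 = c4 and ?c4.0 = c3])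
      (use c d D N False in auto)
  then show ?thesis by simp
qed

text \<open>The exponential of the signed distance between the horocycles at vertices
  \<open>i\<close> and \<open>j\<close>, that is, the square of the lambda length normalised to be 1
  at tangency.\<close>

definition vlam :: "(nat \<Rightarrow> complex) \<Rightarrow> (nat \<Rightarrow> real) \<Rightarrow> nat \<Rightarrow> nat \<Rightarrow> real" where
  "vlam v a i j = a i * a j * (1 - v i \<bullet> v j) / 2"

definition side_param :: "nat \<Rightarrow> (nat \<Rightarrow> complex) \<Rightarrow> (nat \<Rightarrow> real) \<Rightarrow> nat \<Rightarrow> real \<Rightarrow> complex" where
  "side_param n v a i = geo (a i) (v i) (a (Suc i mod n)) (v (Suc i mod n))"

lemma adjacent_commute: "adjacent n i j \<longleftrightarrow> adjacent n j i"
  by (auto simp: adjacent_def)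

lemma Suc_mod_inj:
  assumes "i < n" "j < n" "Suc i mod n = Suc j mod n"
  shows "i = j"
  using assms by (auto simp: mod_Suc split: if_splits)

lemma adjacent_Suc_mod_iff:
  assumes "i < n" "j < n"
  shows "adjacent n (Suc i mod n) (Suc j mod n) \<longleftrightarrow> adjacent n i j"
proof -
  have "Suc i mod n < n" "Suc j mod n < n" using assms by auto
  then show ?thesis
    using Suc_mod_inj[of j n "Suc i mod n"] Suc_mod_inj[of i n "Suc j mod n"] assms by (auto simp: adjacent_def)
qed

lemma side_subset_region:
  assumes n: "2 \<le> n" and v: "\<And>i. i < n \<Longrightarrow> norm (v i) = 1" "\<And>i j. i < n \<Longrightarrow> j < n \<Longrightarrow> i \<noteq> j \<Longrightarrow> v i \<noteq> v j"
    and i: "i < n"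
  shows "side n v i \<subseteq> region n v"
proof -
  have "open_segment (v i) (v (Suc i mod n)) \<subseteq> convex hull (v ` {..<n})"
  proof -
    have "{v i, v (Suc i mod n)} \<subseteq> v ` {..<n}" using i by auto
    then have "closed_segment (v i) (v (Suc i mod n)) \<subseteq> convex hull (v ` {..<n})"
      unfolding segment_convex_hull by (rule hull_mono)
    then show ?thesis using segment_open_subset_closed by blast
  qed
  moreover have "open_segment (v i) (v (Suc i mod n)) \<subseteq> hyp_plane"
  proof
    fix x assume "x \<in> open_segment (v i) (v (Suc i mod n))"
    then have "dist 0 x < dist 0 (v i) \<or> dist 0 x < dist 0 (v (Suc i mod n))"
      using dist_decreases_open_segment by metis
    then show "x \<in> hyp_plane" using v(1)[of i] v(1)[of "Suc i mod n"] i by (auto simp: mem_hyp_plane)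
  qed
  ultimately show ?thesis by (simp add: side_def region_def)
qed

locale weighted_polygon =
  fixes n :: nat and v :: "nat \<Rightarrow> complex" and a :: "nat \<Rightarrow> real"
  assumes n: "3 \<le> n" and v: "ideal_polygon n v" and weights: "horogon_weights n v a"
begin

lemmas norm_v = ideal_polygon_vertices(1)[OF v]
lemmas v_neq = ideal_polygon_vertices(2)[OF v]

lemma suc: "i < n \<Longrightarrow> Suc i mod n < n" "i < n \<Longrightarrow> Suc i mod n \<noteq> i" "i < n \<Longrightarrow> i \<noteq> Suc i mod n"
  using Suc_mod_neq[of n i] n by auto

lemma a_pos: "i < n \<Longrightarrow> 0 < a i"
  using weights by (simp add: horogon_weights_def)

lemma geodesic_side: "i < n \<Longrightarrow> geodesic (a i) (a (Suc i mod n)) (v i) (v (Suc i mod n))"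
  using weights by unfold_locales (auto simp: norm_v a_pos suc horogon_weights_def)

lemma vlam_self: "i < n \<Longrightarrow> vlam v a i i = 0"
  using norm_v[of i] by (simp add: vlam_def dot_square_norm)

lemma vlam_adjacent: "i < n \<Longrightarrow> j < n \<Longrightarrow> adjacent n i j \<Longrightarrow> vlam v a i j = 1"
  using weights by (auto simp: adjacent_def vlam_def horogon_weights_def inner_commute mult.commute)

lemma vlam_nonneg: "i < n \<Longrightarrow> j < n \<Longrightarrow> 0 \<le> vlam v a i j"
proof -
  assume ij: "i < n" "j < n"
  have "v i \<bullet> v j \<le> norm (v i) * norm (v j)" by (rule norm_cauchy_schwarz)
  then show ?thesis using ij a_pos[of i] a_pos[of j] by (simp add: vlam_def norm_v)
qed

lemma hcosh_side_param:
  assumes "i < n" "j < n"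
  defines "i' \<equiv> Suc i mod n" and "j' \<equiv> Suc j mod n"
  shows "2 * hcosh (side_param n v a i s) (side_param n v a j t) =
    vlam v a i j * exp (- (s + t)) + vlam v a i' j' * exp (s + t) +
    vlam v a i' j * exp (s - t) + vlam v a i j' * exp (- (s - t))"
  using hcosh_geo[OF geodesic_side[OF assms(1)] geodesic_side[OF assms(2)], of s t]
  unfolding side_param_def vlam_def i'_def j'_def by (simp add: field_simps)

lemma side_param_in_hyp_plane: "i < n \<Longrightarrow> side_param n v a i s \<in> hyp_plane"
  unfolding side_param_def by (rule geodesic.geo_in_hyp_plane[OF geodesic_side])

lemma hdist_side_param_self: "i < n \<Longrightarrow> hdist (side_param n v a i s) (side_param n v a i t) = \<bar>s - t\<bar>"
  unfolding side_param_def by (rule geodesic.hdist_geo_self[OF geodesic_side])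

lemma range_side_param: "i < n \<Longrightarrow> range (side_param n v a i) = side n v i"
  unfolding side_param_def side_def by (rule geodesic.range_geo[OF geodesic_side])

lemma side_subset: "i < n \<Longrightarrow> side n v i \<subseteq> region n v"
  using side_subset_region[OF _ norm_v v_neq] n by simp

end

text \<open>For two sides without common endpoint, the initial vertices \<open>i\<close>,
  \<open>j\<close> are not adjacent, nor are the terminal ones, whereas the two mixed pairs may be.
  So \<open>pow2\<close> demands room for an extra summand at non-adjacent pairs only, and tangency
  suffices for the mixed ones.\<close>

lemma side_distance_scaled_le:
  assumes v: "weighted_polygon n v a" and w: "weighted_polygon n w b"
    and N: "1 \<le> N"
    and pow1: "\<And>i j. i < n \<Longrightarrow> j < n \<Longrightarrow> i \<noteq> j \<Longrightarrow> vlam w b i j \<le> vlam v a i j ^ N"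
    and pow2: "\<And>i j k l. i < n \<Longrightarrow> j < n \<Longrightarrow> i \<noteq> j \<Longrightarrow> \<not> adjacent n i j \<Longrightarrow> k < n \<Longrightarrow> l < n \<Longrightarrow>
      vlam w b i j + vlam w b k l \<le> vlam v a i j ^ N"
    and ge1: "\<And>i j. i < n \<Longrightarrow> j < n \<Longrightarrow> i \<noteq> j \<Longrightarrow> 1 \<le> vlam v a i j"
    and ij: "i < n" "j < n"
  shows "hdist (side_param n w b i (real N * s)) (side_param n w b j (real N * t))
    \<le> real N * hdist (side_param n v a i s) (side_param n v a j t)"
proof -
  interpret v: weighted_polygon n v a by fact
  interpret w: weighted_polygon n w b by fact
  have *: "hdist (side_param n w b i (real N * s)) (side_param n w b j (real N * t))
    \<le> real N * hdist (side_param n v a i s) (side_param n v a j t)" if ij: "i < n" "j < n"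
    and le: "2 * hcosh (side_param n w b i (real N * s)) (side_param n w b j (real N * t))
      \<le> 2 * cosh (real N * hdist (side_param n v a i s) (side_param n v a j t))" for i j s t
  proof -
    have "0 \<le> real N * hdist (side_param n v a i s) (side_param n v a j t)"
      using hdist_nonneg[OF v.side_param_in_hyp_plane v.side_param_in_hyp_plane] ij by simp
    then show ?thesis
      by (subst hdist_le_iff) (use w.side_param_in_hyp_plane ij le in auto)
  qed
  have D: "0 \<le> hdist (side_param n v a i s) (side_param n v a j t)"
      "2 * cosh (hdist (side_param n v a i s) (side_param n v a j t)) =
        2 * hcosh (side_param n v a i s) (side_param n v a j t)" if "i < n" "j < n" for i j s t
    using hdist_nonneg cosh_hdist v.side_param_in_hyp_plane that by auto
  have next_side: "hdist (side_param n w b i (real N * s)) (side_param n w b (Suc i mod n) (real N * t))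
    \<le> real N * hdist (side_param n v a i s) (side_param n v a (Suc i mod n) t)" if i: "i < n" for i s t
  proof (rule *[OF i v.suc(1)[OF i]])
    define j where "j = Suc i mod n"
    define k where "k = Suc j mod n"
    have jk: "j < n" "k < n" using v.suc i by (auto simp: j_def k_def)
    have ik: "i \<noteq> k" using v.n i by (auto simp: j_def k_def mod_Suc split: if_splits)
    have adj: "adjacent n i j" "adjacent n j k" by (simp_all add: adjacent_def j_def k_def)
    \<comment> \<open>The shared vertex contributes 0 and the two adjacent pairs contribute 1 each,
      which leaves \<open>2 * cosh (s + t)\<close> and one exponential.\<close>
    have form: "2 * hcosh (side_param n v a i s) (side_param n v a j t) = 2 * cosh (s + t) + vlam v a i k * exp (t - s)"
      for s t
      using v.hcosh_side_param[OF i jk(1), of s t] v.vlam_adjacent[OF _ _ adj(1)] v.vlam_adjacent[OF _ _ adj(2)] v.vlam_self[OF jk(1)] i jk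
      unfolding j_def[symmetric] k_def[symmetric] by (simp add: cosh_def)
    have form': "2 * hcosh (side_param n w b i s) (side_param n w b j t) = 2 * cosh (s + t) + vlam w b i k * exp (t - s)"
      for s t
      using w.hcosh_side_param[OF i jk(1), of s t] w.vlam_adjacent[OF _ _ adj(1)] w.vlam_adjacent[OF _ _ adj(2)] w.vlam_self[OF jk(1)] i jk
      unfolding j_def[symmetric] k_def[symmetric] by (simp add: cosh_def)
    have "2 * cosh (real N * (s + t)) + vlam w b i k * exp (real N * (t - s))
      \<le> 2 * cosh (real N * hdist (side_param n v a i s) (side_param n v a j t))"
      using D[OF i jk(1), of s t] form[of s t] v.vlam_nonneg[OF i jk(2)] pow1[OF i jk(2) ik] N
      by (intro cosh_mult_ge_adjacent) auto
    then show "2 * hcosh (side_param n w b i (real N * s)) (side_param n w b (Suc i mod n) (real N * t))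
      \<le> 2 * cosh (real N * hdist (side_param n v a i s) (side_param n v a (Suc i mod n) t))"
      unfolding j_def[symmetric] form' by (simp add: distrib_left right_diff_distrib)
  qed
  define i' where "i' = Suc i mod n"
  define j' where "j' = Suc j mod n"
  consider "i = j" | "j = i'" | "i = j'" | "i \<noteq> j" "j \<noteq> i'" "i \<noteq> j'" by blast
  then show ?thesis
  proof cases
    case 1
    then show ?thesis
      using ij by (simp add: v.hdist_side_param_self w.hdist_side_param_self right_diff_distrib[symmetric] abs_mult)
  next
    case 2
    then show ?thesis using next_side[OF ij(1)] by (simp add: i'_def)
  next
    case 3
    have "hdist (side_param n w b j (real N * t)) (side_param n w b i (real N * s))
      \<le> real N * hdist (side_param n v a j t) (side_param n v a i s)"
      using next_side[OF ij(2)] 3 by (simp add: j'_def)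
    then show ?thesis by (metis hdist_commute)
  next
    case 4
    have lt: "i' < n" "j' < n" using ij v.suc by (simp_all add: i'_def j'_def)
    have ne: "i' \<noteq> j'" using Suc_mod_inj[OF ij] 4 by (auto simp: i'_def j'_def)
    have nadj: "\<not> adjacent n i j" using 4 by (auto simp: adjacent_def i'_def j'_def)
    then have nadj': "\<not> adjacent n i' j'" using adjacent_Suc_mod_iff[OF ij] by (simp add: i'_def j'_def)
    have "vlam w b i j * exp (- (real N * (s + t))) + vlam w b i' j' * exp (real N * (s + t)) +
      vlam w b i' j * exp (real N * (s - t)) + vlam w b i j' * exp (- (real N * (s - t)))
      \<le> 2 * cosh (real N * hdist (side_param n v a i s) (side_param n v a j t))"
    proof (rule cosh_mult_ge_nonadjacent)
      show "2 * cosh (hdist (side_param n v a i s) (side_param n v a j t)) =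
        vlam v a i j * exp (- (s + t)) + vlam v a i' j' * exp (s + t) +
        vlam v a i' j * exp (s - t) + vlam v a i j' * exp (- (s - t))"
        using D(2)[OF ij] v.hcosh_side_param[OF ij] by (simp add: i'_def j'_def)
    qed (use D(1) ij lt N v.vlam_nonneg w.vlam_nonneg ge1 4 ne pow1 pow2 nadj nadj' in auto)
    then show ?thesis
      by (intro *[OF ij]) (simp add: w.hcosh_side_param[OF ij] i'_def j'_def distrib_left right_diff_distrib)
  qed
qed

lemma boundary_tight_exists:
  assumes n: "3 \<le> n" and v: "ideal_polygon n v" and w: "ideal_polygon n w"
    and a: "embedded_weights n v a" and b: "horogon_weights n w b"
  shows "\<exists>f. boundary_tight n v w f"
proof -
  interpret v: weighted_polygon n v a
    using n v a by unfold_locales (simp_all add: embedded_weights_def)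
  interpret w: weighted_polygon n w b
    using n w b by unfold_locales
  \<comment> \<open>A crude bound for every entry, all being nonnegative. Two target values must be
    dominated at once, hence \<open>2 * M\<close> below; powers of the values between non-adjacent
    vertices exceed it eventually, as these values are greater than 1.\<close>
  define M where "M = (\<Sum>i<n. \<Sum>j<n. vlam w b i j)"
  have M: "vlam w b i j \<le> M" if "i < n" "j < n" for i j
  proof -
    have "vlam w b i j \<le> (\<Sum>j<n. vlam w b i j)"
      using that w.vlam_nonneg by (intro member_le_sum) auto
    also have "\<dots> \<le> M" unfolding M_def
      using that w.vlam_nonneg by (intro member_le_sum[of i "{..<n}" "\<lambda>i. \<Sum>j<n. vlam w b i j"] sum_nonneg) auto
    finally show ?thesis .
  qed
  have gt1: "1 < vlam v a i j" if "i < n" "j < n" "i \<noteq> j" "\<not> adjacent n i j" for i j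
    using a that by (simp add: embedded_weights_def vlam_def)
  have "\<forall>\<^sub>F N in sequentially. \<forall>i\<in>{..<n}. \<forall>j\<in>{..<n}. i \<noteq> j \<longrightarrow> \<not> adjacent n i j \<longrightarrow> 2 * M \<le> vlam v a i j ^ N"
  proof (intro eventually_ball_finite ballI finite_lessThan)
    fix i j assume ij: "i \<in> {..<n}" "j \<in> {..<n}"
    show "\<forall>\<^sub>F N in sequentially. i \<noteq> j \<longrightarrow> \<not> adjacent n i j \<longrightarrow> 2 * M \<le> vlam v a i j ^ N"
    proof (cases "i \<noteq> j \<and> \<not> adjacent n i j")
      case True
      then have gt: "1 < vlam v a i j" using gt1 ij by simp
      obtain N where "2 * M < vlam v a i j ^ N" using real_arch_pow[OF gt] by blast
      then have "2 * M \<le> vlam v a i j ^ N'" if "N \<le> N'" for N'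
      proof -
        have "vlam v a i j ^ N \<le> vlam v a i j ^ N'" using that gt by (intro power_increasing) auto
        then show ?thesis using \<open>2 * M < vlam v a i j ^ N\<close> by linarith
      qed
      then show ?thesis unfolding eventually_sequentially by blast
    qed auto
  qed
  then have "\<forall>\<^sub>F N in sequentially. 1 \<le> N \<and> (\<forall>i\<in>{..<n}. \<forall>j\<in>{..<n}. i \<noteq> j \<longrightarrow> \<not> adjacent n i j \<longrightarrow> 2 * M \<le> vlam v a i j ^ N)"
    using eventually_ge_at_top[of 1] by (rule eventually_elim2) simp
  then obtain N where N: "1 \<le> N"
    and pow: "\<And>i j. i < n \<Longrightarrow> j < n \<Longrightarrow> i \<noteq> j \<Longrightarrow> \<not> adjacent n i j \<Longrightarrow> 2 * M \<le> vlam v a i j ^ N"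
    using eventually_happens'[OF sequentially_bot] by force
  define \<gamma> where "\<gamma> = side_param n v a"
  define \<delta> where "\<delta> = side_param n w b"
  \<comment> \<open>The graph of the boundary map: time \<open>s\<close> on a side goes to time
    \<open>N * s\<close> on the corresponding side, both counted from the tangency points.\<close>
  define G where "G = {(\<gamma> i s, \<delta> i (real N * s)) | i s. i < n}"
  define C where "C = convex hull (w ` {..<n})"
  have region_w: "region n w = C \<inter> hyp_plane" by (simp add: region_def C_def)
  have bdry: "hdist (\<delta> i (real N * s)) (\<delta> j (real N * t)) \<le> real N * hdist (\<gamma> i s) (\<gamma> j t)"
    if ij: "i < n" "j < n" for i j s t
    unfolding \<gamma>_def \<delta>_def
  proof (rule side_distance_scaled_le[OF v.weighted_polygon_axioms w.weighted_polygon_axioms N _ _ _ ij])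
    show "vlam w b i j \<le> vlam v a i j ^ N" if "i < n" "j < n" "i \<noteq> j" for i j
    proof (cases "adjacent n i j")
      case True
      then show ?thesis using that by (simp add: v.vlam_adjacent w.vlam_adjacent)
    next
      case False
      then show ?thesis using pow[OF that] M[OF that(1,2)] w.vlam_nonneg[OF that(1,2)] by simp
    qed
    show "vlam w b i j + vlam w b k l \<le> vlam v a i j ^ N"
      if "i < n" "j < n" "i \<noteq> j" "\<not> adjacent n i j" "k < n" "l < n" for i j k l
      using pow[OF that(1-4)] M[OF that(1,2)] M[OF that(5,6)] by simp
    show "1 \<le> vlam v a i j" if "i < n" "j < n" "i \<noteq> j" for i j
      using gt1[OF that] v.vlam_adjacent[OF that(1,2)] by (cases "adjacent n i j") auto
  qed
  have \<delta>_region: "\<delta> i s \<in> region n w" if "i < n" for i s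
    using w.side_subset[OF that] w.range_side_param[OF that] unfolding \<delta>_def by blast
  obtain f where f: "f ` hyp_plane \<subseteq> C \<inter> hyp_plane"
    "\<And>x y. x \<in> hyp_plane \<Longrightarrow> y \<in> hyp_plane \<Longrightarrow> hdist (f x) (f y) \<le> real N * hdist x y"
    "\<And>x y. (x, y) \<in> G \<Longrightarrow> f x = y"
  proof (rule kirszbraun[of G C "real N"])
    have "(\<gamma> 0 0, \<delta> 0 (real N * 0)) \<in> G" unfolding G_def using n by force
    then show "G \<noteq> {}" by blast
    show "G \<subseteq> hyp_plane \<times> (C \<inter> hyp_plane)"
      using \<delta>_region v.side_param_in_hyp_plane by (auto simp: G_def region_w \<gamma>_def)
    show "closed C" "convex C"
      by (simp_all add: C_def compact_imp_closed finite_imp_compact_convex_hull)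
    show "1 \<le> real N" using N by simp
    show "hdist y y' \<le> real N * hdist x x'" if "(x, y) \<in> G" "(x', y') \<in> G" for x y x' y'
      using that bdry by (auto simp: G_def)
  qed (rule that)
  have f\<gamma>: "f (\<gamma> i s) = \<delta> i (real N * s)" if "i < n" for i s
    by (rule f(3)) (use that in \<open>auto simp: G_def\<close>)
  have f_side: "f ` side n v i = side n w i" if i: "i < n" for i
  proof -
    have "f ` side n v i = range (\<lambda>s. \<delta> i (real N * s))"
      unfolding v.range_side_param[OF i, symmetric] \<gamma>_def[symmetric] image_image f\<gamma>[OF i] ..
    also have "\<dots> = range (\<delta> i)"
    proof (intro equalityI subsetI)
      fix x assume "x \<in> range (\<delta> i)"
      then obtain s where "x = \<delta> i s" by blast
      then have "x = \<delta> i (real N * (s / real N))" using N by simp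
      then show "x \<in> range (\<lambda>s. \<delta> i (real N * s))" by blast
    qed auto
    finally show ?thesis using w.range_side_param[OF i] by (simp add: \<delta>_def)
  qed
  have "boundary_tight n v w f"
    unfolding boundary_tight_def
  proof (intro conjI exI[of _ "real N"] allI impI ballI)
    show "f ` region n v \<subseteq> region n w" using f(1) by (auto simp: region_def C_def)
    show "f ` side n v i \<subseteq> side n w i" if "i < n" for i using f_side[OF that] by simp
    show "hdist (f x) (f y) \<le> real N * hdist x y" if "x \<in> region n v" "y \<in> region n v" for x y
      using f(2) that by (simp add: region_def)
    show "f ` polygon_boundary n v = polygon_boundary n w"
      unfolding polygon_boundary_def image_UN using f_side by simp
    fix i \<eta> assume i: "i < n" and \<eta>: "arclength_param \<eta> (side n v i)"
    have iso: "hdist (f x) (f y) = real N * hdist x y" if xy: "x \<in> side n v i" "y \<in> side n v i" for x y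
    proof -
      obtain s t where st: "x = \<gamma> i s" "y = \<gamma> i t" using xy v.range_side_param[OF i] unfolding \<gamma>_def by blast
      show ?thesis
        unfolding st f\<gamma>[OF i] unfolding \<gamma>_def \<delta>_def v.hdist_side_param_self[OF i] w.hdist_side_param_self[OF i]
        by (simp add: right_diff_distrib[symmetric] abs_mult)
    qed
    have range\<eta>: "range \<eta> = side n v i" and dist\<eta>: "\<And>s t. hdist (\<eta> s) (\<eta> t) = \<bar>s - t\<bar>"
      using \<eta> by (auto simp: arclength_param_def)
    have in_side: "\<eta> s \<in> side n v i" for s using range\<eta> by blast
    \<comment> \<open>An arbitrary \<open>\<eta>\<close> need not start at a tangency point. Since
      \<open>f\<close> multiplies distances on the side by exactly \<open>N\<close>, slowing time by
      the factor \<open>N\<close> restores unit speed.\<close>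
    define \<eta>' where "\<eta>' = (\<lambda>t. f (\<eta> (t / real N)))"
    have "range \<eta>' = side n w i"
    proof -
      have "range (\<lambda>t. \<eta> (t / real N)) = range \<eta>"
      proof (intro equalityI subsetI)
        fix x assume "x \<in> range \<eta>"
        then obtain s where "x = \<eta> s" by blast
        then have "x = \<eta> ((real N * s) / real N)" using N by simp
        then show "x \<in> range (\<lambda>t. \<eta> (t / real N))" by blast
      qed auto
      then have "range \<eta>' = f ` range \<eta>" unfolding \<eta>'_def by (metis image_image)
      then show ?thesis using range\<eta> f_side[OF i] by simp
    qed
    moreover have "hdist (\<eta>' s) (\<eta>' t) = \<bar>s - t\<bar>" for s t
      unfolding \<eta>'_def iso[OF in_side in_side] dist\<eta> using N
      by (simp add: diff_divide_distrib[symmetric] abs_divide)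
    moreover have "f (\<eta> t) = \<eta>' (real N * t)" for t using N by (simp add: \<eta>'_def)
    ultimately show "\<exists>\<gamma>'. arclength_param \<gamma>' (side n w i) \<and> (\<forall>t. f (\<eta> t) = \<gamma>' (real N * t))"
      unfolding arclength_param_def by blast
  qed
  then show ?thesis by blast
qed

section \<open>Horogons from boundary-tight maps\<close>

text \<open>Translation along a geodesic multiplies the two weights by reciprocal factors: choosing
  the origin of time is the same as choosing a tangent pair of horocycles at the endpoints.\<close>

lemma geo_shift: "geo A p B q (s + e) = geo (A * exp (- e)) p (B * exp e) q s"
proof -
  have "exp (- (s + e)) * A = exp (- s) * (A * exp (- e))" "exp (s + e) * B = exp s * (B * exp e)"
    by (simp_all add: exp_add exp_diff exp_minus field_simps)
  then show ?thesis by (simp only: geo_def)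
qed

lemma geodesic_shift:
  assumes "geodesic A B p q"
  shows "geodesic (A * exp (- e)) (B * exp e) p q"
proof -
  interpret geodesic A B p q by fact
  have "(A * exp (- e)) * (B * exp e) * (1 - p \<bullet> q) = (exp (- e) * exp e) * (A * B * (1 - p \<bullet> q))"
    by (simp add: algebra_simps)
  also have "\<dots> = 2" by (simp add: normalized mult_exp_exp)
  finally show ?thesis using unit pos by unfold_locales auto
qed

lemma one_minus_inner_pos:
  assumes "norm p = 1" "norm q = (1::real)" "p \<noteq> q"
  shows "0 < 1 - p \<bullet> q"
proof -
  have "0 < (norm (p - q))\<^sup>2 / 2" using assms(3) by simp
  then show ?thesis unfolding one_minus_inner_unit[OF assms(1,2)] .
qed

lemma geodesic_exists:
  assumes "norm p = 1" "norm q = 1" "p \<noteq> q"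
  shows "\<exists>A. geodesic A A p q"
proof
  define d where "d = 1 - p \<bullet> q"
  define A where "A = sqrt (2 / d)"
  have d: "0 < d" unfolding d_def by (rule one_minus_inner_pos[OF assms])
  then have "0 < A" "A * A * d = 2" by (simp_all add: A_def)
  then show "geodesic A A p q" using assms by unfold_locales (auto simp: d_def)
qed

lemma real_isometry:
  fixes h :: "real \<Rightarrow> real"
  assumes "\<And>s t. \<bar>h s - h t\<bar> = \<bar>s - t\<bar>"
  obtains \<sigma> where "\<sigma> \<in> {1, -1}" "\<And>t. h t = \<sigma> * t + h 0"
proof
  define \<sigma> where "\<sigma> = h 1 - h 0"
  have \<sigma>: "\<bar>\<sigma>\<bar> = 1" using assms[of 1 0] by (simp add: \<sigma>_def)
  then show "\<sigma> \<in> {1, -1}" by auto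
  show "h t = \<sigma> * t + h 0" for t
  proof -
    have 1: "\<bar>h t - h 0\<bar> = \<bar>t\<bar>" "\<bar>h t - h 1\<bar> = \<bar>t - 1\<bar>" using assms[of t 0] assms[of t 1] by simp_all
    from \<sigma> have "\<sigma> = 1 \<or> \<sigma> = -1" by arith
    then show ?thesis
    proof
      assume "\<sigma> = 1"
      then show ?thesis using 1 unfolding \<sigma>_def by (auto simp: abs_if split: if_splits)
    next
      assume "\<sigma> = -1"
      then show ?thesis using 1 unfolding \<sigma>_def by (auto simp: abs_if split: if_splits)
    qed
  qed
qed

lemma arclength_param_unique:
  assumes \<alpha>: "arclength_param \<alpha> S" and \<beta>: "arclength_param \<beta> S"
  obtains \<sigma> c where "\<sigma> \<in> {1, -1 :: real}" "\<And>t. \<alpha> t = \<beta> (\<sigma> * t + c)"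
proof -
  have "\<forall>t. \<exists>u. \<alpha> t = \<beta> u" using \<alpha> \<beta> unfolding arclength_param_def by blast
  then obtain h where h: "\<And>t. \<alpha> t = \<beta> (h t)" by metis
  have iso: "\<bar>h s - h t\<bar> = \<bar>s - t\<bar>" for s t
    using \<alpha> \<beta> h[of s] h[of t] unfolding arclength_param_def by metis
  obtain \<sigma> where \<sigma>: "\<sigma> \<in> {1, -1}" "\<And>t. h t = \<sigma> * t + h 0"
    by - (rule real_isometry[of h, OF iso], rule that)
  have "\<alpha> t = \<beta> (\<sigma> * t + h 0)" for t
    using h[of t] by (simp only: \<sigma>(2)[of t])
  then show ?thesis using \<sigma>(1) by (rule that[rotated])
qed

text \<open>By rigidity of isometries of the line, any two parametrisations differ by a translation,
  absorbed here by the weights, and a direction, kept as \<open>\<sigma>\<close>.\<close>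

lemma arclength_param_open_segment:
  assumes \<gamma>: "arclength_param \<gamma> (open_segment p q)" and pq: "norm p = 1" "norm q = 1" "p \<noteq> q"
  shows "\<exists>A B. \<exists>\<sigma>\<in>{1, -1}. geodesic A B p q \<and> (\<forall>t. \<gamma> t = geo A p B q (\<sigma> * t))"
proof -
  obtain A where A: "geodesic A A p q" using geodesic_exists[OF pq] by blast
  obtain \<sigma> c where \<sigma>: "\<sigma> \<in> {1, -1 :: real}" "\<And>t. \<gamma> t = geo A p A q (\<sigma> * t + c)"
    by - (rule arclength_param_unique[OF \<gamma> geodesic.arclength_geo[OF A]], rule that)
  then have "\<forall>t. \<gamma> t = geo (A * exp (- c)) p (A * exp c) q (\<sigma> * t)" by (simp add: geo_shift)
  then show ?thesis using geodesic_shift[OF A, of c] \<sigma>(1) by blast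
qed

text \<open>Both points run back to the ideal points \<open>p\<close> and \<open>p'\<close>; the
  growth rate of \<open>hcosh\<close> recovers the product of the lightlike vectors there, so
  weights can be read off from distances.\<close>

lemma hcosh_geo_limit:
  assumes "geodesic A B p q" "geodesic A' B' p' q'"
  shows "((\<lambda>r. 2 * hcosh (geo A p B q (- r)) (geo A' p' B' q' (- r)) * exp (- 2 * r))
    \<longlongrightarrow> A * A' * (1 - p \<bullet> p') / 2) at_top"
proof -
  define c1 where "c1 = A * A' * (1 - p \<bullet> p')"
  define c2 where "c2 = B * B' * (1 - q \<bullet> q')"
  define c3 where "c3 = B * A' * (1 - q \<bullet> p') + A * B' * (1 - p \<bullet> q')"
  have eq: "2 * hcosh (geo A p B q (- r)) (geo A' p' B' q' (- r)) * exp (- 2 * r)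
    = (c1 + c2 * exp (- 4 * r) + c3 * exp (- 2 * r)) / 2" for r
  proof -
    have "2 * hcosh (geo A p B q (- r)) (geo A' p' B' q' (- r)) * exp (- 2 * r)
      = (4 * hcosh (geo A p B q (- r)) (geo A' p' B' q' (- r))) * exp (- 2 * r) / 2" by simp
    also have "4 * hcosh (geo A p B q (- r)) (geo A' p' B' q' (- r)) = c1 * exp (2 * r) + c2 * exp (- 2 * r) + c3"
      unfolding hcosh_geo[OF assms] c1_def c2_def c3_def by simp
    also have "(c1 * exp (2 * r) + c2 * exp (- 2 * r) + c3) * exp (- 2 * r)
      = c1 * (exp (2 * r) * exp (- 2 * r)) + c2 * (exp (- 2 * r) * exp (- 2 * r)) + c3 * exp (- 2 * r)"
      by (simp add: algebra_simps)
    also have "exp (2 * r) * exp (- 2 * r) = 1" by (simp add: mult_exp_exp)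
    also have "exp (- 2 * r) * exp (- 2 * r) = exp (- 4 * r)" by (simp add: mult_exp_exp)
    finally show ?thesis by simp
  qed
  have e: "((\<lambda>r::real. exp (- k * r)) \<longlongrightarrow> 0) at_top" if "0 < k" for k
    by (intro filterlim_compose[OF exp_at_bot]
        filterlim_tendsto_neg_mult_at_bot[OF tendsto_const _ filterlim_ident]) (use that in simp)
  have "((\<lambda>r. (c1 + c2 * exp (- 4 * r) + c3 * exp (- 2 * r)) / 2) \<longlongrightarrow> (c1 + c2 * 0 + c3 * 0) / 2) at_top"
    by (intro tendsto_intros e) auto
  then show ?thesis unfolding eq by (simp add: c1_def)
qed

text \<open>Consecutive sides are asymptotic, so the offset between their origins is forced to scale by \<open>L\<close>.\<close>

lemma asymptotic_sides:
  fixes L :: real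
  assumes g1: "geodesic A B p q" and g2: "geodesic C D q r"
    and g1': "geodesic A' B' p' q'" and g2': "geodesic C' D' q' r'"
    and pr': "p' \<noteq> r'" and L: "0 < L"
    and sign: "\<sigma> \<in> {1, -1}" "\<tau> \<in> {1, -1}"
    and lip: "\<And>s t. hdist (geo A' p' B' q' (\<sigma> * (L * s))) (geo C' q' D' r' (\<tau> * (L * t)))
      \<le> L * hdist (geo A p B q s) (geo C q D r t)"
  shows "\<sigma> = 1 \<and> \<tau> = 1 \<and> ln (B' / C') = L * ln (B / C)"
proof -
  interpret g1: geodesic A B p q by fact
  interpret g2: geodesic C D q r by fact
  interpret g1': geodesic A' B' p' q' by fact
  interpret g2': geodesic C' D' q' r' by fact
  \<comment> \<open>The signed gap between the horocycles at \<open>q\<close> that belong to the two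
    parametrisations.\<close>
  define \<eta> where "\<eta> = ln (B / C)"
  define \<eta>' where "\<eta>' = ln (B' / C')"
  define m where "m = A * D * (1 - p \<bullet> r)"
  define m' where "m' = A' * D' * (1 - p' \<bullet> r')"
  have e\<eta>: "exp \<eta> = B / C" "exp (- \<eta>) = C / B"
    using g1.pos g2.pos by (simp_all add: \<eta>_def exp_minus)
  have e\<eta>': "exp \<eta>' = B' / C'" "exp (- \<eta>') = C' / B'"
    using g1'.pos g2'.pos by (simp_all add: \<eta>'_def exp_minus)
  have m': "0 < m'" using one_minus_inner_pos[OF g1'.unit(1) g2'.unit(2) pr'] g1'.pos g2'.pos by (simp add: m'_def)
  have form: "4 * hcosh (geo A p B q s) (geo C q D r t) = 4 * cosh (s + t + \<eta>) + m * exp (t - s)" for s t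
  proof -
    have "A * C * (1 - p \<bullet> q) = (A * B * (1 - p \<bullet> q)) * (C / B)" using g1.pos by simp
    then have 1: "A * C * (1 - p \<bullet> q) = 2 * exp (- \<eta>)" by (simp only: g1.normalized e\<eta>)
    have "B * D * (1 - q \<bullet> r) = (C * D * (1 - q \<bullet> r)) * (B / C)" using g2.pos by simp
    then have 2: "B * D * (1 - q \<bullet> r) = 2 * exp \<eta>" by (simp only: g2.normalized e\<eta>)
    have q: "q \<bullet> q = 1" using g1.unit by (simp add: dot_square_norm)
    have "2 * exp (- \<eta>) * exp (- (s + t)) + 2 * exp \<eta> * exp (s + t) = 4 * cosh (s + t + \<eta>)"
      by (simp add: cosh_def exp_add exp_minus exp_diff field_simps)
    then show ?thesis
      unfolding hcosh_geo[OF g1 g2] 1 2 q by (simp add: m_def)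
  qed
  have form': "4 * hcosh (geo A' p' B' q' s) (geo C' q' D' r' t) = 4 * cosh (s + t + \<eta>') + m' * exp (t - s)" for s t
  proof -
    have "A' * C' * (1 - p' \<bullet> q') = (A' * B' * (1 - p' \<bullet> q')) * (C' / B')" using g1'.pos by simp
    then have 1: "A' * C' * (1 - p' \<bullet> q') = 2 * exp (- \<eta>')" by (simp only: g1'.normalized e\<eta>')
    have "B' * D' * (1 - q' \<bullet> r') = (C' * D' * (1 - q' \<bullet> r')) * (B' / C')" using g2'.pos by simp
    then have 2: "B' * D' * (1 - q' \<bullet> r') = 2 * exp \<eta>'" by (simp only: g2'.normalized e\<eta>')
    have q: "q' \<bullet> q' = 1" using g1'.unit by (simp add: dot_square_norm)
    have "2 * exp (- \<eta>') * exp (- (s + t)) + 2 * exp \<eta>' * exp (s + t) = 4 * cosh (s + t + \<eta>')"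
      by (simp add: cosh_def exp_add exp_minus exp_diff field_simps)
    then show ?thesis
      unfolding hcosh_geo[OF g1' g2'] 1 2 q by (simp add: m'_def)
  qed
  \<comment> \<open>The points at times \<open>s\<close> and \<open>- s - \<eta>\<close> lie on a
    common horocycle at \<open>q\<close>. Their distance tends to 0 as both run into the cusp, so
    the images must come together as well.\<close>
  define d where "d = (\<lambda>s. hdist (geo A p B q s) (geo C q D r (- s - \<eta>)))"
  define h' where "h' = (\<lambda>s. hcosh (geo A' p' B' q' (\<sigma> * (L * s))) (geo C' q' D' r' (\<tau> * (L * (- s - \<eta>)))))"
  have e: "((\<lambda>s::real. exp (- 2 * s)) \<longlongrightarrow> 0) at_top"
    by (intro filterlim_compose[OF exp_at_bot]
        filterlim_tendsto_neg_mult_at_bot[OF tendsto_const _ filterlim_ident]) simp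
  have "(d \<longlongrightarrow> arcosh 1) at_top"
  proof -
    have h: "hcosh (geo A p B q s) (geo C q D r (- s - \<eta>)) = 1 + m * exp (- \<eta>) / 4 * exp (- 2 * s)" for s
    proof -
      have "exp (- s - \<eta> - s) = exp (- \<eta>) * exp (- 2 * s)" by (simp add: mult_exp_exp)
      then show ?thesis using form[of s "- s - \<eta>"] by simp
    qed
    have "((\<lambda>s. 1 + m * exp (- \<eta>) / 4 * exp (- 2 * s)) \<longlongrightarrow> 1 + m * exp (- \<eta>) / 4 * 0) at_top"
      by (intro tendsto_intros e)
    then show ?thesis
      unfolding d_def hdist_eq_arcosh h
    proof (intro tendsto_arcosh_strong)
      show "\<forall>\<^sub>F s in at_top. 1 \<le> 1 + m * exp (- \<eta>) / 4 * exp (- 2 * s)"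
        unfolding h[symmetric] by (intro always_eventually allI hcosh_ge_1 g1.geo_in_hyp_plane g2.geo_in_hyp_plane)
    qed simp_all
  qed
  then have "((\<lambda>s. cosh (L * d s)) \<longlongrightarrow> cosh (L * 0)) at_top"
    by (intro tendsto_intros) simp
  then have lim: "((\<lambda>s. cosh (L * d s)) \<longlongrightarrow> 1) at_top" by simp
  have h'_le: "h' s \<le> cosh (L * d s)" for s
  proof -
    have "0 \<le> L * d s" using L hdist_nonneg[OF g1.geo_in_hyp_plane g2.geo_in_hyp_plane] by (simp add: d_def)
    then show ?thesis
      using lip[of s "- s - \<eta>"] unfolding d_def[symmetric] h'_def
      by (simp add: hdist_le_iff d_def g1'.geo_in_hyp_plane g2'.geo_in_hyp_plane)
  qed
  \<comment> \<open>Excludes reversed directions: there \<open>h'\<close> would grow exponentially,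
    while it is bounded by a quantity tending to 1.\<close>
  have bounded: False if kh: "0 < k" "\<And>s. k * exp (2 * L * s) \<le> 4 * h' s" for k
  proof -
    have "filterlim (\<lambda>s. k * exp (2 * L * s)) at_top at_top"
      using kh(1) L
      by (intro filterlim_tendsto_pos_mult_at_top[OF tendsto_const] filterlim_compose[OF exp_at_top]
          filterlim_ident) auto
    then have "\<forall>\<^sub>F s in at_top. 8 < k * exp (2 * L * s)"
      by (simp add: filterlim_at_top_dense)
    moreover have "\<forall>\<^sub>F s in at_top. cosh (L * d s) < 2"
      using lim by (rule order_tendstoD(2)) simp
    ultimately have "\<forall>\<^sub>F s::real in at_top. False"
    proof eventually_elim
      case (elim s)
      then show False using kh(2)[of s] h'_le[of s] by simp
    qed
    then show False by simp
  qed
  have cosh_exp: "exp (x + L * (2 * s)) \<le> 4 * cosh (x + L * (2 * s))" "exp (x + L * (2 * s)) \<le> 4 * cosh (- x - L * (2 * s))" for x s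
  proof -
    show "exp (x + L * (2 * s)) \<le> 4 * cosh (x + L * (2 * s))" by (simp add: cosh_def add_nonneg_pos)
    moreover have "- x - L * (2 * s) = - (x + L * (2 * s))" by simp
    ultimately show "exp (x + L * (2 * s)) \<le> 4 * cosh (- x - L * (2 * s))" by (simp only: cosh_minus)
  qed
  have ee: "exp (x + L * (2 * s)) = exp x * exp (2 * L * s)" for x s by (simp add: mult_exp_exp algebra_simps)
  consider "\<sigma> = 1" "\<tau> = 1" | "\<sigma> = 1" "\<tau> = -1" | "\<sigma> = -1" "\<tau> = 1" | "\<sigma> = -1" "\<tau> = -1" using sign by auto
  then show ?thesis
  proof cases
    case 1
    \<comment> \<open>With both directions kept, the \<open>cosh\<close> term does not depend on
      \<open>s\<close>; letting \<open>s\<close> grow forces it to be 1.\<close>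
    have "cosh (\<eta>' - L * \<eta>) \<le> cosh (L * d s)" for s
    proof -
      have "4 * h' s = 4 * cosh (L * s + L * (- s - \<eta>) + \<eta>') + m' * exp (L * (- s - \<eta>) - L * s)"
        unfolding h'_def 1 by (simp add: form')
      also have "L * s + L * (- s - \<eta>) + \<eta>' = \<eta>' - L * \<eta>" by (simp add: algebra_simps)
      finally have "4 * h' s = 4 * cosh (\<eta>' - L * \<eta>) + m' * exp (L * (- s - \<eta>) - L * s)" .
      moreover have "0 < m' * exp (L * (- s - \<eta>) - L * s)" using m' by simp
      ultimately have "cosh (\<eta>' - L * \<eta>) \<le> h' s" by linarith
      then show ?thesis using h'_le[of s] by simp
    qed
    then have "cosh (\<eta>' - L * \<eta>) \<le> 1"
      using tendsto_lowerbound[OF lim] by (simp add: always_eventually)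
    then have "cosh (\<eta>' - L * \<eta>) = 1" using cosh_real_ge_1[of "\<eta>' - L * \<eta>"] by simp
    then show ?thesis using 1 by (simp add: \<eta>_def \<eta>'_def)
  next
    case 2
    have "exp (L * \<eta> + \<eta>') * exp (2 * L * s) \<le> 4 * h' s" for s
    proof -
      have "4 * h' s = 4 * cosh (L * s + - (L * (- s - \<eta>)) + \<eta>') + m' * exp (- (L * (- s - \<eta>)) - L * s)"
        unfolding h'_def 2 by (simp add: form')
      also have "L * s + - (L * (- s - \<eta>)) + \<eta>' = (L * \<eta> + \<eta>') + L * (2 * s)" by (simp add: algebra_simps)
      finally have "4 * cosh ((L * \<eta> + \<eta>') + L * (2 * s)) \<le> 4 * h' s" using m' by simp
      then show ?thesis using cosh_exp(1)[of "L * \<eta> + \<eta>'" s] unfolding ee by linarith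
    qed
    then show ?thesis using bounded[of "exp (L * \<eta> + \<eta>')"] by simp
  next
    case 3
    have "exp (L * \<eta> - \<eta>') * exp (2 * L * s) \<le> 4 * h' s" for s
    proof -
      have "4 * h' s = 4 * cosh (- (L * s) + L * (- s - \<eta>) + \<eta>') + m' * exp (L * (- s - \<eta>) - - (L * s))"
        unfolding h'_def 3 by (simp add: form')
      also have "- (L * s) + L * (- s - \<eta>) + \<eta>' = - (L * \<eta> - \<eta>') - L * (2 * s)" by (simp add: algebra_simps)
      finally have "4 * cosh (- (L * \<eta> - \<eta>') - L * (2 * s)) \<le> 4 * h' s" using m' by simp
      then show ?thesis using cosh_exp(2)[of "L * \<eta> - \<eta>'" s] unfolding ee by linarith
    qed
    then show ?thesis using bounded[of "exp (L * \<eta> - \<eta>')"] by simp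
  next
    case 4
    \<comment> \<open>Both images run away from \<open>q'\<close>, to \<open>p'\<close> and
      \<open>r'\<close>, and the \<open>cosh\<close> term stays bounded. The growth comes from
      \<open>m'\<close>, positive because \<open>p'\<close> and \<open>r'\<close> differ.\<close>
    have "m' * exp (L * \<eta>) * exp (2 * L * s) \<le> 4 * h' s" for s
    proof -
      have "4 * h' s = 4 * cosh (- (L * s) + - (L * (- s - \<eta>)) + \<eta>') + m' * exp (- (L * (- s - \<eta>)) - - (L * s))"
        unfolding h'_def 4 by (simp add: form')
      also have "- (L * (- s - \<eta>)) - - (L * s) = L * \<eta> + L * (2 * s)" by (simp add: algebra_simps)
      finally show ?thesis
        unfolding ee using cosh_real_nonneg[of "- (L * s) + - (L * (- s - \<eta>)) + \<eta>'"] by (simp add: mult.assoc)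
    qed
    then show ?thesis using bounded[of "m' * exp (L * \<eta>)"] m' by simp
  qed
qed

text \<open>The target enters through its vertex labels \<open>w\<close>, so that it may also be the
  source polygon with shifted labels.\<close>

lemma consecutive_sides:
  fixes L :: real
  assumes n: "3 \<le> n" and v: "ideal_polygon n v"
    and w: "\<And>i. i < n \<Longrightarrow> w i \<noteq> w (Suc (Suc i mod n) mod n)"
    and L: "0 < L"
    and lip: "\<And>x y. x \<in> region n v \<Longrightarrow> y \<in> region n v \<Longrightarrow> hdist (f x) (f y) \<le> L * hdist x y"
    and g: "\<And>i. i < n \<Longrightarrow> geodesic (A i) (B i) (v i) (v (Suc i mod n))"
    and g': "\<And>i. i < n \<Longrightarrow> geodesic (A' i) (B' i) (w i) (w (Suc i mod n))"
    and sign: "\<And>i. i < n \<Longrightarrow> \<sigma> i \<in> {1, -1}"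
    and f: "\<And>i s. i < n \<Longrightarrow> f (geo (A i) (v i) (B i) (v (Suc i mod n)) s)
      = geo (A' i) (w i) (B' i) (w (Suc i mod n)) (\<sigma> i * (L * s))"
    and i: "i < n"
  shows "\<sigma> i = 1 \<and> ln (B' i / A' (Suc i mod n)) = L * ln (B i / A (Suc i mod n))"
proof -
  define j where "j = Suc i mod n"
  have j: "j < n" using i by (auto simp: j_def)
  have region: "geo (A i) (v i) (B i) (v (Suc i mod n)) s \<in> region n v" if "i < n" for i s
  proof -
    have "geo (A i) (v i) (B i) (v (Suc i mod n)) s \<in> side n v i"
      unfolding side_def geodesic.range_geo[OF g[OF that], symmetric] by simp
    then show ?thesis
      using side_subset_region[where v = v, OF _ ideal_polygon_vertices[OF v] that] n by auto
  qed
  have "\<sigma> i = 1 \<and> \<sigma> j = 1 \<and> ln (B' i / A' j) = L * ln (B i / A j)"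
  proof (rule asymptotic_sides)
    show "geodesic (A i) (B i) (v i) (v j)" "geodesic (A' i) (B' i) (w i) (w j)"
      using g[OF i] g'[OF i] by (simp_all add: j_def)
    show "geodesic (A j) (B j) (v j) (v (Suc j mod n))" "geodesic (A' j) (B' j) (w j) (w (Suc j mod n))"
      using g[OF j] g'[OF j] .
    show "w i \<noteq> w (Suc j mod n)" using w[OF i] by (simp add: j_def)
    show "hdist (geo (A' i) (w i) (B' i) (w j) (\<sigma> i * (L * s))) (geo (A' j) (w j) (B' j) (w (Suc j mod n)) (\<sigma> j * (L * t)))
      \<le> L * hdist (geo (A i) (v i) (B i) (v j) s) (geo (A j) (v j) (B j) (v (Suc j mod n)) t)" for s t
      using lip[OF region[OF i] region[OF j], of s t] unfolding f[OF i] f[OF j] by (simp add: j_def)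
  qed (use L sign[OF i] sign[OF j] in auto)
  then show ?thesis by (simp add: j_def)
qed

lemma Suc_Suc_mod_neq:
  assumes "3 \<le> n" "i < n"
  shows "Suc (Suc i mod n) mod n < n" "i \<noteq> Suc (Suc i mod n) mod n"
  using assms by (auto simp: mod_Suc split: if_splits)

text \<open>With \<open>L = 0\<close> every side would collapse to a point and the image of the
  boundary would be finite, but it is the whole boundary of the target; a negative \<open>L\<close>
  contradicts the Lipschitz bound for two points at distance 1.\<close>

lemma boundary_tight_stretch:
  assumes n: "3 \<le> n" and v: "ideal_polygon n v" and w: "ideal_polygon n w"
    and f: "boundary_tight n v w f"
  obtains L where "0 < L"
    "\<And>x y. x \<in> region n v \<Longrightarrow> y \<in> region n v \<Longrightarrow> hdist (f x) (f y) \<le> L * hdist x y"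
    "\<And>i \<gamma>. i < n \<Longrightarrow> arclength_param \<gamma> (side n v i) \<Longrightarrow>
      \<exists>\<gamma>'. arclength_param \<gamma>' (side n w i) \<and> (\<forall>t. f (\<gamma> t) = \<gamma>' (L * t))"
proof -
  note v1 = ideal_polygon_vertices[OF v] and w1 = ideal_polygon_vertices[OF w]
  obtain L where region: "f ` region n v \<subseteq> region n w"
    and lip: "\<forall>x\<in>region n v. \<forall>y\<in>region n v. hdist (f x) (f y) \<le> L * hdist x y"
    and bdry: "f ` polygon_boundary n v = polygon_boundary n w"
    and sides: "\<forall>i<n. \<forall>\<gamma>. arclength_param \<gamma> (side n v i) \<longrightarrow>
      (\<exists>\<gamma>'. arclength_param \<gamma>' (side n w i) \<and> (\<forall>t. f (\<gamma> t) = \<gamma>' (L * t)))"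
    using f unfolding boundary_tight_def by (elim conjE exE) (rule that)
  have param: "\<exists>\<gamma>. arclength_param \<gamma> (side n v i)" if i: "i < n" for i
  proof -
    have "Suc i mod n < n" "i \<noteq> Suc i mod n" using Suc_mod_neq[of n i] n i by auto
    then have "\<exists>A. geodesic A A (v i) (v (Suc i mod n))" using geodesic_exists v1 i by blast
    then show ?thesis unfolding side_def using geodesic.arclength_geo by blast
  qed
  have "0 \<le> L"
  proof -
    have 0: "0 < n" using n by simp
    obtain \<gamma> where \<gamma>: "arclength_param \<gamma> (side n v 0)" using param[OF 0] by blast
    then have "\<gamma> t \<in> region n v" for t
      using side_subset_region[where v = v, OF _ v1 0] n unfolding arclength_param_def by auto
    then have "hdist (f (\<gamma> 1)) (f (\<gamma> 0)) \<le> L * hdist (\<gamma> 1) (\<gamma> 0)" "f (\<gamma> 1) \<in> hyp_plane" "f (\<gamma> 0) \<in> hyp_plane"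
      using lip region by (auto simp: region_def)
    moreover have "hdist (\<gamma> 1) (\<gamma> 0) = 1" using \<gamma> by (simp add: arclength_param_def)
    ultimately show ?thesis using hdist_nonneg[of "f (\<gamma> 1)" "f (\<gamma> 0)"] by simp
  qed
  moreover have "L \<noteq> 0"
  proof
    assume L: "L = 0"
    have "finite (f ` side n v i)" if "i < n" for i
    proof -
      obtain \<gamma> where \<gamma>: "arclength_param \<gamma> (side n v i)" using param[OF \<open>i < n\<close>] by blast
      obtain \<gamma>' where "\<And>t. f (\<gamma> t) = \<gamma>' (L * t)" using sides \<open>i < n\<close> \<gamma> by blast
      then have "f (\<gamma> t) = \<gamma>' 0" for t using L by simp
      moreover have "side n v i = range \<gamma>" using \<gamma> by (simp add: arclength_param_def)
      ultimately have "f ` side n v i \<subseteq> {\<gamma>' 0}" by auto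
      then show ?thesis using finite_subset by blast
    qed
    then have "finite (polygon_boundary n w)"
      unfolding bdry[symmetric] unfolding polygon_boundary_def image_UN by blast
    then have "finite (side n w 0)"
      using n by (auto simp: polygon_boundary_def)
    then show False using w1(2)[of 0 1] n by (simp add: side_def finite_open_segment)
  qed
  ultimately show ?thesis using lip sides by (intro that[of L]) auto
qed

text \<open>Weights \<open>A i\<close>, \<open>B i\<close> on each target side are read off from the
  image of the parametrised source side. The gap at each source vertex is 0, hence also in the
  target: \<open>B i = A (Suc i mod n)\<close>, and the weights close up to a horogon.\<close>

lemma horogon_weights_push:
  assumes n: "3 \<le> n" and v: "ideal_polygon n v" and w: "ideal_polygon n w"
    and f: "boundary_tight n v w f" and a: "horogon_weights n v a"
  shows "\<exists>b. horogon_weights n w b"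
proof -
  interpret v: weighted_polygon n v a using n v a by unfold_locales
  note w1 = ideal_polygon_vertices[OF w]
  obtain L where L: "0 < L"
    and lip: "\<And>x y. x \<in> region n v \<Longrightarrow> y \<in> region n v \<Longrightarrow> hdist (f x) (f y) \<le> L * hdist x y"
    and sides: "\<And>i \<gamma>. i < n \<Longrightarrow> arclength_param \<gamma> (side n v i) \<Longrightarrow>
      \<exists>\<gamma>'. arclength_param \<gamma>' (side n w i) \<and> (\<forall>t. f (\<gamma> t) = \<gamma>' (L * t))"
    by - (rule boundary_tight_stretch[OF n v w f], rule that)
  have "\<forall>i. \<exists>A B \<sigma>. i < n \<longrightarrow> geodesic A B (w i) (w (Suc i mod n)) \<and> \<sigma> \<in> {1, -1} \<and>
    (\<forall>s. f (side_param n v a i s) = geo A (w i) B (w (Suc i mod n)) (\<sigma> * (L * s)))"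
  proof (intro allI)
    fix i
    show "\<exists>A B \<sigma>. i < n \<longrightarrow> geodesic A B (w i) (w (Suc i mod n)) \<and> \<sigma> \<in> {1, -1} \<and>
      (\<forall>s. f (side_param n v a i s) = geo A (w i) B (w (Suc i mod n)) (\<sigma> * (L * s)))"
    proof (cases "i < n")
      case i: True
      have "arclength_param (side_param n v a i) (side n v i)"
        by (simp add: arclength_param_def v.range_side_param v.hdist_side_param_self i)
      then obtain \<gamma>' where \<gamma>': "arclength_param \<gamma>' (side n w i)" "\<And>t. f (side_param n v a i t) = \<gamma>' (L * t)"
        using sides[OF i] by blast
      then show ?thesis
        using arclength_param_open_segment[OF \<gamma>'(1)[unfolded side_def] w1(1) w1(1) w1(2)] i v.suc by (metis)
    qed simp
  qed
  then obtain A B \<sigma> where g': "\<And>i. i < n \<Longrightarrow> geodesic (A i) (B i) (w i) (w (Suc i mod n))"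
    and \<sigma>: "\<And>i. i < n \<Longrightarrow> \<sigma> i \<in> {1, -1}"
    and fs: "\<And>i s. i < n \<Longrightarrow> f (side_param n v a i s) = geo (A i) (w i) (B i) (w (Suc i mod n)) (\<sigma> i * (L * s))"
    by metis
  have BA: "B i = A (Suc i mod n)" if i: "i < n" for i
  proof -
    have "\<sigma> i = 1 \<and> ln (B i / A (Suc i mod n)) = L * ln (a (Suc i mod n) / a (Suc i mod n))"
      by (rule consecutive_sides[OF n v _ L lip v.geodesic_side g' \<sigma> fs[unfolded side_param_def] i])
        (use w1(2) Suc_Suc_mod_neq[OF n] in auto)
    then have "ln (B i / A (Suc i mod n)) = 0" using v.a_pos[OF v.suc(1)[OF i]] by simp
    moreover have "0 < B i" "0 < A (Suc i mod n)"
      using geodesic.pos[OF g'[OF i]] geodesic.pos[OF g'[OF v.suc(1)[OF i]]] by auto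
    ultimately show ?thesis by (simp add: ln_div)
  qed
  have "horogon_weights n w A"
    unfolding horogon_weights_def using geodesic.pos[OF g'] geodesic.normalized[OF g'] BA by metis
  then show ?thesis by blast
qed

text \<open>As the points run into the cusps at vertices \<open>i\<close> and \<open>j\<close>,
  \<open>2 * hcosh\<close> grows like \<open>vlam\<close> times \<open>exp (2 * r)\<close>. The
  distance bound, normalised and taken to the limit, compares the coefficients.\<close>

lemma vlam_le_powr:
  fixes L :: real
  assumes v: "weighted_polygon n v a" and w: "weighted_polygon n w b" and L: "0 < L"
    and ij: "i < n" "j < n" "i \<noteq> j"
    and le: "\<And>r. hdist (side_param n w b i (- (L * r))) (side_param n w b j (- (L * r)))
      \<le> L * hdist (side_param n v a i (- r)) (side_param n v a j (- r))"
  shows "vlam w b i j \<le> vlam v a i j powr L"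
proof -
  interpret v: weighted_polygon n v a by fact
  interpret w: weighted_polygon n w b by fact
  define P where "P = (\<lambda>r. 2 * hcosh (side_param n v a i (- r)) (side_param n v a j (- r)) * exp (- 2 * r))"
  define Q where "Q = (\<lambda>r. 2 * hcosh (side_param n w b i (- r)) (side_param n w b j (- r)) * exp (- 2 * r))"
  have limP: "(P \<longlongrightarrow> vlam v a i j) at_top" and limQ: "(Q \<longlongrightarrow> vlam w b i j) at_top"
    unfolding P_def Q_def side_param_def vlam_def
    using hcosh_geo_limit[OF v.geodesic_side v.geodesic_side] hcosh_geo_limit[OF w.geodesic_side w.geodesic_side] ij by auto
  have Lr: "filterlim (\<lambda>r::real. L * r) at_top at_top"
    by (rule filterlim_tendsto_pos_mult_at_top[OF tendsto_const L filterlim_ident])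
  have pos: "0 < vlam v a i j"
    using one_minus_inner_pos[OF v.norm_v v.norm_v v.v_neq] v.a_pos ij by (simp add: vlam_def)
  have "((\<lambda>r. exp (- (L * r))) \<longlongrightarrow> 0) at_top"
    using Lr by (intro filterlim_compose[OF exp_at_bot] filterlim_compose[OF filterlim_uminus_at_bot_at_top])
  then have "((\<lambda>r. P r powr L + exp (- (L * r)) * exp (- (L * r))) \<longlongrightarrow> vlam v a i j powr L + 0 * 0) at_top"
    using pos by (intro tendsto_intros limP) auto
  moreover have "((\<lambda>r. Q (L * r)) \<longlongrightarrow> vlam w b i j) at_top"
    by (rule filterlim_compose[OF limQ Lr])
  moreover have "Q (L * r) \<le> P r powr L + exp (- (L * r)) * exp (- (L * r))" for r
  proof -
    define x where "x = side_param n v a i (- r)"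
    define y where "y = side_param n v a j (- r)"
    define x' where "x' = side_param n w b i (- (L * r))"
    define y' where "y' = side_param n w b j (- (L * r))"
    have hyp: "x \<in> hyp_plane" "y \<in> hyp_plane" "x' \<in> hyp_plane" "y' \<in> hyp_plane"
      using ij by (simp_all add: x_def y_def x'_def y'_def v.side_param_in_hyp_plane w.side_param_in_hyp_plane)
    define d where "d = hdist x y"
    have d: "0 \<le> d" using hyp by (simp add: d_def hdist_nonneg)
    have "hcosh x' y' \<le> cosh (L * d)"
      using le[of r] hdist_le_iff[OF hyp(3,4), of "L * d"] d L
      by (simp add: x_def y_def x'_def y'_def d_def)
    then have "2 * hcosh x' y' \<le> exp (L * d) + exp (- (L * d))" by (simp add: cosh_def)
    \<comment> \<open>The summand 1 absorbs \<open>exp (- (L * d))\<close>; after multiplication by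
      \<open>E\<close> it tends to 0.\<close>
    also have "\<dots> \<le> (2 * cosh d) powr L + 1"
    proof (intro add_mono)
      have "exp (L * d) = exp d powr L" by (simp add: powr_def)
      also have "\<dots> \<le> (2 * cosh d) powr L" using L by (intro powr_mono2) (auto simp: cosh_def)
      finally show "exp (L * d) \<le> (2 * cosh d) powr L" .
      show "exp (- (L * d)) \<le> 1" using L d by simp
    qed
    also have "2 * cosh d = 2 * hcosh x y" using hyp by (simp add: d_def cosh_hdist)
    finally have le: "2 * hcosh x' y' \<le> (2 * hcosh x y) powr L + 1" .
    define E where "E = exp (- 2 * (L * r))"
    have "2 * hcosh x' y' * E \<le> ((2 * hcosh x y) powr L + 1) * E"
      using le by (rule mult_right_mono) (simp add: E_def)
    moreover have "(2 * hcosh x y) powr L * E = P r powr L"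
    proof -
      have "E = exp (- 2 * r) powr L" by (simp add: E_def powr_def)
      then show ?thesis using hcosh_ge_1[OF hyp(1,2)] by (simp add: P_def x_def y_def powr_mult)
    qed
    moreover have "E = exp (- (L * r)) * exp (- (L * r))" by (simp add: E_def mult_exp_exp)
    moreover have "2 * hcosh x' y' * E = Q (L * r)" by (simp add: Q_def x'_def y'_def E_def)
    ultimately show ?thesis by (simp add: distrib_right)
  qed
  ultimately show ?thesis
    using tendsto_le[OF trivial_limit_at_top_linorder] by (metis (no_types, lifting) add.right_neutral always_eventually mult_zero_left)
qed

text \<open>The target parametrisations are fixed by \<open>b\<close> and those of the source
  adjusted to match. As \<open>L > 0\<close>, a vanishing gap in the target forces one in the
  source. Embeddedness passes over because, for \<open>L > 0\<close> and \<open>x >= 0\<close>,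
  \<open>1 < x powr L\<close> implies \<open>1 < x\<close>.\<close>

lemma horogon_weights_pull:
  assumes n: "3 \<le> n" and v: "ideal_polygon n v" and w: "ideal_polygon n w"
    and f: "boundary_tight n v w f" and b: "horogon_weights n w b"
  shows "\<exists>a. horogon_weights n v a \<and> (embedded_weights n w b \<longrightarrow> embedded_weights n v a)"
proof -
  interpret w: weighted_polygon n w b using n w b by unfold_locales
  note v1 = ideal_polygon_vertices[OF v]
  obtain L where L: "0 < L"
    and lip: "\<And>x y. x \<in> region n v \<Longrightarrow> y \<in> region n v \<Longrightarrow> hdist (f x) (f y) \<le> L * hdist x y"
    and sides: "\<And>i \<gamma>. i < n \<Longrightarrow> arclength_param \<gamma> (side n v i) \<Longrightarrow>
      \<exists>\<gamma>'. arclength_param \<gamma>' (side n w i) \<and> (\<forall>t. f (\<gamma> t) = \<gamma>' (L * t))"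
    by - (rule boundary_tight_stretch[OF n v w f], rule that)
  have "\<forall>i. \<exists>A B \<sigma>. i < n \<longrightarrow> geodesic A B (v i) (v (Suc i mod n)) \<and> \<sigma> \<in> {1, -1} \<and>
    (\<forall>s. f (geo A (v i) B (v (Suc i mod n)) s) = side_param n w b i (\<sigma> * (L * s)))"
  proof (intro allI)
    fix i
    show "\<exists>A B \<sigma>. i < n \<longrightarrow> geodesic A B (v i) (v (Suc i mod n)) \<and> \<sigma> \<in> {1, -1} \<and>
      (\<forall>s. f (geo A (v i) B (v (Suc i mod n)) s) = side_param n w b i (\<sigma> * (L * s)))"
    proof (cases "i < n")
      case i: True
      obtain \<kappa> where \<kappa>: "geodesic \<kappa> \<kappa> (v i) (v (Suc i mod n))"
        using geodesic_exists[OF v1(1)[OF i] v1(1)[OF w.suc(1)[OF i]] v1(2)[OF i w.suc(1)[OF i] w.suc(3)[OF i]]]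
        by blast
      obtain \<gamma>' where \<gamma>': "arclength_param \<gamma>' (side n w i)"
        "\<And>t. f (geo \<kappa> (v i) \<kappa> (v (Suc i mod n)) t) = \<gamma>' (L * t)"
        using sides[OF i geodesic.arclength_geo[OF \<kappa>, folded side_def]] by blast
      have "arclength_param (side_param n w b i) (side n w i)"
        by (simp add: arclength_param_def w.range_side_param w.hdist_side_param_self i)
      then obtain \<sigma> c where \<sigma>: "\<sigma> \<in> {1, -1}" "\<And>t. \<gamma>' t = side_param n w b i (\<sigma> * t + c)"
        by - (rule arclength_param_unique[OF \<gamma>'(1)], assumption, rule that)
      \<comment> \<open>The source shift that cancels the target translation \<open>c\<close>, using
        \<open>\<sigma>\<^sup>2 = 1\<close>.\<close>
      define e where "e = - (\<sigma> * c / L)"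
      have "\<sigma> * (L * (s + e)) + c = \<sigma> * (L * s)" for s
        using \<sigma>(1) L by (auto simp: e_def algebra_simps)
      then have "f (geo (\<kappa> * exp (- e)) (v i) (\<kappa> * exp e) (v (Suc i mod n)) s) = side_param n w b i (\<sigma> * (L * s))" for s
        unfolding geo_shift[symmetric] \<gamma>'(2) \<sigma>(2) by simp
      then show ?thesis using geodesic_shift[OF \<kappa>] \<sigma>(1) by blast
    qed simp
  qed
  then obtain A B \<sigma> where g: "\<And>i. i < n \<Longrightarrow> geodesic (A i) (B i) (v i) (v (Suc i mod n))"
    and \<sigma>: "\<And>i. i < n \<Longrightarrow> \<sigma> i \<in> {1, -1}"
    and fs: "\<And>i s. i < n \<Longrightarrow> f (geo (A i) (v i) (B i) (v (Suc i mod n)) s) = side_param n w b i (\<sigma> i * (L * s))"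
    by metis
  have cons: "\<sigma> i = 1 \<and> ln (b (Suc i mod n) / b (Suc i mod n)) = L * ln (B i / A (Suc i mod n))" if i: "i < n" for i
    by (rule consecutive_sides[OF n v _ L lip g w.geodesic_side \<sigma> fs[unfolded side_param_def] i])
      (use w.v_neq Suc_Suc_mod_neq[OF n] in auto)
  have BA: "B i = A (Suc i mod n)" if i: "i < n" for i
  proof -
    have "ln (B i / A (Suc i mod n)) = 0" using cons[OF i] w.a_pos[OF w.suc(1)[OF i]] L by simp
    moreover have "0 < B i" "0 < A (Suc i mod n)"
      using geodesic.pos[OF g[OF i]] geodesic.pos[OF g[OF w.suc(1)[OF i]]] by auto
    ultimately show ?thesis by (simp add: ln_div)
  qed
  have A: "horogon_weights n v A"
    unfolding horogon_weights_def using geodesic.pos[OF g] geodesic.normalized[OF g] BA by metis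
  interpret v: weighted_polygon n v A using n v A by unfold_locales
  have fside: "f (side_param n v A i s) = side_param n w b i (L * s)" if "i < n" for i s
    using fs[OF that, of s] cons[OF that] BA[OF that] by (simp add: side_param_def)
  have vlam_le: "vlam w b i j \<le> vlam v A i j powr L" if ij: "i < n" "j < n" "i \<noteq> j" for i j
  proof (rule vlam_le_powr[OF v.weighted_polygon_axioms w.weighted_polygon_axioms L ij])
    fix r
    have "side_param n v A i (- r) \<in> region n v" "side_param n v A j (- r) \<in> region n v"
      using v.side_subset v.range_side_param ij by blast+
    from lip[OF this] show "hdist (side_param n w b i (- (L * r))) (side_param n w b j (- (L * r)))
      \<le> L * hdist (side_param n v A i (- r)) (side_param n v A j (- r))"
      by (simp add: fside ij)
  qed
  have "embedded_weights n v A" if emb: "embedded_weights n w b"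
    unfolding embedded_weights_def
  proof (intro conjI A allI impI)
    fix i j assume ij: "i < n" "j < n" "i \<noteq> j" "\<not> adjacent n i j"
    have "1 < vlam w b i j" using emb ij by (simp add: embedded_weights_def vlam_def)
    then have "1 < vlam v A i j powr L" using vlam_le[OF ij(1-3)] by simp
    moreover have "vlam v A i j powr L \<le> 1" if "vlam v A i j \<le> 1"
      using powr_mono2[of L "vlam v A i j" 1] that L v.vlam_nonneg[OF ij(1,2)] by simp
    ultimately have "1 < vlam v A i j" by force
    then show "2 < A i * A j * (1 - v i \<bullet> v j)" by (simp add: vlam_def)
  qed
  then show ?thesis using A by blast
qed

section \<open>The regular ideal polygon\<close>

lemma norm_cis_diff: "norm (cis a - cis b) = 2 * \<bar>sin ((a - b) / 2)\<bar>"
proof (rule power2_eq_imp_eq)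
  have "(norm (cis a - cis b))\<^sup>2 = (cos a - cos b)\<^sup>2 + (sin a - sin b)\<^sup>2"
    by (simp add: cmod_power2)
  also have "\<dots> = ((sin a)\<^sup>2 + (cos a)\<^sup>2) + ((sin b)\<^sup>2 + (cos b)\<^sup>2) - 2 * cos (a - b)"
    by (simp add: cos_diff power2_eq_square algebra_simps)
  also have "\<dots> = (2 * \<bar>sin ((a - b) / 2)\<bar>)\<^sup>2"
  proof -
    have "2 - 2 * cos x = (2 * \<bar>sin (x / 2)\<bar>)\<^sup>2" for x :: real
      using cos_double_sin[of "x / 2"] by (simp add: power_mult_distrib)
    then show ?thesis by simp
  qed
  finally show "(norm (cis a - cis b))\<^sup>2 = (2 * \<bar>sin ((a - b) / 2)\<bar>)\<^sup>2" .
qed auto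

lemma ptolemy_sin:
  fixes x y z :: real
  shows "sin (x + y) * sin (y + z) = sin x * sin z + sin y * sin (x + y + z)"
proof -
  have "(sin y)\<^sup>2 + (cos y)\<^sup>2 = 1" by simp
  then show ?thesis unfolding sin_add cos_add by algebra
qed

text \<open>In either orientation a chord is twice the sine of half the angle difference, which lies
  in \<open>(0, pi)\<close>; the rest is the identity for three consecutive half-arcs.\<close>

lemma ptolemy:
  assumes "ideal_polygon n v" and ijkl: "i < j" "j < k" "k < l" "l < n"
  shows "norm (v i - v k) * norm (v j - v l)
    = norm (v i - v j) * norm (v k - v l) + norm (v j - v k) * norm (v i - v l)"
proof -
  obtain \<theta> s where s: "s \<in> {1, -1 :: real}"
    and \<theta>: "\<And>i j. i < j \<Longrightarrow> j < n \<Longrightarrow> \<theta> i < \<theta> j \<and> \<theta> j < \<theta> i + 2 * pi"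
    and v: "\<And>i. i < n \<Longrightarrow> v i = cis (s * \<theta> i)"
    using assms(1) unfolding ideal_polygon_def by blast
  have chord: "norm (v i - v j) = 2 * sin ((\<theta> j - \<theta> i) / 2)" if "i < j" "j < n" for i j
  proof -
    have "norm (v i - v j) = 2 * \<bar>sin ((s * \<theta> i - s * \<theta> j) / 2)\<bar>"
      using that v by (simp add: norm_cis_diff)
    also have "\<dots> = 2 * \<bar>sin ((\<theta> j - \<theta> i) / 2)\<bar>"
    proof (cases "s = 1")
      case True
      have "(s * \<theta> i - s * \<theta> j) / 2 = - ((\<theta> j - \<theta> i) / 2)"
        unfolding True minus_divide_left by simp
      then show ?thesis by (simp only: sin_minus abs_minus_cancel)
    next
      case False
      then show ?thesis using s by simp
    qed
    also have "0 < sin ((\<theta> j - \<theta> i) / 2)" using \<theta>[OF that] by (intro sin_gt_zero) auto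
    then have "2 * \<bar>sin ((\<theta> j - \<theta> i) / 2)\<bar> = 2 * sin ((\<theta> j - \<theta> i) / 2)" by simp
    finally show ?thesis .
  qed
  define x where "x = (\<theta> j - \<theta> i) / 2"
  define y where "y = (\<theta> k - \<theta> j) / 2"
  define z where "z = (\<theta> l - \<theta> k) / 2"
  have xyz: "(\<theta> k - \<theta> i) / 2 = x + y" "(\<theta> l - \<theta> j) / 2 = y + z" "(\<theta> l - \<theta> i) / 2 = x + y + z"
    by (simp_all add: x_def y_def z_def field_simps)
  have "norm (v i - v k) = 2 * sin (x + y)" "norm (v j - v l) = 2 * sin (y + z)"
    "norm (v i - v j) = 2 * sin x" "norm (v k - v l) = 2 * sin z" "norm (v j - v k) = 2 * sin y"
    "norm (v i - v l) = 2 * sin (x + y + z)"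
    using chord[of i k, unfolded xyz] chord[of j l, unfolded xyz] chord[of i j, folded x_def]
      chord[of k l, folded z_def] chord[of j k, folded y_def] chord[of i l, unfolded xyz] ijkl
    by simp_all
  then show ?thesis using ptolemy_sin[of x y z] by (simp add: algebra_simps)
qed

text \<open>The isometry \<open>g\<close> is given inside the region only, so its action at the
  vertices is recovered from the sides: they keep their direction by the asymptotic argument, and
  growth rates of distances compare the products at the vertices. \<open>c i\<close> plays the role
  of the derivative of the induced boundary map at \<open>v i\<close>.\<close>

lemma regular_shift_factors:
  assumes n: "3 \<le> n" and reg: "regular_ideal_polygon n v"
  obtains c where "\<And>i. i < n \<Longrightarrow> 0 < c i"
    "\<And>i j. i < n \<Longrightarrow> j < n \<Longrightarrow> 1 - v (Suc i mod n) \<bullet> v (Suc j mod n) = c i * c j * (1 - v i \<bullet> v j)"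
proof -
  have v: "ideal_polygon n v" using reg by (simp add: regular_ideal_polygon_def)
  note v1 = ideal_polygon_vertices[OF v]
  have suc: "Suc i mod n < n" "i \<noteq> Suc i mod n" if "i < n" for i
    using Suc_mod_neq[of n i] n that by auto
  have "(\<lambda>i. (i + 1) mod n) \<in> dihedral n"
    unfolding dihedral_def by (rule UN_I[of 1]) (use n in simp_all)
  then have "\<exists>g. isometry_of (region n v) g \<and> (\<forall>i<n. g ` side n v i = side n v ((i + 1) mod n))"
    using reg unfolding regular_ideal_polygon_def by (elim conjE) (drule (1) bspec)
  then obtain g where iso: "isometry_of (region n v) g" and side: "\<And>i. i < n \<Longrightarrow> g ` side n v i = side n v (Suc i mod n)"
    by auto
  have g: "\<And>x y. x \<in> region n v \<Longrightarrow> y \<in> region n v \<Longrightarrow> hdist (g x) (g y) = hdist x y"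
    and g_region: "\<And>x. x \<in> region n v \<Longrightarrow> g x \<in> region n v"
    using iso unfolding isometry_of_def by (auto dest: bij_betwE)
  have region: "side n v i \<subseteq> region n v" if "i < n" for i
    using side_subset_region[where v = v, OF _ v1 that] n by auto
  have "\<forall>i. \<exists>\<kappa>. i < n \<longrightarrow> geodesic \<kappa> \<kappa> (v i) (v (Suc i mod n))"
  proof (intro allI)
    fix i
    show "\<exists>\<kappa>. i < n \<longrightarrow> geodesic \<kappa> \<kappa> (v i) (v (Suc i mod n))"
      using geodesic_exists[of "v i" "v (Suc i mod n)"] v1(1)[of i] v1(1)[of "Suc i mod n"] v1(2)[of i "Suc i mod n"] suc[of i]
      by (cases "i < n") auto
  qed
  then obtain \<kappa> where \<kappa>: "\<And>i. i < n \<Longrightarrow> geodesic (\<kappa> i) (\<kappa> i) (v i) (v (Suc i mod n))" by metis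
  define \<gamma> where "\<gamma> = (\<lambda>i. geo (\<kappa> i) (v i) (\<kappa> i) (v (Suc i mod n)))"
  have \<gamma>_side: "range (\<gamma> i) = side n v i" if "i < n" for i
    unfolding \<gamma>_def side_def by (rule geodesic.range_geo[OF \<kappa>[OF that]])
  have \<gamma>_region: "\<gamma> i s \<in> region n v" if "i < n" for i s
    using \<gamma>_side[OF that] region[OF that] by blast
  define w where "w = (\<lambda>i. v (Suc i mod n))"
  have "\<forall>i. \<exists>A B \<sigma>. i < n \<longrightarrow> geodesic A B (w i) (w (Suc i mod n)) \<and> \<sigma> \<in> {1, -1} \<and>
    (\<forall>s. g (\<gamma> i s) = geo A (w i) B (w (Suc i mod n)) (\<sigma> * s))"
  proof (intro allI)
    fix i
    show "\<exists>A B \<sigma>. i < n \<longrightarrow> geodesic A B (w i) (w (Suc i mod n)) \<and> \<sigma> \<in> {1, -1} \<and>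
      (\<forall>s. g (\<gamma> i s) = geo A (w i) B (w (Suc i mod n)) (\<sigma> * s))"
    proof (cases "i < n")
      case i: True
      have "range (\<lambda>s. g (\<gamma> i s)) = side n v (Suc i mod n)"
        unfolding side[OF i, symmetric] \<gamma>_side[OF i, symmetric] by (simp add: image_image)
      moreover have "hdist (g (\<gamma> i s)) (g (\<gamma> i t)) = \<bar>s - t\<bar>" for s t
        unfolding g[OF \<gamma>_region[OF i] \<gamma>_region[OF i]] unfolding \<gamma>_def by (rule geodesic.hdist_geo_self[OF \<kappa>[OF i]])
      ultimately have "arclength_param (\<lambda>s. g (\<gamma> i s)) (open_segment (w i) (w (Suc i mod n)))"
        by (simp add: arclength_param_def side_def w_def)
      moreover have "norm (w i) = 1" "norm (w (Suc i mod n)) = 1" "w i \<noteq> w (Suc i mod n)"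
        using v1 suc i by (simp_all add: w_def)
      ultimately show ?thesis using arclength_param_open_segment by blast
    qed simp
  qed
  then obtain A B \<sigma> where g': "\<And>i. i < n \<Longrightarrow> geodesic (A i) (B i) (w i) (w (Suc i mod n))"
    and \<sigma>: "\<And>i. i < n \<Longrightarrow> \<sigma> i \<in> {1, -1}"
    and gs: "\<And>i s. i < n \<Longrightarrow> g (\<gamma> i s) = geo (A i) (w i) (B i) (w (Suc i mod n)) (\<sigma> i * s)"
    by metis
  have \<sigma>1: "\<sigma> i = 1" if i: "i < n" for i
  proof -
    \<comment> \<open>An isometry is the case \<open>L = 1\<close>, with the shifted labels as
      target.\<close>
    have "\<sigma> i = 1 \<and> ln (B i / A (Suc i mod n)) = 1 * ln (\<kappa> i / \<kappa> (Suc i mod n))"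
    proof (rule consecutive_sides[where f = g and w = w and \<sigma> = \<sigma>, OF n v _ _ _ \<kappa> g' \<sigma> _ i])
      show "w i \<noteq> w (Suc (Suc i mod n) mod n)" if "i < n" for i
        using v1(2) Suc_Suc_mod_neq[OF n] suc that by (simp add: w_def)
      show "hdist (g x) (g y) \<le> 1 * hdist x y" if "x \<in> region n v" "y \<in> region n v" for x y
        using g[OF that] by simp
      show "g (geo (\<kappa> i) (v i) (\<kappa> i) (v (Suc i mod n)) s) = geo (A i) (w i) (B i) (w (Suc i mod n)) (\<sigma> i * (1 * s))"
        if "i < n" for i s
        using gs[OF that] by (simp add: \<gamma>_def)
    qed simp_all
    then show ?thesis ..
  qed
  have key: "\<kappa> i * \<kappa> j * (1 - v i \<bullet> v j) = A i * A j * (1 - w i \<bullet> w j)" if ij: "i < n" "j < n" for i j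
  proof -
    have hyp: "\<gamma> i s \<in> hyp_plane" "g (\<gamma> i s) \<in> hyp_plane" if "i < n" for i s
      using \<gamma>_region[OF that] g_region by (auto simp: region_def)
    have "hcosh (g (\<gamma> i s)) (g (\<gamma> j t)) = hcosh (\<gamma> i s) (\<gamma> j t)" for s t
      using g[OF \<gamma>_region[OF ij(1)] \<gamma>_region[OF ij(2)], of s t] hyp ij by (metis cosh_hdist)
    then have eq: "hcosh (geo (A i) (w i) (B i) (w (Suc i mod n)) s) (geo (A j) (w j) (B j) (w (Suc j mod n)) t) =
      hcosh (geo (\<kappa> i) (v i) (\<kappa> i) (v (Suc i mod n)) s) (geo (\<kappa> j) (v j) (\<kappa> j) (v (Suc j mod n)) t)" for s t
      using gs ij \<sigma>1 by (simp add: \<gamma>_def)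
    show ?thesis
      using tendsto_unique[OF trivial_limit_at_top_linorder
          hcosh_geo_limit[OF g'[OF ij(1)] g'[OF ij(2)], unfolded eq] hcosh_geo_limit[OF \<kappa>[OF ij(1)] \<kappa>[OF ij(2)]]]
      by simp
  qed
  show ?thesis
  proof (rule that[of "\<lambda>i. \<kappa> i / A i"])
    show "0 < \<kappa> i / A i" if "i < n" for i
      using geodesic.pos(1)[OF \<kappa>[OF that]] geodesic.pos(1)[OF g'[OF that]] by simp
    show "1 - v (Suc i mod n) \<bullet> v (Suc j mod n) = \<kappa> i / A i * (\<kappa> j / A j) * (1 - v i \<bullet> v j)"
      if "i < n" "j < n" for i j
      using key[OF that] geodesic.pos(1)[OF g'[OF that(1)]] geodesic.pos(1)[OF g'[OF that(2)]]
      by (simp add: w_def field_simps)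
  qed
qed

lemma regular_embedded_weights:
  assumes n: "3 \<le> n" and reg: "regular_ideal_polygon n v"
  shows "\<exists>a. embedded_weights n v a"
proof -
  have v: "ideal_polygon n v" using reg by (simp add: regular_ideal_polygon_def)
  note v1 = ideal_polygon_vertices[OF v]
  obtain c where c: "\<And>i. i < n \<Longrightarrow> 0 < c i"
    and shift: "\<And>i j. i < n \<Longrightarrow> j < n \<Longrightarrow> 1 - v (Suc i mod n) \<bullet> v (Suc j mod n) = c i * c j * (1 - v i \<bullet> v j)"
    by - (rule regular_shift_factors[OF n reg], rule that)
  define l where "l = (\<lambda>i j. 1 - v i \<bullet> v j)"
  define s where "s = (\<lambda>i. Suc i mod n)"
  have s: "s i < n" "s i \<noteq> i" if "i < n" for i
    using Suc_mod_neq[of n i] n that by (auto simp: s_def)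
  have bij: "bij_betw s {..<n} {..<n}"
  proof -
    have inj: "inj_on s {..<n}" by (rule inj_onI) (auto simp: s_def dest: Suc_mod_inj)
    then have "s ` {..<n} = {..<n}" using s by (intro endo_inj_surj) auto
    then show ?thesis using inj by (simp add: bij_betw_def)
  qed
  \<comment> \<open>The obstruction to closing up around the cycle. The product of \<open>l\<close>
    over all sides is unchanged by reindexing along the shift, but is also multiplied by the square
    of the product of all \<open>c i\<close>.\<close>
  have c1: "(\<Prod>i<n. c i) = 1"
  proof -
    define C where "C = (\<Prod>i<n. c i)"
    define Q where "Q = (\<Prod>i<n. l i (s i))"
    have C: "0 < C" unfolding C_def using c by (intro prod_pos) auto
    have Q: "0 < Q" unfolding Q_def l_def using s by (intro prod_pos ballI one_minus_inner_pos v1) (auto dest: s(2)[THEN not_sym])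
    have "Q = (\<Prod>i<n. l (s i) (s (s i)))"
      unfolding Q_def by (rule prod.reindex_bij_betw[OF bij, symmetric])
    also have "\<dots> = (\<Prod>i<n. c i * c (s i) * l i (s i))"
      using shift s by (intro prod.cong) (auto simp: l_def s_def)
    also have "\<dots> = C * C * Q"
      using prod.reindex_bij_betw[OF bij, of c] by (simp add: prod.distrib C_def Q_def)
    finally have "C * C = 1" using Q by simp
    then have "(C - 1) * (C + 1) = 0" by (simp add: algebra_simps)
    then show ?thesis using C unfolding C_def[symmetric] by simp
  qed
  define a where "a = (\<lambda>i. \<Prod>j<i. inverse (c j))"
  have a_pos: "0 < a i" if "i \<le> n" for i
    unfolding a_def using c that by (intro prod_pos) auto
  have a_step: "a (s i) * c i = a i" if i: "i < n" for i
  proof (cases "Suc i = n")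
    case True
    \<comment> \<open>At the last label the successor is 0, and \<open>a 0 = 1\<close>; the total
      product being 1 closes the recursion.\<close>
    have "a (Suc i) = 1" unfolding a_def True using prod_inversef[of c "{..<n}"] c1 by (simp add: o_def)
    then have "a i * inverse (c i) = 1" by (simp add: a_def)
    then have "a i = c i" using c[OF i] by (simp add: field_simps)
    then show ?thesis using True by (simp add: s_def a_def)
  next
    case False
    then have "s i = Suc i" using i by (simp add: s_def)
    then show ?thesis using c[OF i] by (simp add: a_def)
  qed
  define m where "m = (\<lambda>i j. a i * a j * l i j)"
  have m_comm: "m i j = m j i" for i j by (simp add: m_def l_def inner_commute)
  have m_shift: "m (s i) (s j) = m i j" if "i < n" "j < n" for i j
  proof -
    have "l (s i) (s j) = c i * c j * l i j" using shift[OF that] by (simp add: l_def s_def)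
    then have "m (s i) (s j) = (a (s i) * c i) * (a (s j) * c j) * l i j" by (simp add: m_def)
    then show ?thesis using a_step that by (simp add: m_def)
  qed
  have m_add: "m (i + k) (j + k) = m i j" if "i + k < n" "j + k < n" for i j k
    using that
  proof (induction k)
    case (Suc k)
    then have "m (s (i + k)) (s (j + k)) = m i j" using m_shift by simp
    then show ?case using Suc by (simp add: s_def)
  qed simp
  define k where "k = m 0 1"
  have m_next: "m i (s i) = k" if "i < n" for i
    using that
  proof (induction i)
    case 0
    then show ?case using n by (simp add: k_def s_def)
  next
    case (Suc i)
    then have "m (s i) (s (s i)) = k" using m_shift[of i "s i"] s by simp
    then show ?case using Suc by (simp add: s_def)
  qed
  have m_pos: "0 < m i j" if "i < n" "j < n" "i \<noteq> j" for i j
    using that a_pos one_minus_inner_pos[OF v1(1) v1(1) v1(2)] by (simp add: m_def l_def)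
  have k: "0 < k" using m_pos n by (simp add: k_def)
  \<comment> \<open>Weighted chords: every vertex occurs once in each product of Ptolemy's relation,
    so the relation persists after weighting.\<close>
  define e where "e = (\<lambda>i j. sqrt (a i) * sqrt (a j) * norm (v i - v j))"
  have e: "(e i j)\<^sup>2 = 2 * m i j" "0 \<le> e i j" "e i j = sqrt (2 * m i j)" if "i < n" "j < n" for i j
  proof -
    have "0 \<le> a i" "0 \<le> a j" using a_pos that by (simp_all add: less_imp_le)
    then show 1: "(e i j)\<^sup>2 = 2 * m i j" and 2: "0 \<le> e i j"
      using one_minus_inner_unit[OF v1(1) v1(1), of i j] that
      by (simp_all add: e_def m_def l_def power_mult_distrib)
    show "e i j = sqrt (2 * m i j)" using 1 2 by (metis real_sqrt_unique)
  qed
  \<comment> \<open>Ptolemy for the vertices \<open>0, 1, d, d + 1\<close>: by shift invariance the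
    two diagonals agree, and so do the sides from 0 to 1 and from \<open>d\<close> to
    \<open>d + 1\<close>; the remaining product is positive.\<close>
  have far: "k < m 0 d" if d: "2 \<le> d" "d + 1 < n" for d
  proof -
    have "norm (v 0 - v d) * norm (v 1 - v (d + 1))
      = norm (v 0 - v 1) * norm (v d - v (d + 1)) + norm (v 1 - v d) * norm (v 0 - v (d + 1))"
      by (rule ptolemy[OF v]) (use d in auto)
    then have "e 0 d * e 1 (d + 1) = e 0 1 * e d (d + 1) + e 1 d * e 0 (d + 1)"
      unfolding e_def by algebra
    moreover have "e 1 (d + 1) = e 0 d" using e(3) m_add[of 0 1 d] d by simp
    moreover have "e d (d + 1) = e 0 1" using e(3) m_add[of 0 d 1] d by (simp add: add.commute)
    moreover have "0 < e 1 d * e 0 (d + 1)"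
      using d e(3) m_pos by (intro mult_pos_pos) auto
    ultimately have "(e 0 1)\<^sup>2 < (e 0 d)\<^sup>2" by (simp add: power2_eq_square)
    then show ?thesis using e(1) d by (simp add: k_def)
  qed
  have far': "k < m i j" if ij: "i < j" "j < n" "\<not> adjacent n i j" for i j
  proof -
    \<comment> \<open>Non-adjacency excludes difference 1 and the pair of first and last label,
      which gives \<open>2 <= j - i\<close> and \<open>j - i + 1 < n\<close>.\<close>
    have "j \<noteq> Suc i" using ij by (auto simp: adjacent_def)
    moreover have "\<not> (i = 0 \<and> Suc j = n)" using ij by (auto simp: adjacent_def)
    ultimately have "k < m 0 (j - i)" using ij by (intro far) auto
    then show ?thesis using m_add[of 0 i "j - i"] ij by simp
  qed
  \<comment> \<open>Rescales the common value \<open>k\<close> of consecutive pairs to the tangency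
    value 2.\<close>
  define b where "b = (\<lambda>i. sqrt (2 / k) * a i)"
  have b: "b i * b j * (1 - v i \<bullet> v j) = 2 / k * m i j" for i j
  proof -
    have "sqrt (2 / k) * sqrt (2 / k) = 2 / k" using k by simp
    then show ?thesis unfolding b_def m_def l_def by algebra
  qed
  have "embedded_weights n v b"
    unfolding embedded_weights_def horogon_weights_def b
  proof (intro conjI allI impI)
    show "0 < b i" if "i < n" for i using a_pos k that by (simp add: b_def)
    show "2 / k * m i (Suc i mod n) = 2" if "i < n" for i
      using m_next[OF that] k by (simp add: s_def)
    show "2 < 2 / k * m i j" if "i < n" "j < n" "i \<noteq> j" "\<not> adjacent n i j" for i j
    proof -
      have "k < m i j"
        using far'[of i j] far'[of j i] that m_comm[of i j] adjacent_commute[of n i j] by (cases "i < j") auto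
      then show ?thesis using k by (simp add: field_simps)
    qed
  qed
  then show ?thesis by blast
qed

theorem theorem1:
  fixes n :: nat and P P_reg :: "nat \<Rightarrow> complex"
  assumes "n \<ge> 3"
    and "ideal_polygon n P"
    and "regular_ideal_polygon n P_reg"
  shows "((\<exists>f. boundary_tight n P P_reg f) \<longleftrightarrow> (\<exists>H. embedded_horogon n P H)) \<and>
    ((\<exists>f. boundary_tight n P_reg P f) \<longleftrightarrow> (\<exists>H. immersed_horogon n P H))"
proof -
  have reg: "ideal_polygon n P_reg" using assms(3) by (simp add: regular_ideal_polygon_def)
  obtain b where b: "embedded_weights n P_reg b" using regular_embedded_weights[OF assms(1,3)] by blast
  then have b': "horogon_weights n P_reg b" by (simp add: embedded_weights_def)
  \<comment> \<open>As weights of a target, \<open>b\<close> is pulled back to \<open>P\<close> with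
    its embeddedness; below, as weights of a source, it is pushed forward, and its embeddedness
    allows the construction of a map to any horogon of \<open>P\<close>.\<close>
  have "(\<exists>f. boundary_tight n P P_reg f) \<longleftrightarrow> (\<exists>a. embedded_weights n P a)"
    using horogon_weights_pull[OF assms(1,2) reg _ b'] b
      boundary_tight_exists[OF assms(1,2) reg _ b'] by blast
  moreover have "(\<exists>f. boundary_tight n P_reg P f) \<longleftrightarrow> (\<exists>a. horogon_weights n P a)"
    using horogon_weights_push[OF assms(1) reg assms(2) _ b']
      boundary_tight_exists[OF assms(1) reg assms(2) b] by blast
  ultimately show ?thesis using horogon_iff[OF assms(1,2)] by simp
qed

end
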